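(* Let $G$ be a finitely generated residually finite group and $\Omega$ a square matrix over $\mathbb{C}G$ with $\mathrm{det}^{\mathrm r}_{\mathcal N(G)}(\Omega)\neq 0$. Then the map $(\phi,t)\mapsto\mathrm{det}^{\mathrm r}_{\mathcal N(G)}(\kappa(\phi,t)\Omega)$ is continuous on $H^1(G;\mathbb{R})\times\mathbb{R}_{>0}$.
   Context: For $\phi\in H^1(G;\mathbb{R})=\mathrm{Hom}(G,\mathbb{R})$ (with its finite-dimensional vector space topology) and $t>0$, the Alexander twist $\kappa(\phi,t):\mathbb{C}G\to\mathbb{C}G$ is the $\mathbb{C}$-linear map $g\mapsto t^{\phi(g)}g$, applied entrywise to matrices. For a $p\times p$ matrix $A$ over $\mathbb{C}G$ (acting on $l^2(G)^p$), $\mathrm{det}^{\mathrm r}_{\mathcal N(G)}(A)$ is the Fuglede–Kadison determinant $\det_{\mathcal N(G)}(A)$ if the induced operator is injective and of determinant class, and $0$ otherwise. *)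

theory Defs
  imports "HOL-Analysis.Analysis" "HOL-Probability.Probability"
begin

text \<open>The group G is a type of class group_add (written additively, not assumed
commutative). Elements of CG are functions 'g => complex with finite support;
l2(G) consists of square-summable functions 'g => complex. A p x p matrix over CG
is a function nat => nat => ('g => complex), only entries with indices below p matter.\<close>

inductive_set gen_subgroup :: "'g::group_add set \<Rightarrow> 'g set" for S where
  gen_zero: "0 \<in> gen_subgroup S"
| gen_base: "s \<in> S \<Longrightarrow> s \<in> gen_subgroup S"
| gen_uminus: "a \<in> gen_subgroup S \<Longrightarrow> - a \<in> gen_subgroup S"
| gen_plus: "a \<in> gen_subgroup S \<Longrightarrow> b \<in> gen_subgroup S \<Longrightarrow> a + b \<in> gen_subgroup S"

definition finitely_generated_grp :: "'g::group_add itself \<Rightarrow> bool" where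
  "finitely_generated_grp _ \<longleftrightarrow> (\<exists>S::'g set. finite S \<and> gen_subgroup S = UNIV)"

definition normal_subgrp :: "'g::group_add set \<Rightarrow> bool" where
  "normal_subgrp N \<longleftrightarrow> 0 \<in> N \<and> (\<forall>a\<in>N. \<forall>b\<in>N. a + b \<in> N) \<and> (\<forall>a\<in>N. - a \<in> N)
     \<and> (\<forall>g. \<forall>a\<in>N. g + a + - g \<in> N)"

definition residually_finite_grp :: "'g::group_add itself \<Rightarrow> bool" where
  "residually_finite_grp _ \<longleftrightarrow>
     (\<forall>g::'g. g \<noteq> 0 \<longrightarrow> (\<exists>N. normal_subgrp N \<and> finite ((\<lambda>x. (+) x ` N) ` UNIV) \<and> g \<notin> N))"

text \<open>H^1(G;R) = Hom(G,R).\<close>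
definition hom_real :: "('g::group_add \<Rightarrow> real) set" where
  "hom_real = {\<phi>. \<forall>a b. \<phi> (a + b) = \<phi> a + \<phi> b}"

definition supp :: "('g \<Rightarrow> complex) \<Rightarrow> 'g set" where
  "supp a = {g. a g \<noteq> 0}"

definition in_CG :: "('g \<Rightarrow> complex) \<Rightarrow> bool" where
  "in_CG a \<longleftrightarrow> finite (supp a)"

text \<open>Convolution x * a where a is finitely supported:
  (x * a)(g) = sum_h x(h) a(h^-1 g) = sum_{k in supp a} x(g k^-1) a(k).\<close>
definition conv :: "('g::group_add \<Rightarrow> complex) \<Rightarrow> ('g \<Rightarrow> complex) \<Rightarrow> 'g \<Rightarrow> complex" where
  "conv x a g = (\<Sum>k\<in>supp a. x (g + - k) * a k)"

definition grp_star :: "('g::group_add \<Rightarrow> complex) \<Rightarrow> 'g \<Rightarrow> complex" where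
  "grp_star a g = cnj (a (- g))"

type_synonym 'g cgmat = "nat \<Rightarrow> nat \<Rightarrow> 'g \<Rightarrow> complex"

definition mat_CG :: "nat \<Rightarrow> 'g cgmat \<Rightarrow> bool" where
  "mat_CG p A \<longleftrightarrow> (\<forall>i<p. \<forall>j<p. in_CG (A i j))"

definition mmult :: "nat \<Rightarrow> 'g::group_add cgmat \<Rightarrow> 'g cgmat \<Rightarrow> 'g cgmat" where
  "mmult p A B = (\<lambda>i j g. (\<Sum>l<p. conv (A i l) (B l j) g))"

definition mstar :: "'g::group_add cgmat \<Rightarrow> 'g cgmat" where
  "mstar A = (\<lambda>i j. grp_star (A j i))"

definition mone :: "'g::group_add cgmat" where
  "mone = (\<lambda>i j g. if i = j \<and> g = 0 then 1 else 0)"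

primrec mpow :: "nat \<Rightarrow> 'g::group_add cgmat \<Rightarrow> nat \<Rightarrow> 'g cgmat" where
  "mpow p A 0 = mone"
| "mpow p A (Suc n) = mmult p A (mpow p A n)"

definition trN :: "nat \<Rightarrow> 'g::group_add cgmat \<Rightarrow> complex" where
  "trN p A = (\<Sum>i<p. A i i 0)"

definition twist :: "('g \<Rightarrow> real) \<Rightarrow> real \<Rightarrow> ('g \<Rightarrow> complex) \<Rightarrow> 'g \<Rightarrow> complex" where
  "twist \<phi> t a = (\<lambda>g. complex_of_real (t powr \<phi> g) * a g)"

definition mtwist :: "('g \<Rightarrow> real) \<Rightarrow> real \<Rightarrow> 'g cgmat \<Rightarrow> 'g cgmat" where
  "mtwist \<phi> t A = (\<lambda>i j. twist \<phi> t (A i j))"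

definition l2 :: "('g \<Rightarrow> complex) set" where
  "l2 = {x. (\<lambda>g. (cmod (x g))\<^sup>2) summable_on UNIV}"

definition op_injective :: "nat \<Rightarrow> 'g::group_add cgmat \<Rightarrow> bool" where
  "op_injective p A \<longleftrightarrow>
     (\<forall>x::nat \<Rightarrow> 'g \<Rightarrow> complex. (\<forall>i<p. x i \<in> l2) \<longrightarrow>
        (\<forall>j<p. (\<lambda>g. \<Sum>i<p. conv (x i) (A i j) g) = (\<lambda>_. 0)) \<longrightarrow> (\<forall>i<p. x i = (\<lambda>_. 0)))"

text \<open>Spectral measure of A^* A with respect to the von Neumann trace: the
(unique) compactly supported finite Borel measure on R whose moments are
trN((A^* A)^n).\<close>
definition spec_measure :: "nat \<Rightarrow> 'g::group_add cgmat \<Rightarrow> real measure" where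
  "spec_measure p A = (THE \<mu>. sets \<mu> = sets borel \<and> finite_measure \<mu>
      \<and> (\<exists>K. emeasure \<mu> (- {0..K}) = 0)
      \<and> (\<forall>n. complex_of_real (\<integral>x. x ^ n \<partial>\<mu>) = trN p (mpow p (mmult p (mstar A) A) n)))"

definition det_class :: "nat \<Rightarrow> 'g::group_add cgmat \<Rightarrow> bool" where
  "det_class p A \<longleftrightarrow>
     (\<integral>\<^sup>+ x. ennreal (indicator {0<..<1} x * - ln x) \<partial>(spec_measure p A)) < \<infinity>"

definition detFK :: "nat \<Rightarrow> 'g::group_add cgmat \<Rightarrow> real" where
  "detFK p A = exp ((1/2) * (\<integral>x. indicator {0<..} x * ln x \<partial>(spec_measure p A)))"

definition detr :: "nat \<Rightarrow> 'g::group_add cgmat \<Rightarrow> real" where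
  "detr p A = (if op_injective p A \<and> det_class p A then detFK p A else 0)"

end

theory Submission
  imports Defs "HOL-Complex_Analysis.Complex_Analysis" "Jordan_Normal_Form.Jordan_Normal_Form_Uniqueness"
    "Jordan_Normal_Form.Schur_Decomposition"
begin

text \<open>Write V(\<psi>) for the regular determinant of the matrix twisted by g \<mapsto> exp (\<psi> g) g, and \<mu> for the spectral
  measure of A^* A. The integral u of ln (x + \<epsilon>) against \<mu> is continuous in \<psi>, because the logarithm is a uniform limit
  of polynomials and each moment is a polynomial in finitely many coefficients; as \<epsilon> decreases to 0, exp (u / 2)
  decreases to V, so V is upper semicontinuous. For the complex twists exp (z \<psi> g), the functional u is subharmonic in z
  and depends only on Re z, since a unitary character preserves the trace; hence u is midpoint convex in \<psi>. This gives
  V(\<psi>)^2 \<le> V(\<psi> + h) V(\<psi> - h), which turns V(0) > 0 into positivity everywhere and upper semicontinuity into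
  continuity. Residual finiteness reduces moments, the existence of \<mu> and subharmonicity to finite matrices.\<close>

section \<open>Gram matrices of finite complex matrices\<close>

text \<open>Moments alone do not control determinants at finite quotients: ln x is unbounded near 0,
  so no polynomial approximates it uniformly there. Every comparison with a finite quotient is
  therefore made at a fixed \<epsilon> > 0, and \<epsilon> tends to 0 only after midpoint convexity
  is known over G itself. A real twist is a ring automorphism that does not respect the star, so it
  relates no two spectral measures directly; a unitary twist does respect it. The complex family exp
  (z \<psi> g) contains both kinds, as its real and imaginary directions. A_z^* A_z is not
  holomorphic in z, but A_0^* A_z is. A Cauchy-Schwarz inequality for determinants passes from one
  to the other, and the maximum modulus principle then replaces potential theory. On
  \<open>hom_real\<close> of a finitely generated group the product topology of functions is the
  vector space topology, because finitely many values determine a homomorphism linearly.\<close>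

definition hadj :: "complex mat \<Rightarrow> complex mat" where
  "hadj C = map_mat cnj (transpose_mat C)"

lemma hadj_carrier [simp]: "C \<in> carrier_mat n m \<Longrightarrow> hadj C \<in> carrier_mat m n"
  by (simp add: hadj_def)

lemma dim_hadj [simp]: "dim_row (hadj C) = dim_col C" "dim_col (hadj C) = dim_row C"
  by (simp_all add: hadj_def)

lemma index_hadj [simp]: "i < dim_col C \<Longrightarrow> j < dim_row C \<Longrightarrow> hadj C $$ (i, j) = cnj (C $$ (j, i))"
  by (simp add: hadj_def)

lemma hadj_mult_add_smult_one:
  assumes "C \<in> carrier_mat n n" "D \<in> carrier_mat n n"
  shows "hadj (hadj C * D + complex_of_real e \<cdot>\<^sub>m 1\<^sub>m n) = hadj D * C + complex_of_real e \<cdot>\<^sub>m 1\<^sub>m n"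
  using assms by (intro eq_matI) (auto simp: hadj_def scalar_prod_def mult.commute intro!: sum.cong)

lemma det_hadj: "C \<in> carrier_mat n n \<Longrightarrow> det (hadj C) = cnj (det C)"
proof -
  assume C: "C \<in> carrier_mat n n"
  have sgn: "cnj (signof q) = signof q" for q :: "nat \<Rightarrow> nat"
    by (simp add: sign_def)
  have "det (map_mat cnj (transpose_mat C)) = cnj (det (transpose_mat C))"
    using C by (simp add: det_def'[of _ n] permutes_in_image sgn)
  then show ?thesis using C by (simp add: hadj_def det_transpose)
qed

section \<open>Hermitian inner products and Gram forms of finite matrices\<close>

definition ip :: "nat \<Rightarrow> complex vec \<Rightarrow> complex vec \<Rightarrow> complex" where
  "ip n x y = (\<Sum>i<n. x $ i * cnj (y $ i))"

lemma ip_self: "ip n x x = complex_of_real (\<Sum>i<n. (cmod (x $ i))\<^sup>2)"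
  by (simp add: ip_def complex_norm_square del: of_real_power)

lemma ip_self_nonneg: "0 \<le> Re (ip n x x)" "Im (ip n x x) = 0"
  unfolding ip_self by (simp_all add: sum_nonneg del: of_real_sum)

lemma ip_self_pos: 
  assumes "x \<in> carrier_vec n" "x \<noteq> 0\<^sub>v n"
  shows "0 < Re (ip n x x)"
proof -
  obtain i where i: "i < n" "x $ i \<noteq> 0"
    using assms by (metis carrier_vecD eq_vecI index_zero_vec(1) index_zero_vec(2))
  have "0 < (\<Sum>i<n. (cmod (x $ i))\<^sup>2)"
    by (rule sum_pos2[of _ i]) (use i in auto)
  then show ?thesis unfolding ip_self by (simp del: of_real_sum)
qed

lemma ip_commute: "ip n y x = cnj (ip n x y)"
  by (simp add: ip_def mult.commute)

lemma ip_add_left: "y \<in> carrier_vec n \<Longrightarrow> ip n (x + y) z = ip n x z + ip n y z"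
  by (simp add: ip_def sum.distrib algebra_simps)

lemma ip_smult_left: "x \<in> carrier_vec n \<Longrightarrow> ip n (c \<cdot>\<^sub>v x) z = c * ip n x z"
  by (simp add: ip_def sum_distrib_left algebra_simps)

lemma ip_add_right: "z \<in> carrier_vec n \<Longrightarrow> ip n x (y + z) = ip n x y + ip n x z"
  by (simp add: ip_def sum.distrib algebra_simps)

lemma ip_smult_right: "z \<in> carrier_vec n \<Longrightarrow> ip n x (c \<cdot>\<^sub>v z) = cnj c * ip n x z"
  by (simp add: ip_def sum_distrib_left algebra_simps)

lemma ip_mult_mat_left:
  assumes "A \<in> carrier_mat n n" "x \<in> carrier_vec n" "y \<in> carrier_vec n"
  shows "ip n (A *\<^sub>v x) y = ip n x (hadj A *\<^sub>v y)"
proof -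
  have "ip n (A *\<^sub>v x) y = (\<Sum>i<n. \<Sum>j<n. A $$ (i,j) * x $ j * cnj (y $ i))"
    using assms by (simp add: ip_def scalar_prod_def sum_distrib_right flip: lessThan_atLeast0)
  also have "\<dots> = (\<Sum>j<n. \<Sum>i<n. A $$ (i,j) * x $ j * cnj (y $ i))"
    by (rule sum.swap)
  also have "\<dots> = ip n x (hadj A *\<^sub>v y)"
    using assms by (auto simp: ip_def scalar_prod_def sum_distrib_left mult_ac lessThan_atLeast0 intro!: sum.cong)
  finally show ?thesis .
qed

lemma hadj_hadj [simp]: "hadj (hadj C) = C"
  by (intro eq_matI) (auto simp: hadj_def)

lemma gram_mult_vec:
  assumes "C \<in> carrier_mat n n" "D \<in> carrier_mat n n" "v \<in> carrier_vec n"
  shows "(hadj C * D + e \<cdot>\<^sub>m 1\<^sub>m n) *\<^sub>v v = hadj C *\<^sub>v (D *\<^sub>v v) + e \<cdot>\<^sub>v v"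
proof -
  have "(e \<cdot>\<^sub>m 1\<^sub>m n) *\<^sub>v v = e \<cdot>\<^sub>v v"
    using assms by auto
  moreover have "hadj C * D *\<^sub>v v = hadj C *\<^sub>v (D *\<^sub>v v)"
    using assms by (intro assoc_mult_mat_vec[of _ n n _ n]) auto
  ultimately show ?thesis
    using assms by (subst add_mult_distrib_mat_vec[of _ n n]) (auto intro!: mult_carrier_mat[of _ n n])
qed

text \<open>For real e \<ge> 0 this is the pairing of the stacked maps v |-> (D v, sqrt e v) and u
  |-> (C u, sqrt e u). Taking C = D gives positivity; different C and D give the mixed block needed
  in \<open>det_gram_cauchy_schwarz\<close>.\<close>

lemma ip_gram:
  assumes "C \<in> carrier_mat n n" "D \<in> carrier_mat n n" "v \<in> carrier_vec n" "u \<in> carrier_vec n"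
  shows "ip n ((hadj C * D + e \<cdot>\<^sub>m 1\<^sub>m n) *\<^sub>v v) u = ip n (D *\<^sub>v v) (C *\<^sub>v u) + e * ip n v u"
  unfolding gram_mult_vec[OF assms(1-3)]
  using assms by (simp add: ip_add_left ip_smult_left ip_mult_mat_left[of "hadj C"] mult_mat_vec_carrier[of _ n n])

section \<open>Eigenvalues, traces of powers and shifted determinants\<close>

lemma upper_triangular_pow_diag:
  assumes "B \<in> carrier_mat n n" "upper_triangular B"
  shows "upper_triangular (B ^\<^sub>m k) \<and> (\<forall>i<n. (B ^\<^sub>m k) $$ (i,i) = (B $$ (i,i)) ^ k)"
proof (induction k)
  case 0
  then show ?case using assms by (auto simp: upper_triangular_def)
next
  case (Suc k)
  have c: "B ^\<^sub>m k \<in> carrier_mat n n" using assms by simp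
  have z: "(B ^\<^sub>m k * B) $$ (i,j) = (\<Sum>l = 0..<n. (B ^\<^sub>m k) $$ (i,l) * B $$ (l,j))" if "i < n" "j < n" for i j
    using that assms c by (simp add: scalar_prod_def)
  have "(B ^\<^sub>m k * B) $$ (i,j) = 0" if "j < i" "i < n" for i j
  proof -
    have "(B ^\<^sub>m k) $$ (i,l) * B $$ (l,j) = 0" if "l < n" for l
    proof (cases "l < i")
      case True
      then show ?thesis using Suc c \<open>i < n\<close> by (auto simp: upper_triangular_def)
    next
      case False
      then show ?thesis using assms \<open>j < i\<close> that by (auto simp: upper_triangular_def)
    qed
    then show ?thesis using z that by simp
  qed
  moreover have "(B ^\<^sub>m k * B) $$ (i,i) = (B $$ (i,i)) ^ Suc k" if "i < n" for i
  proof -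
    have "(B ^\<^sub>m k) $$ (i,l) * B $$ (l,i) = (if l = i then (B $$ (i,i)) ^ Suc k else 0)" if "l < n" for l
    proof -
      consider "l < i" | "l = i" | "i < l" by linarith
      then show ?thesis
      proof cases
        case 1
        then show ?thesis using Suc c \<open>i < n\<close> by (auto simp: upper_triangular_def)
      next
        case 2
        then show ?thesis using Suc \<open>i < n\<close> by (simp add: power_commutes)
      next
        case 3
        then show ?thesis using assms that by (auto simp: upper_triangular_def)
      qed
    qed
    then show ?thesis using z[OF that that] that by simp
  qed
  ultimately show ?case using c assms by (auto simp: upper_triangular_def)
qed

lemma trace_mult_commute:
  fixes A B :: "'a::comm_semiring_0 mat"
  assumes "A \<in> carrier_mat n n" "B \<in> carrier_mat n n"
  shows "(\<Sum>i<n. (A * B) $$ (i,i)) = (\<Sum>i<n. (B * A) $$ (i,i))"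
proof -
  have "(\<Sum>i<n. (A * B) $$ (i,i)) = (\<Sum>i<n. \<Sum>j<n. A $$ (i,j) * B $$ (j,i))"
    using assms by (simp add: scalar_prod_def lessThan_atLeast0)
  also have "\<dots> = (\<Sum>j<n. \<Sum>i<n. A $$ (i,j) * B $$ (j,i))"
    by (rule sum.swap)
  also have "\<dots> = (\<Sum>i<n. (B * A) $$ (i,i))"
    using assms by (simp add: scalar_prod_def lessThan_atLeast0 mult.commute)
  finally show ?thesis .
qed

text \<open>The diagonal of a Schur form lists the eigenvalues with multiplicity, and this one list
  serves the traces of all powers and all shifted determinants at once.\<close>

lemma spectrum_list:
  fixes A :: "complex mat"
  assumes A: "A \<in> carrier_mat n n"
  obtains f where "\<And>i. i < n \<Longrightarrow> eigenvalue A (f i)"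
    and "\<And>k. (\<Sum>i<n. (A ^\<^sub>m k) $$ (i,i)) = (\<Sum>i<n. f i ^ k)"
    and "\<And>e. det (A + e \<cdot>\<^sub>m 1\<^sub>m n) = (\<Prod>i<n. f i + e)"
proof -
  obtain es where es: "char_poly A = (\<Prod>a\<leftarrow>es. [:- a, 1:])"
    using char_poly_factorized[OF A] by blast
  obtain B where B: "B \<in> carrier_mat n n" "upper_triangular B" "similar_mat A B"
    using schur_decomposition_exists[OF A es] by blast
  obtain P Q where wit: "similar_mat_wit A B P Q"
    using B(3) unfolding similar_mat_def by blast
  have PQ: "P * Q = 1\<^sub>m n" "Q * P = 1\<^sub>m n" "A = P * B * Q" "A \<in> carrier_mat n n" "B \<in> carrier_mat n n"
    "P \<in> carrier_mat n n" "Q \<in> carrier_mat n n"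
    using similar_mat_witD[OF carrier_matD(1)[OF A, symmetric] wit] .
  define f where "f i = B $$ (i,i)" for i
  have ev: "eigenvalue A (f i)" if "i < n" for i
  proof -
    have "poly (char_poly A) (f i) = poly (\<Prod>a\<leftarrow>diag_mat B. [:- a, 1:]) (f i)"
      using char_poly_similar[OF B(3)] char_poly_upper_triangular[OF B(1,2)] by simp
    also have "\<dots> = 0"
    proof -
      have "f i \<in> set (diag_mat B)"
        using that B by (auto simp: f_def diag_mat_def)
      then show ?thesis
        by (simp add: poly_prod_list prod_list_zero_iff)
    qed
    finally show ?thesis using eigenvalue_root_char_poly[OF A] by simp
  qed
  have tr: "(\<Sum>i<n. (A ^\<^sub>m k) $$ (i,i)) = (\<Sum>i<n. f i ^ k)" for k
  proof -
    have Bk: "B ^\<^sub>m k \<in> carrier_mat n n" using B by simp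
    have "A ^\<^sub>m k = P * B ^\<^sub>m k * Q"
      using similar_mat_wit_pow_id[OF wit] .
    then have "(\<Sum>i<n. (A ^\<^sub>m k) $$ (i,i)) = (\<Sum>i<n. (Q * (P * B ^\<^sub>m k)) $$ (i,i))"
      using trace_mult_commute[of "P * B ^\<^sub>m k" n Q] PQ(6,7) Bk by simp
    also have "Q * (P * B ^\<^sub>m k) = B ^\<^sub>m k"
      using PQ(2,6,7) Bk by (simp add: assoc_mult_mat[symmetric, of _ n n _ n _ n] left_mult_one_mat[of _ n n])
    finally show ?thesis
      using upper_triangular_pow_diag[OF B(1,2)] by (simp add: f_def)
  qed
  have dt: "det (A + e \<cdot>\<^sub>m 1\<^sub>m n) = (\<Prod>i<n. f i + e)" for e
  proof -
    have "similar_mat (char_matrix A (-e)) (char_matrix B (-e))"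
      using similar_mat_wit_char_matrix[OF wit] unfolding similar_mat_def by blast
    then have "det (A + e \<cdot>\<^sub>m 1\<^sub>m n) = det (B + e \<cdot>\<^sub>m 1\<^sub>m n)"
      using det_similar A B by (fastforce simp: char_matrix_def)
    also have "\<dots> = prod_list (diag_mat (B + e \<cdot>\<^sub>m 1\<^sub>m n))"
      by (rule det_upper_triangular[of _ n]) (use B in \<open>auto simp: upper_triangular_def\<close>)
    also have "\<dots> = (\<Prod>i<n. f i + e)"
      using B by (simp add: prod_list_diag_prod f_def lessThan_atLeast0)
    finally show ?thesis .
  qed
  show thesis using that[OF ev tr dt] .
qed

text \<open>Read the eigenvector equation at a coordinate of maximal modulus. Row sums are the right
  measure of size here because those of a finite quotient are bounded independently of the
  quotient.\<close>

lemma eigenvalue_le_row_sum: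
  fixes A :: "complex mat"
  assumes A: "A \<in> carrier_mat n n" and ev: "eigenvalue A l"
    and K: "\<And>i. i < n \<Longrightarrow> (\<Sum>j<n. cmod (A $$ (i,j))) \<le> K"
  shows "cmod l \<le> K"
proof -
  obtain v where v: "v \<in> carrier_vec n" "v \<noteq> 0\<^sub>v n" "A *\<^sub>v v = l \<cdot>\<^sub>v v"
    using ev A unfolding eigenvalue_def eigenvector_def by auto
  obtain k where k: "k < n" "v $ k \<noteq> 0"
    using v by (metis carrier_vecD eq_vecI index_zero_vec(1) index_zero_vec(2))
  define m where "m = Max ((\<lambda>i. cmod (v $ i)) ` {..<n})"
  have "m \<in> (\<lambda>i. cmod (v $ i)) ` {..<n}"
    unfolding m_def using k by (intro Max_in) auto
  then obtain i where i: "i < n" "m = cmod (v $ i)" by auto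
  have le: "cmod (v $ j) \<le> m" if "j < n" for j
    unfolding m_def using that by (intro Max_ge) auto
  have pos: "0 < m" using le[OF k(1)] k by (meson less_le_trans zero_less_norm_iff)
  have "l * v $ i = (\<Sum>j<n. A $$ (i,j) * v $ j)"
  proof -
    have "l * v $ i = (A *\<^sub>v v) $ i" unfolding v(3) using v(1) i by simp
    also have "\<dots> = (\<Sum>j<n. A $$ (i,j) * v $ j)"
      using A v(1) i by (simp add: scalar_prod_def lessThan_atLeast0)
    finally show ?thesis .
  qed
  then have "cmod l * m \<le> (\<Sum>j<n. cmod (A $$ (i,j) * v $ j))"
    using i by (metis norm_mult norm_sum)
  also have "\<dots> \<le> (\<Sum>j<n. cmod (A $$ (i,j)) * m)"
    using le by (intro sum_mono) (auto simp: norm_mult mult_left_mono)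
  also have "\<dots> \<le> K * m"
    using K[OF i(1)] pos by (simp add: sum_distrib_right[symmetric])
  finally show ?thesis using pos by simp
qed

text \<open>An eigenvector v satisfies f * <v, v> = <C v, C v>, so the eigenvalue is real and
  nonnegative. This lets finite spectra be read as measures on an interval [0, K].\<close>

lemma gram_spectrum:
  assumes C: "C \<in> carrier_mat n n"
    and K: "\<And>i. i < n \<Longrightarrow> (\<Sum>j<n. cmod ((hadj C * C) $$ (i,j))) \<le> K"
  obtains f :: "nat \<Rightarrow> real" where "\<And>i. i < n \<Longrightarrow> 0 \<le> f i \<and> f i \<le> K"
    and "\<And>k. (\<Sum>i<n. ((hadj C * C) ^\<^sub>m k) $$ (i,i)) = complex_of_real (\<Sum>i<n. f i ^ k)"
    and "\<And>e. det (hadj C * C + complex_of_real e \<cdot>\<^sub>m 1\<^sub>m n) = complex_of_real (\<Prod>i<n. f i + e)"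
proof -
  have H: "hadj C * C \<in> carrier_mat n n" using C by (metis hadj_carrier mult_carrier_mat)
  obtain f where f: "\<And>i. i < n \<Longrightarrow> eigenvalue (hadj C * C) (f i)"
    "\<And>k. (\<Sum>i<n. ((hadj C * C) ^\<^sub>m k) $$ (i,i)) = (\<Sum>i<n. f i ^ k)"
    "\<And>e. det (hadj C * C + e \<cdot>\<^sub>m 1\<^sub>m n) = (\<Prod>i<n. f i + e)"
    using spectrum_list[OF H] by blast
  have real: "0 \<le> Re (f i) \<and> Im (f i) = 0" if i: "i < n" for i
  proof -
    obtain v where v: "v \<in> carrier_vec n" "v \<noteq> 0\<^sub>v n" "(hadj C * C) *\<^sub>v v = f i \<cdot>\<^sub>v v"
      using f(1)[OF i] H unfolding eigenvalue_def eigenvector_def by auto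
    have "f i * ip n v v = ip n ((hadj C * C + 0 \<cdot>\<^sub>m 1\<^sub>m n) *\<^sub>v v) v"
    proof -
      have "hadj C * C + 0 \<cdot>\<^sub>m 1\<^sub>m n = hadj C * C"
        using C by (intro eq_matI) auto
      then show ?thesis using v by (simp add: ip_smult_left)
    qed
    also have "\<dots> = ip n (C *\<^sub>v v) (C *\<^sub>v v)"
      using ip_gram[OF C C v(1) v(1), of 0] by simp
    finally have eq: "f i * ip n v v = ip n (C *\<^sub>v v) (C *\<^sub>v v)" .
    have pos: "Re (ip n v v) > 0" by (rule ip_self_pos[OF v(1,2)])
    have a: "Re (f i) * Re (ip n v v) \<ge> 0"
      using arg_cong[OF eq, of Re] ip_self_nonneg[of n "C *\<^sub>v v"] by (simp add: ip_self_nonneg)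
    have b: "Im (f i) * Re (ip n v v) = 0"
      using arg_cong[OF eq, of Im] by (simp add: ip_self_nonneg)
    show ?thesis using pos a b by (simp add: zero_le_mult_iff)
  qed
  have eqf: "f i = complex_of_real (Re (f i))" if "i < n" for i
    using real[OF that] by (simp add: complex_eq_iff)
  have le: "Re (f i) \<le> K" if "i < n" for i
    using eigenvalue_le_row_sum[OF H f(1)[OF that] K] complex_Re_le_cmod[of "f i"] by force
  have tr: "(\<Sum>i<n. ((hadj C * C) ^\<^sub>m k) $$ (i,i)) = complex_of_real (\<Sum>i<n. Re (f i) ^ k)" for k
    unfolding f(2) of_real_sum of_real_power
    by (rule sum.cong[OF refl]) (metis eqf lessThan_iff)
  have dt: "det (hadj C * C + complex_of_real e \<cdot>\<^sub>m 1\<^sub>m n) = complex_of_real (\<Prod>i<n. Re (f i) + e)" for e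
    unfolding f(3) of_real_prod of_real_add
    by (rule prod.cong[OF refl]) (metis eqf lessThan_iff)
  show thesis by (rule that[OF _ tr dt]) (use real le in auto)
qed

lemma det_gram_add_pos:
  assumes C: "C \<in> carrier_mat n n" and e: "0 < e"
  shows "0 < Re (det (hadj C * C + complex_of_real e \<cdot>\<^sub>m 1\<^sub>m n))"
    and "Im (det (hadj C * C + complex_of_real e \<cdot>\<^sub>m 1\<^sub>m n)) = 0"
proof -
  define K where "K = (\<Sum>i<n. \<Sum>j<n. cmod ((hadj C * C) $$ (i,j)))"
  have K: "(\<Sum>j<n. cmod ((hadj C * C) $$ (i,j))) \<le> K" if "i < n" for i
    unfolding K_def by (rule member_le_sum) (use that in \<open>auto intro: sum_nonneg\<close>)
  obtain f where f: "\<And>i. i < n \<Longrightarrow> 0 \<le> f i \<and> f i \<le> K"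
    and d: "\<And>e. det (hadj C * C + complex_of_real e \<cdot>\<^sub>m 1\<^sub>m n) = complex_of_real (\<Prod>i<n. f i + e)"
    using gram_spectrum[OF C K] by metis
  have "0 < (\<Prod>i<n. f i + e)" using f e by (intro prod_pos) (auto intro: add_nonneg_pos)
  then show "0 < Re (det (hadj C * C + complex_of_real e \<cdot>\<^sub>m 1\<^sub>m n))"
    "Im (det (hadj C * C + complex_of_real e \<cdot>\<^sub>m 1\<^sub>m n)) = 0"
    unfolding d by (simp_all del: of_real_prod of_real_add)
qed

section \<open>A Cauchy-Schwarz inequality for determinants\<close>

lemma mat_inverse_exists:
  fixes A :: "complex mat"
  assumes "A \<in> carrier_mat n n" "det A \<noteq> 0"
  obtains B where "B \<in> carrier_mat n n" "A * B = 1\<^sub>m n" "B * A = 1\<^sub>m n"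
  using det_non_zero_imp_unit[OF assms] unfolding Units_def ring_mat_def by auto

text \<open>Stack C0 and C over sqrt e times the identity, giving X0 and X. With P0 = X0^* X0, P =
  X^* X and M = X0^* X, the matrix X0 P0^-1 X0^* is an orthogonal projection, so M^* P0^-1 M is at
  most P. Hence P^-1 M^* P0^-1 M has eigenvalues of modulus at most 1, while its determinant is |det
  M|^2 / (det P0 det P). The proof avoids the stacked matrices and uses
  \<open>ip_gram\<close>.\<close>

lemma det_gram_cauchy_schwarz:
  assumes C0: "C0 \<in> carrier_mat n n" and C: "C \<in> carrier_mat n n" and e: "0 < e"
  shows "(cmod (det (hadj C0 * C + complex_of_real e \<cdot>\<^sub>m 1\<^sub>m n)))\<^sup>2
    \<le> Re (det (hadj C0 * C0 + complex_of_real e \<cdot>\<^sub>m 1\<^sub>m n)) * Re (det (hadj C * C + complex_of_real e \<cdot>\<^sub>m 1\<^sub>m n))"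
proof -
  define M where "M = hadj C0 * C + complex_of_real e \<cdot>\<^sub>m 1\<^sub>m n"
  define P0 where "P0 = hadj C0 * C0 + complex_of_real e \<cdot>\<^sub>m 1\<^sub>m n"
  define P where "P = hadj C * C + complex_of_real e \<cdot>\<^sub>m 1\<^sub>m n"
  have car [simp]: "M \<in> carrier_mat n n" "P0 \<in> carrier_mat n n" "P \<in> carrier_mat n n"
    using C0 C unfolding M_def P0_def P_def by auto
  have hM [simp]: "hadj M \<in> carrier_mat n n" by simp
  have hP: "hadj P = P" "hadj P0 = P0"
    unfolding P_def P0_def using hadj_mult_add_smult_one C C0 by auto
  have dP: "0 < Re (det P)" "Im (det P) = 0" and dP0: "0 < Re (det P0)" "Im (det P0) = 0"
    using det_gram_add_pos[OF C e] det_gram_add_pos[OF C0 e] by (auto simp: P_def P0_def)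
  have "det P \<noteq> 0" "det P0 \<noteq> 0" using dP dP0 by auto
  obtain I where I [simp]: "I \<in> carrier_mat n n" and PI: "P * I = 1\<^sub>m n" "I * P = 1\<^sub>m n"
    using mat_inverse_exists[of P n] \<open>det P \<noteq> 0\<close> by auto
  obtain I0 where I0 [simp]: "I0 \<in> carrier_mat n n" and PI0: "P0 * I0 = 1\<^sub>m n" "I0 * P0 = 1\<^sub>m n"
    using mat_inverse_exists[of P0 n] \<open>det P0 \<noteq> 0\<close> by auto
  \<comment> \<open>\<open>I * S\<close> is P^-1 M^* P0^-1 M; its eigenvalues are those of S
    relative to P.\<close>
  define S where "S = hadj M * (I0 * M)"
  have S [simp]: "S \<in> carrier_mat n n" "I0 * M \<in> carrier_mat n n" 
    unfolding S_def by (auto intro!: mult_carrier_mat[of _ n n])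
  have IS: "I * S \<in> carrier_mat n n" by (auto intro!: mult_carrier_mat[of _ n n])
  obtain f where f: "\<And>i. i < n \<Longrightarrow> eigenvalue (I * S) (f i)"
    "\<And>e. det (I * S + e \<cdot>\<^sub>m 1\<^sub>m n) = (\<Prod>i<n. f i + e)"
    using spectrum_list[OF IS] by metis
  have "A + 0 \<cdot>\<^sub>m 1\<^sub>m n = A" if "A \<in> carrier_mat n n" for A :: "complex mat"
    using that by (intro eq_matI) auto
  from f(2)[of 0] this[OF IS] have detIS: "det (I * S) = (\<Prod>i<n. f i)" by simp
  have fle: "cmod (f i) \<le> 1" if i: "i < n" for i
  proof -
    obtain v where v: "v \<in> carrier_vec n" "v \<noteq> 0\<^sub>v n" "(I * S) *\<^sub>v v = f i \<cdot>\<^sub>v v"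
      using f(1)[OF i] IS unfolding eigenvalue_def eigenvector_def by auto
    \<comment> \<open>X0 u is the orthogonal projection of X v to the range of X0; \<beta> and
      \<alpha> below are the squared lengths of X v and X0 u.\<close>
    define u where "u = I0 *\<^sub>v (M *\<^sub>v v)"
    have u: "u \<in> carrier_vec n" unfolding u_def using v by (auto intro!: mult_mat_vec_carrier[of _ n n])
    have Mv: "M *\<^sub>v v \<in> carrier_vec n" using v by (auto intro!: mult_mat_vec_carrier[of _ n n])
    have Sv: "S *\<^sub>v v = f i \<cdot>\<^sub>v (P *\<^sub>v v)"
    proof -
      have "S *\<^sub>v v = (P * (I * S)) *\<^sub>v v"
        by (simp add: PI assoc_mult_mat[symmetric, of _ n n _ n _ n] left_mult_one_mat[of _ n n])
      also have "\<dots> = P *\<^sub>v (f i \<cdot>\<^sub>v v)"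
        using v IS by (subst assoc_mult_mat_vec[of _ n n _ n]) auto
      finally show ?thesis using v mult_mat_vec[of P n n v] by simp
    qed
    have Sv2: "S *\<^sub>v v = hadj M *\<^sub>v u"
      using v Mv unfolding S_def u_def
      by (simp add: assoc_mult_mat_vec[of _ n n _ n])
    have P0u: "P0 *\<^sub>v u = M *\<^sub>v v"
    proof -
      have "P0 *\<^sub>v u = (P0 * I0) *\<^sub>v (M *\<^sub>v v)"
        unfolding u_def using Mv by (subst assoc_mult_mat_vec[of _ n n _ n]) auto
      then show ?thesis using PI0 Mv by simp
    qed
    define \<beta> where "\<beta> = ip n (P *\<^sub>v v) v"
    define \<alpha> where "\<alpha> = ip n (P0 *\<^sub>v u) u"
    have \<beta>: "\<beta> = ip n (C *\<^sub>v v) (C *\<^sub>v v) + e * ip n v v"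
      unfolding \<beta>_def P_def by (rule ip_gram[OF C C v(1) v(1)])
    have \<alpha>: "\<alpha> = ip n (C0 *\<^sub>v u) (C0 *\<^sub>v u) + e * ip n u u"
      unfolding \<alpha>_def P0_def by (rule ip_gram[OF C0 C0 u u])
    have \<alpha>2: "\<alpha> = ip n (C *\<^sub>v v) (C0 *\<^sub>v u) + e * ip n v u"
      unfolding \<alpha>_def P0u M_def by (rule ip_gram[OF C0 C v(1) u])
    have \<beta>pos: "Re \<beta> > 0" "Im \<beta> = 0"
      unfolding \<beta> using ip_self_nonneg[of n "C *\<^sub>v v"] ip_self_pos[OF v(1,2)] ip_self_nonneg[of n v] e
      by (auto intro: add_nonneg_pos)
    have \<alpha>pos: "Re \<alpha> \<ge> 0" "Im \<alpha> = 0"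
      unfolding \<alpha> using ip_self_nonneg[of n "C0 *\<^sub>v u"] ip_self_nonneg[of n u] e
      by auto
    \<comment> \<open>The residual X v - X0 u has components x and sqrt e y. Its squared length is
      \<beta> - \<alpha>, because \<alpha> is also the pairing of X v with X0 u, which is
      \<open>\<alpha>2\<close>.\<close>
    define x where "x = C *\<^sub>v v + (-1) \<cdot>\<^sub>v (C0 *\<^sub>v u)"
    define y where "y = v + (-1) \<cdot>\<^sub>v u"
    have cv [simp]: "C *\<^sub>v v \<in> carrier_vec n" "C0 *\<^sub>v u \<in> carrier_vec n"
      using C C0 v u by auto
    have xx: "ip n x x = ip n (C *\<^sub>v v) (C *\<^sub>v v) - ip n (C *\<^sub>v v) (C0 *\<^sub>v u)
       - cnj (ip n (C *\<^sub>v v) (C0 *\<^sub>v u)) + ip n (C0 *\<^sub>v u) (C0 *\<^sub>v u)"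
      unfolding x_def ip_commute[of n "C0 *\<^sub>v u" "C *\<^sub>v v", symmetric]
      by (simp add: ip_add_left ip_add_right ip_smult_left ip_smult_right)
    have yy: "ip n y y = ip n v v - ip n v u - cnj (ip n v u) + ip n u u"
      unfolding y_def ip_commute[of n u v, symmetric]
      using v u by (simp add: ip_add_left ip_add_right ip_smult_left ip_smult_right)
    have "0 \<le> Re (ip n x x) + e * Re (ip n y y)"
      using ip_self_nonneg[of n x] ip_self_nonneg[of n y] e by simp
    also have "\<dots> = Re \<beta> + Re \<alpha> - 2 * Re (ip n (C *\<^sub>v v) (C0 *\<^sub>v u) + e * ip n v u)"
      unfolding xx yy \<beta> \<alpha> by (simp add: algebra_simps)
    also have "\<dots> = Re \<beta> - Re \<alpha>" unfolding \<alpha>2[symmetric] by simp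
    finally have le: "Re \<alpha> \<le> Re \<beta>" by simp
    have Pv: "P *\<^sub>v v \<in> carrier_vec n" using v by (auto intro!: mult_mat_vec_carrier[of _ n n])
    have "f i * \<beta> = ip n (S *\<^sub>v v) v"
      unfolding \<beta>_def Sv using Pv by (simp add: ip_smult_left)
    also have "\<dots> = ip n u (M *\<^sub>v v)"
      unfolding Sv2 using ip_mult_mat_left[OF hM u v(1)] by simp
    also have "\<dots> = cnj \<alpha>" unfolding \<alpha>_def P0u by (rule ip_commute)
    finally have "f i * \<beta> = cnj \<alpha>" .
    then have "cmod (f i) * cmod \<beta> = cmod \<alpha>" by (metis complex_mod_cnj norm_mult)
    moreover have "cmod \<beta> = Re \<beta>" "cmod \<alpha> = Re \<alpha>" using \<alpha>pos \<beta>pos by (auto simp: cmod_def)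
    ultimately have "cmod (f i) * Re \<beta> \<le> 1 * Re \<beta>" using le by simp
    then show ?thesis using \<beta>pos(1) by (simp only: mult_le_cancel_right_pos)
  qed
  have "cmod (det (I * S)) \<le> 1"
    unfolding detIS prod_norm[symmetric] by (rule prod_le_1) (use fle in auto)
  moreover have "det (I * S) * (det P * det P0) = cnj (det M) * det M"
  proof -
    have IS_eq: "det (I * S) = det I * (cnj (det M) * (det I0 * det M))"
      unfolding S_def using det_hadj[of M n]
      by (simp add: det_mult[of _ n] mult_carrier_mat[of _ n n])
    have inv: "det P * det I = 1" "det P0 * det I0 = 1"
      using det_mult[of P n I] det_mult[of P0 n I0] PI PI0 by simp_all
    have "det I * (cnj (det M) * (det I0 * det M)) * (det P * det P0)
      = (det P * det I) * (det P0 * det I0) * (cnj (det M) * det M)"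
      by (simp only: mult_ac)
    then show ?thesis unfolding IS_eq inv by simp
  qed
  ultimately have "cmod (det M) * cmod (det M) \<le> cmod (det P * det P0)"
  proof -
    assume "cmod (det (I * S)) \<le> 1" and eq: "det (I * S) * (det P * det P0) = cnj (det M) * det M"
    have "cmod (det M) * cmod (det M) = cmod (det (I * S)) * cmod (det P * det P0)"
      using arg_cong[OF eq, of cmod] by (simp only: norm_mult complex_mod_cnj)
    also have "\<dots> \<le> 1 * cmod (det P * det P0)"
      by (rule mult_right_mono) (use \<open>cmod (det (I * S)) \<le> 1\<close> in auto)
    finally show ?thesis by simp
  qed
  also have "\<dots> = Re (det P0) * Re (det P)"
    using dP dP0 by (simp add: norm_mult cmod_def)
  finally show ?thesis by (simp add: M_def P_def P0_def power2_eq_square)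
qed

section \<open>Matrices over the group ring\<close>

text \<open>The bound covers all index pairs, also those beyond the matrix size, and is an inclusion
  rather than an equality: one finite S is then the summation range for a whole family of matrices
  with varying coefficients.\<close>

definition msupp :: "'g set \<Rightarrow> 'g cgmat \<Rightarrow> bool" where
  "msupp S A \<longleftrightarrow> finite S \<and> (\<forall>i j. supp (A i j) \<subseteq> S)"

lemma msuppD: "msupp S A \<Longrightarrow> finite S" "msupp S A \<Longrightarrow> g \<notin> S \<Longrightarrow> A i j g = 0" "msupp S A \<Longrightarrow> supp (A i j) \<subseteq> S"
  by (auto simp: msupp_def supp_def)

lemma msuppI: "finite S \<Longrightarrow> (\<And>i j g. g \<notin> S \<Longrightarrow> A i j g = 0) \<Longrightarrow> msupp S A"
  by (auto simp: msupp_def supp_def)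

lemma conv_eq_sum:
  assumes "finite S" "supp a \<subseteq> S"
  shows "conv x a g = (\<Sum>k\<in>S. x (g + - k) * a k)"
  unfolding conv_def using assms by (intro sum.mono_neutral_left) (auto simp: supp_def)

text \<open>A row vector times a matrix. The entries of x are arbitrary functions, so one operation
  describes both the operator on l2 rows and, through \<open>mmult_vmul\<close>, the rows of a
  matrix product.\<close>

definition vmul :: "nat \<Rightarrow> (nat \<Rightarrow> 'g::group_add \<Rightarrow> complex) \<Rightarrow> 'g cgmat \<Rightarrow> nat \<Rightarrow> 'g \<Rightarrow> complex" where
  "vmul p x A = (\<lambda>j g. \<Sum>i<p. conv (x i) (A i j) g)"

lemma mmult_vmul: "mmult p A B i = vmul p (A i) B"
  by (simp add: mmult_def vmul_def)

lemma vmul_eq: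
  "msupp S A \<Longrightarrow> vmul p x A j g = (\<Sum>i<p. \<Sum>k\<in>S. x i (g + - k) * A i j k)"
  unfolding vmul_def by (intro sum.cong refl conv_eq_sum) (auto simp: msupp_def)

definition addset :: "'g::group_add set \<Rightarrow> 'g set \<Rightarrow> 'g set" where
  "addset S T = (\<lambda>(a, b). a + b) ` (S \<times> T)"

lemma finite_addset [simp]: "finite S \<Longrightarrow> finite T \<Longrightarrow> finite (addset S T)"
  by (simp add: addset_def)

lemma addsetI: "a \<in> S \<Longrightarrow> b \<in> T \<Longrightarrow> a + b \<in> addset S T"
  by (auto simp: addset_def)

lemma addsetI2: "g + - k \<in> S \<Longrightarrow> k \<in> T \<Longrightarrow> g \<in> addset S T"
  using addsetI[of "g + - k" S k T] by simp

lemma vmul_supp: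
  assumes "msupp T B" "\<And>i g. g \<notin> S \<Longrightarrow> x i g = 0" "g \<notin> addset S T"
  shows "vmul p x B j g = 0"
  unfolding vmul_eq[OF assms(1)]
proof (intro sum.neutral ballI)
  fix i k assume "k \<in> T"
  then have "g + - k \<notin> S" using assms(3) addsetI2 by blast
  then show "x i (g + - k) * B i j k = 0" using assms(2) by simp
qed

lemma msupp_mmult: "msupp S A \<Longrightarrow> msupp T B \<Longrightarrow> msupp (addset S T) (mmult p A B)"
  unfolding mmult_vmul using vmul_supp[of T B S "A _"] 
  by (intro msuppI) (auto simp: msuppD mmult_vmul)

lemma msupp_mstar: "msupp S A \<Longrightarrow> msupp (uminus ` S) (mstar A)"
proof (rule msuppI)
  fix i j g
  assume A: "msupp S A" and "g \<notin> uminus ` S"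
  then have "- g \<notin> S" by (metis imageI minus_minus)
  then show "mstar A i j g = 0" using A by (simp add: mstar_def grp_star_def msuppD)
qed (simp add: msupp_def)

lemma msupp_mone: "msupp {0} mone"
  by (intro msuppI) (auto simp: mone_def)

primrec word_set :: "'g::group_add set \<Rightarrow> nat \<Rightarrow> 'g set" where
  "word_set S 0 = {0}"
| "word_set S (Suc n) = addset S (word_set S n)"

lemma finite_word_set [simp]: "finite S \<Longrightarrow> finite (word_set S n)"
  by (induction n) auto

lemma msupp_mpow: "msupp S A \<Longrightarrow> msupp (word_set S n) (mpow p A n)"
  by (induction n) (auto intro: msupp_mmult msupp_mone)

lemma sum_swap3:
  "(\<Sum>m\<in>M. \<Sum>l\<in>L. \<Sum>k\<in>T. f m l k) = (\<Sum>l\<in>L. \<Sum>k\<in>T. \<Sum>m\<in>M. f m l k)"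
  by (subst sum.swap) (intro sum.cong[OF refl] sum.swap)

text \<open>Substitute m = h + k. The set \<open>addset S T\<close> contains the translate S + k for
  every k in T at once, and the summand vanishes on the excess.\<close>

lemma sum_translate:
  fixes a x :: "'g::group_add \<Rightarrow> complex"
  assumes "finite S" "finite T" "k \<in> T" "\<And>h. h \<notin> S \<Longrightarrow> a h = 0"
  shows "(\<Sum>m\<in>addset S T. x m * a (m + - k)) = (\<Sum>h\<in>S. x (h + k) * a h)"
proof -
  have "(\<Sum>m\<in>(\<lambda>h. h + k) ` S. x m * a (m + - k)) = (\<Sum>m\<in>addset S T. x m * a (m + - k))"
  proof (rule sum.mono_neutral_left)
    show "\<forall>m\<in>addset S T - (\<lambda>h. h + k) ` S. x m * a (m + - k) = 0"
    proof
      fix m assume "m \<in> addset S T - (\<lambda>h. h + k) ` S"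
      then have "m + - k \<notin> S" by (metis DiffD2 diff_add_cancel diff_conv_add_uminus imageI)
      then show "x m * a (m + - k) = 0" using assms by simp
    qed
  qed (use assms in \<open>auto intro: addsetI\<close>)
  moreover have "(\<Sum>m\<in>(\<lambda>h. h + k) ` S. x m * a (m + - k)) = (\<Sum>h\<in>S. x (h + k) * a h)"
    by (subst sum.reindex) (auto simp: inj_on_def add.assoc)
  ultimately show ?thesis by simp
qed

text \<open>The support of x may be infinite; all sums stay finite because A and B have finite
  support, so the identity is a rearrangement without convergence questions.\<close>

lemma vmul_assoc:
  assumes A: "msupp S A" and B: "msupp T B"
  shows "vmul p (vmul p x A) B = vmul p x (mmult p A B)"
proof (intro ext)
  fix j g
  have fin: "finite S" "finite T" using A B by (auto dest: msuppD)
  have "vmul p x (mmult p A B) j g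
      = (\<Sum>i<p. \<Sum>m\<in>addset S T. x i (g + - m) * (\<Sum>l<p. \<Sum>k\<in>T. A i l (m + - k) * B l j k))"
    unfolding vmul_eq[OF msupp_mmult[OF A B]] mmult_vmul vmul_eq[OF B] ..
  also have "\<dots> = (\<Sum>i<p. \<Sum>m\<in>addset S T. \<Sum>l<p. \<Sum>k\<in>T. x i (g + - m) * A i l (m + - k) * B l j k)"
    by (simp add: sum_distrib_left mult.assoc)
  also have "\<dots> = (\<Sum>i<p. \<Sum>l<p. \<Sum>k\<in>T. \<Sum>m\<in>addset S T. x i (g + - m) * A i l (m + - k) * B l j k)"
    by (intro sum.cong[OF refl] sum_swap3)
  also have "\<dots> = (\<Sum>i<p. \<Sum>l<p. \<Sum>k\<in>T. \<Sum>h\<in>S. x i (g + - k + - h) * A i l h * B l j k)"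
  proof (intro sum.cong[OF refl])
    fix i l k assume k: "k \<in> T"
    have "(\<Sum>m\<in>addset S T. x i (g + - m) * A i l (m + - k)) = (\<Sum>h\<in>S. x i (g + - (h + k)) * A i l h)"
      by (rule sum_translate) (use fin k A in \<open>auto dest: msuppD\<close>)
    then show "(\<Sum>m\<in>addset S T. x i (g + - m) * A i l (m + - k) * B l j k)
       = (\<Sum>h\<in>S. x i (g + - k + - h) * A i l h * B l j k)"
      by (simp add: sum_distrib_right[symmetric] minus_add add.assoc del: diff_conv_add_uminus add_uminus_conv_diff)
  qed
  also have "\<dots> = (\<Sum>l<p. \<Sum>i<p. \<Sum>k\<in>T. \<Sum>h\<in>S. x i (g + - k + - h) * A i l h * B l j k)"
    by (rule sum.swap)
  also have "\<dots> = (\<Sum>l<p. \<Sum>k\<in>T. \<Sum>i<p. \<Sum>h\<in>S. x i (g + - k + - h) * A i l h * B l j k)"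
    by (intro sum.cong[OF refl] sum.swap)
  also have "\<dots> = vmul p (vmul p x A) B j g"
    unfolding vmul_eq[OF B] vmul_eq[OF A] by (simp add: sum_distrib_right)
  finally show "vmul p (vmul p x A) B j g = vmul p x (mmult p A B) j g" ..
qed

lemma mmult_assoc:
  "msupp S A \<Longrightarrow> msupp T B \<Longrightarrow> mmult p (mmult p C A) B = mmult p C (mmult p A B)"
  by (rule ext) (simp add: mmult_vmul vmul_assoc)

lemma vmul_diff_scale:
  "vmul p (\<lambda>i g. x i g - y i g / c) A j g = vmul p x A j g - vmul p y A j g / c"
  by (simp add: vmul_def conv_def left_diff_distrib sum_subtractf sum_divide_distrib)

text \<open>The l2 inner product for a finitely supported second argument. Summing over the support
  of y keeps it a finite sum even when x is an infinite l2 row.\<close>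

definition pairing :: "nat \<Rightarrow> (nat \<Rightarrow> 'g \<Rightarrow> complex) \<Rightarrow> (nat \<Rightarrow> 'g \<Rightarrow> complex) \<Rightarrow> complex" where
  "pairing p x y = (\<Sum>j<p. \<Sum>g\<in>supp (y j). x j g * cnj (y j g))"

lemma pairing_eq:
  assumes "finite T" "\<And>j g. g \<notin> T \<Longrightarrow> y j g = 0"
  shows "pairing p x y = (\<Sum>j<p. \<Sum>g\<in>T. x j g * cnj (y j g))"
  unfolding pairing_def using assms by (intro sum.cong refl sum.mono_neutral_left) (auto simp: supp_def)

lemma pairing_adjoint:
  fixes A :: "'g::group_add cgmat"
  assumes A: "msupp S A" and T: "finite T" "\<And>j g. g \<notin> T \<Longrightarrow> y j g = 0"
  shows "pairing p (vmul p x A) y = pairing p x (vmul p y (mstar A))"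
proof -
  have S: "finite S" using A by (auto dest: msuppD)
  have st: "vmul p y (mstar A) i h = (\<Sum>j<p. \<Sum>k\<in>S. y j (h + k) * cnj (A i j k))" for i h
    unfolding vmul_eq[OF msupp_mstar[OF A]]
    by (rule sum.cong[OF refl], subst sum.reindex) (auto simp: mstar_def grp_star_def)
  define T' where "T' = addset T (uminus ` S)"
  have T': "finite T'" unfolding T'_def using S T by simp
  have yT': "vmul p y (mstar A) i h = 0" if "h \<notin> T'" for i h
    using vmul_supp[OF msupp_mstar[OF A], of T y] T(2) that by (simp add: T'_def)
  have "pairing p x (vmul p y (mstar A)) = (\<Sum>i<p. \<Sum>h\<in>T'. \<Sum>j<p. \<Sum>k\<in>S. x i h * cnj (y j (h + k)) * A i j k)"
    using pairing_eq[of T' "vmul p y (mstar A)" p x, OF T' yT'] by (simp add: st sum_distrib_left mult.assoc)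
  also have "\<dots> = (\<Sum>i<p. \<Sum>j<p. \<Sum>h\<in>T'. \<Sum>k\<in>S. x i h * cnj (y j (h + k)) * A i j k)"
    by (intro sum.cong[OF refl] sum.swap)
  also have "\<dots> = (\<Sum>j<p. \<Sum>i<p. \<Sum>h\<in>T'. \<Sum>k\<in>S. x i h * cnj (y j (h + k)) * A i j k)"
    by (rule sum.swap)
  also have "\<dots> = (\<Sum>j<p. \<Sum>i<p. \<Sum>k\<in>S. \<Sum>h\<in>T'. x i h * cnj (y j (h + k)) * A i j k)"
    by (intro sum.cong[OF refl] sum.swap)
  also have "\<dots> = (\<Sum>j<p. \<Sum>i<p. \<Sum>k\<in>S. \<Sum>g\<in>T. x i (g + - k) * A i j k * cnj (y j g))"
  proof (intro sum.cong[OF refl])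
    fix j i k assume k: "k \<in> S"
    have "(\<Sum>h\<in>T'. x i h * cnj (y j (h + - (- k)))) = (\<Sum>g\<in>T. x i (g + - k) * cnj (y j g))"
      unfolding T'_def by (rule sum_translate[where a = "\<lambda>h. cnj (y j h)"]) (use S T k in auto)
    then have "(\<Sum>h\<in>T'. x i h * cnj (y j (h + k))) * A i j k = (\<Sum>g\<in>T. x i (g + - k) * cnj (y j g)) * A i j k"
      by simp
    then show "(\<Sum>h\<in>T'. x i h * cnj (y j (h + k)) * A i j k) = (\<Sum>g\<in>T. x i (g + - k) * A i j k * cnj (y j g))"
      unfolding sum_distrib_right by (simp only: mult_ac)
  qed
  also have "\<dots> = (\<Sum>j<p. \<Sum>i<p. \<Sum>g\<in>T. \<Sum>k\<in>S. x i (g + - k) * A i j k * cnj (y j g))"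
    by (intro sum.cong[OF refl] sum.swap)
  also have "\<dots> = (\<Sum>j<p. \<Sum>g\<in>T. \<Sum>i<p. \<Sum>k\<in>S. x i (g + - k) * A i j k * cnj (y j g))"
    by (intro sum.cong[OF refl] sum.swap)
  also have "\<dots> = pairing p (vmul p x A) y"
    by (subst pairing_eq[of T y p "vmul p x A"]) (auto simp: T vmul_eq[OF A] sum_distrib_right)
  finally show ?thesis ..
qed

text \<open>The rows of (1 - A A^*/K)^n. As n grows they converge to the rows of the projection onto the
  kernel of right multiplication by A.\<close>

primrec kernel_approx :: "nat \<Rightarrow> real \<Rightarrow> 'g::group_add cgmat \<Rightarrow> nat \<Rightarrow> 'g cgmat" where
  "kernel_approx p K A 0 = mone"
| "kernel_approx p K A (Suc n) = (\<lambda>i j g. kernel_approx p K A n i j g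
     - vmul p (kernel_approx p K A n i) (mmult p A (mstar A)) j g / complex_of_real K)"

lemma msupp_kernel_approx:
  assumes "msupp S A"
  shows "\<exists>T. msupp T (kernel_approx p K A n)"
proof (induction n)
  case 0
  then show ?case using msupp_mone by auto
next
  case (Suc n)
  then obtain T where T: "msupp T (kernel_approx p K A n)" by blast
  have D: "msupp (addset S (uminus ` S)) (mmult p A (mstar A))"
    using assms by (intro msupp_mmult msupp_mstar)
  have "msupp (T \<union> addset T (addset S (uminus ` S))) (kernel_approx p K A (Suc n))"
    using T D by (intro msuppI) (auto simp: msuppD vmul_supp[OF D, of T])
  then show ?case by blast
qed

text \<open>One step subtracts r A A^* / K from the row r, and the factor A^* moves to the other
  side as A. In particular every approximant has the same pairing with an x in the kernel of
  A.\<close>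

lemma pairing_kernel_approx_Suc:
  fixes A :: "'g::group_add cgmat"
  assumes A: "msupp S A"
  shows "pairing p x (kernel_approx p K A (Suc n) i) = pairing p x (kernel_approx p K A n i)
     - pairing p (vmul p x A) (vmul p (kernel_approx p K A n i) A) / complex_of_real K"
proof -
  obtain T where T: "msupp T (kernel_approx p K A n)" using msupp_kernel_approx[OF A] by blast
  define r where "r = kernel_approx p K A n i"
  have r0: "\<And>j g. g \<notin> T \<Longrightarrow> r j g = 0" using T by (auto simp: r_def msuppD)
  define T1 where "T1 = addset T S"
  have s: "vmul p r A j g = 0" if "g \<notin> T1" for j g
    using vmul_supp[OF A, of T r] r0 that by (simp add: T1_def)
  define T2 where "T2 = addset T1 (uminus ` S)"
  have s2: "vmul p (vmul p r A) (mstar A) j g = 0" if "g \<notin> T2" for j g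
    using vmul_supp[OF msupp_mstar[OF A], of T1 "vmul p r A"] s that by (simp add: T2_def)
  have fin: "finite T" "finite T1" "finite T2" using T A by (auto simp: T1_def T2_def msupp_def)
  have eq: "kernel_approx p K A (Suc n) i = (\<lambda>j g. r j g - vmul p (vmul p r A) (mstar A) j g / complex_of_real K)"
    by (simp add: r_def vmul_assoc[OF A msupp_mstar[OF A]])
  have "pairing p x (kernel_approx p K A (Suc n) i)
     = (\<Sum>j<p. \<Sum>g\<in>T\<union>T2. x j g * cnj (r j g - vmul p (vmul p r A) (mstar A) j g / complex_of_real K))"
    unfolding eq by (rule pairing_eq) (use fin r0 s2 in auto)
  also have "\<dots> = (\<Sum>j<p. \<Sum>g\<in>T\<union>T2. x j g * cnj (r j g))
      - (\<Sum>j<p. \<Sum>g\<in>T\<union>T2. x j g * cnj (vmul p (vmul p r A) (mstar A) j g)) / complex_of_real K"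
    by (simp add: right_diff_distrib sum_subtractf sum_divide_distrib)
  also have "(\<Sum>j<p. \<Sum>g\<in>T\<union>T2. x j g * cnj (r j g)) = pairing p x r"
    by (rule pairing_eq[symmetric]) (use fin r0 in auto)
  also have "(\<Sum>j<p. \<Sum>g\<in>T\<union>T2. x j g * cnj (vmul p (vmul p r A) (mstar A) j g)) = pairing p x (vmul p (vmul p r A) (mstar A))"
    by (rule pairing_eq[symmetric]) (use fin s2 in auto)
  also have "\<dots> = pairing p (vmul p x A) (vmul p r A)"
    by (rule pairing_adjoint[OF A fin(2) s, symmetric])
  finally show ?thesis by (simp add: r_def)
qed

lemma pairing_commute:
  assumes "finite T" "\<And>j g. g \<notin> T \<Longrightarrow> x j g = 0" "\<And>j g. g \<notin> T \<Longrightarrow> y j g = 0"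
  shows "pairing p y x = cnj (pairing p x y)"
  using pairing_eq[of T x p y] pairing_eq[of T y p x] assms by (simp add: mult.commute)

lemma pairing_mone: "i < p \<Longrightarrow> pairing p x (mone i) = x i 0"
proof -
  assume i: "i < p"
  have "pairing p x (mone i) = (\<Sum>j<p. \<Sum>g\<in>{0}. x j g * cnj (mone i j g))"
    by (rule pairing_eq) (auto simp: mone_def)
  also have "\<dots> = (\<Sum>j<p. if j = i then x i 0 else 0)"
    by (rule sum.cong) (auto simp: mone_def)
  finally show ?thesis using i by simp
qed

text \<open>R = 1 - A A^* / K is self-adjoint, so the pairing of row i of R^m with row i of R^n is
  the identity coefficient of the (i, i) entry of R^(m + n). The induction moves one factor R at a
  time to the left; the two conjugations from swapping arguments cancel.\<close>

lemma pairing_kernel_approx_kernel_approx: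
  assumes A: "msupp S A" and i: "i < p"
  shows "pairing p (kernel_approx p K A m i) (kernel_approx p K A n i) = kernel_approx p K A (m + n) i i 0"
proof (induction n arbitrary: m)
  case 0
  then show ?case by (simp add: pairing_mone[OF i])
next
  case (Suc n)
  have com: "pairing p (kernel_approx p K A a i) (kernel_approx p K A b i) = cnj (pairing p (kernel_approx p K A b i) (kernel_approx p K A a i))" for a b
  proof -
    obtain T U where "msupp T (kernel_approx p K A a)" "msupp U (kernel_approx p K A b)"
      using msupp_kernel_approx[OF A] by metis
    then show ?thesis by (intro pairing_commute[of "T \<union> U"]) (auto simp: msuppD)
  qed
  have com2: "pairing p (vmul p (kernel_approx p K A a i) A) (vmul p (kernel_approx p K A b i) A)
     = cnj (pairing p (vmul p (kernel_approx p K A b i) A) (vmul p (kernel_approx p K A a i) A))" for a b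
  proof -
    obtain T U where TU: "msupp T (kernel_approx p K A a)" "msupp U (kernel_approx p K A b)"
      using msupp_kernel_approx[OF A] by metis
    have "finite (addset T S \<union> addset U S)" using TU A by (auto simp: msupp_def)
    then show ?thesis using vmul_supp[OF A, of T "kernel_approx p K A a i"] vmul_supp[OF A, of U "kernel_approx p K A b i"] TU
      by (intro pairing_commute[of "addset T S \<union> addset U S"]) (auto simp: msuppD)
  qed
  have "pairing p (kernel_approx p K A m i) (kernel_approx p K A (Suc n) i) = pairing p (kernel_approx p K A (Suc m) i) (kernel_approx p K A n i)"
    unfolding com[of "Suc m" n] pairing_kernel_approx_Suc[OF A] by (simp add: com[of m n] com2[of m n])
  then show ?case using Suc.IH[of "Suc m"] by simp
qed

text \<open>The binomial expansion of the trace of (1 - A A^* / K)^n. It identifies these traces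
  with integrals of (1 - x / K)^n once f is the moment sequence of a measure.\<close>

lemma trN_kernel_approx:
  fixes A :: "'g::group_add cgmat"
  assumes A: "msupp S A"
    and mom: "\<And>k. trN p (mpow p (mmult p A (mstar A)) k) = complex_of_real (f k)"
  shows "trN p (kernel_approx p K A n) = complex_of_real (\<Sum>k\<le>n. (n choose k) * (- 1 / K) ^ k * f k)"
proof -
  define D where "D = mmult p A (mstar A)"
  have D: "msupp (addset S (uminus ` S)) D" unfolding D_def using A by (intro msupp_mmult msupp_mstar)
  \<comment> \<open>The induction needs the trace of (1 - D / K)^n D^k for every k, since a step in
    n produces the exponent k + 1; \<open>gSuc\<close> is Pascal's rule in this form.\<close>
  define g where "g n k = (\<Sum>l\<le>n. (n choose l) * (- 1 / K) ^ l * f (k + l))" for n k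
  have gSuc: "g (Suc n) k = g n k - g n (Suc k) / K" for n k
  proof -
    have "g (Suc n) k = f k + (\<Sum>l\<le>n. (Suc n choose Suc l) * (- 1 / K) ^ Suc l * f (k + Suc l))"
      unfolding g_def by (subst sum.atMost_Suc_shift) simp
    also have "(\<Sum>l\<le>n. (Suc n choose Suc l) * (- 1 / K) ^ Suc l * f (k + Suc l))
      = (\<Sum>l\<le>n. (n choose Suc l) * (- 1 / K) ^ Suc l * f (k + Suc l))
        - g n (Suc k) / K"
    proof -
      have "(Suc n choose Suc l) * (- 1 / K) ^ Suc l * f (k + Suc l)
        = (n choose Suc l) * (- 1 / K) ^ Suc l * f (k + Suc l) - (n choose l) * (- 1 / K) ^ l * f (Suc k + l) / K" for l
        by (simp add: algebra_simps add_divide_distrib)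
      then show ?thesis unfolding g_def by (simp only: sum_subtractf sum_divide_distrib)
    qed
    also have "f k + ((\<Sum>l\<le>n. (n choose Suc l) * (- 1 / K) ^ Suc l * f (k + Suc l)) - g n (Suc k) / K)
       = (\<Sum>l\<le>Suc n. (n choose l) * (- 1 / K) ^ l * f (k + l)) - g n (Suc k) / K"
      by (subst sum.atMost_Suc_shift) simp
    also have "(\<Sum>l\<le>Suc n. (n choose l) * (- 1 / K) ^ l * f (k + l)) = g n k"
      unfolding g_def by (simp add: binomial_eq_0)
    finally show ?thesis .
  qed
  have "trN p (mmult p (kernel_approx p K A n) (mpow p D k)) = complex_of_real (g n k)" for k
  proof (induction n arbitrary: k)
    case 0
    have "trN p (mmult p mone (mpow p D k)) = trN p (mpow p D k)"
    proof -
      have "vmul p (mone i) (mpow p D k) i 0 = mpow p D k i i 0" if i: "i < p" for i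
      proof -
        have "conv (mone i l) (mpow p D k l i) 0 = (if l = i then mpow p D k i i 0 else 0)" for l
        proof (cases "l = i")
          case True
          have "conv (mone i i) (mpow p D k i i) 0 = (\<Sum>h\<in>insert 0 (supp (mpow p D k i i)). mone i i (0 + - h) * mpow p D k i i h)"
            by (rule conv_eq_sum) (use msupp_mpow[OF D, of k p] in \<open>auto simp: msupp_def intro: finite_subset\<close>)
          also have "\<dots> = (\<Sum>h\<in>insert 0 (supp (mpow p D k i i)). if h = 0 then mpow p D k i i 0 else 0)"
            by (rule sum.cong) (auto simp: mone_def)
          also have "\<dots> = mpow p D k i i 0"
            using msupp_mpow[OF D, of k p] by (subst sum.delta) (auto simp: msupp_def intro: finite_subset)
          finally show ?thesis using True by simp
        next
          case False
          then show ?thesis by (simp add: conv_def mone_def)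
        qed
        then show ?thesis using i by (simp add: vmul_def)
      qed
      then show ?thesis by (simp add: trN_def mmult_vmul)
    qed
    then show ?case using mom by (simp add: g_def D_def)
  next
    case (Suc n)
    have "trN p (mmult p (kernel_approx p K A (Suc n)) (mpow p D k)) = trN p (mmult p (kernel_approx p K A n) (mpow p D k))
       - trN p (mmult p (mmult p (kernel_approx p K A n) D) (mpow p D k)) / complex_of_real K"
      unfolding trN_def mmult_vmul
      by (simp add: vmul_diff_scale sum_subtractf sum_divide_distrib D_def[symmetric])
    also have "mmult p (mmult p (kernel_approx p K A n) D) (mpow p D k) = mmult p (kernel_approx p K A n) (mpow p D (Suc k))"
      by (simp add: mmult_assoc[OF D msupp_mpow[OF D]])
    finally show ?case unfolding Suc.IH gSuc by simp
  qed
  note this[of 0]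
  moreover have "trN p (mmult p (kernel_approx p K A n) mone) = trN p (kernel_approx p K A n)"
  proof -
    have "vmul p x mone i 0 = x i 0" if i: "i < p" for x :: "nat \<Rightarrow> 'g \<Rightarrow> complex" and i
    proof -
      have "vmul p x mone i 0 = (\<Sum>l<p. if l = i then x i 0 else 0)"
        unfolding vmul_eq[OF msupp_mone] by (rule sum.cong) (auto simp: mone_def)
      then show ?thesis using i by simp
    qed
    then show ?thesis by (simp add: trN_def mmult_vmul)
  qed
  ultimately show ?thesis by (simp add: g_def)
qed

section \<open>Finite quotients\<close>

definition fin_normal :: "'g::group_add set \<Rightarrow> bool" where
  "fin_normal N \<longleftrightarrow> normal_subgrp N \<and> finite ((\<lambda>x. (+) x ` N) ` UNIV)"

lemma normal_subgrpD:
  assumes "normal_subgrp N"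
  shows "0 \<in> N" "a \<in> N \<Longrightarrow> b \<in> N \<Longrightarrow> a + b \<in> N" "a \<in> N \<Longrightarrow> - a \<in> N" "a \<in> N \<Longrightarrow> g + a + - g \<in> N"
  using assms unfolding normal_subgrp_def by blast+

lemma fin_normal_UNIV: "fin_normal UNIV"
proof -
  have "(\<lambda>x. (+) x ` UNIV) ` UNIV \<subseteq> {UNIV :: 'a set}"
    by (auto simp: surj_plus)
  then show ?thesis
    by (auto simp: fin_normal_def normal_subgrp_def intro: finite_subset)
qed

lemma fin_normal_Int:
  assumes "fin_normal N" "fin_normal M"
  shows "fin_normal (N \<inter> M)"
proof -
  have "(+) x ` (N \<inter> M) = (+) x ` N \<inter> (+) x ` M" for x :: 'a
    by (rule image_Int) simp
  then have "(\<lambda>x. (+) x ` (N \<inter> M)) ` UNIV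
      \<subseteq> (\<lambda>(P, Q). P \<inter> Q) ` (((\<lambda>x. (+) x ` N) ` UNIV) \<times> ((\<lambda>x. (+) x ` M) ` UNIV))"
    by auto
  then have "finite ((\<lambda>x. (+) x ` (N \<inter> M)) ` UNIV)"
    by (rule finite_subset) (use assms in \<open>auto simp: fin_normal_def\<close>)
  then show ?thesis
    using assms by (auto simp: fin_normal_def normal_subgrp_def)
qed

text \<open>Intersect one finite-index normal subgroup for each nonzero element of F.\<close>

lemma residually_finite_avoid:
  assumes "residually_finite_grp TYPE('g::group_add)" "finite (F :: 'g set)"
  obtains N where "fin_normal N" "N \<inter> F \<subseteq> {0}"
proof -
  have "\<exists>N. fin_normal N \<and> N \<inter> F \<subseteq> {0}"
    using assms(2)
  proof induction
    case empty
    then show ?case using fin_normal_UNIV by auto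
  next
    case (insert x F)
    then obtain N where N: "fin_normal N" "N \<inter> F \<subseteq> {0}" by blast
    show ?case
    proof (cases "x = 0")
      case True
      then show ?thesis using N by (intro exI[of _ N]) auto
    next
      case False
      then obtain M where "fin_normal M" "x \<notin> M"
        using assms(1) unfolding residually_finite_grp_def fin_normal_def by blast
      then show ?thesis
        using N by (intro exI[of _ "N \<inter> M"]) (auto intro: fin_normal_Int)
    qed
  qed
  then show thesis using that by blast
qed

section \<open>Cosets and their representatives\<close>

lemma coset_eqI:
  fixes N :: "'g::group_add set"
  assumes N: "normal_subgrp N" and a: "a \<in> (+) b ` N"
  shows "(+) a ` N = (+) b ` N"
proof -
  obtain m where m: "m \<in> N" "a = b + m" using a by blast
  have "b + m + l \<in> (+) b ` N" if "l \<in> N" for l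
    using normal_subgrpD(2)[OF N m(1) that] by (auto simp: add.assoc)
  moreover have "b + l \<in> (+) (b + m) ` N" if "l \<in> N" for l
  proof -
    have "- m + l \<in> N" using normal_subgrpD(2,3)[OF N] m(1) that by blast
    moreover have "b + l = b + m + (- m + l)" by (simp add: add.assoc)
    ultimately show ?thesis by blast
  qed
  ultimately show ?thesis unfolding m(2) by blast
qed

text \<open>Finite index is stated with left cosets, while g + - r \<in> N compares right cosets;
  normality makes the two agree. Right cosets are the form that \<open>sum_transversal\<close>
  uses.\<close>

lemma fin_normal_transversal:
  fixes N :: "'g::group_add set"
  assumes "fin_normal N"
  obtains R where "finite R" "R \<noteq> {}" "\<And>g. \<exists>!r. r \<in> R \<and> g + - r \<in> N"
proof -
  have N: "normal_subgrp N" and fin: "finite ((\<lambda>x. (+) x ` N) ` UNIV)"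
    using assms by (auto simp: fin_normal_def)
  define rep where "rep C = (SOME x :: 'g. x \<in> C)" for C
  define R where "R = rep ` ((\<lambda>x. (+) x ` N) ` UNIV)"
  have rep: "rep ((+) g ` N) \<in> (+) g ` N" for g
    unfolding rep_def by (rule someI[of _ "g + 0"]) (use normal_subgrpD(1)[OF N] in blast)
  have "\<exists>!r. r \<in> R \<and> g + - r \<in> N" for g
  proof (rule ex1I[of _ "rep ((+) g ` N)"], intro conjI)
    show "rep ((+) g ` N) \<in> R" by (auto simp: R_def)
    obtain m where m: "m \<in> N" "rep ((+) g ` N) = g + m" using rep[of g] by blast
    show "g + - rep ((+) g ` N) \<in> N"
      using normal_subgrpD(4)[OF N normal_subgrpD(3)[OF N m(1)], of g]
      by (simp add: m minus_add add.assoc del: add_uminus_conv_diff)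
  next
    fix r assume r: "r \<in> R \<and> g + - r \<in> N"
    then obtain g' where g': "r = rep ((+) g' ` N)" by (auto simp: R_def)
    have 1: "(+) r ` N = (+) g' ` N" using coset_eqI[OF N rep[of g']] g' by simp
    \<comment> \<open>Conjugation by - r turns g - r into - r + g, which places g in the left coset
      of r.\<close>
    have "- r + (g + - r) + - (- r) \<in> N" using normal_subgrpD(4)[OF N] r by blast
    moreover have "g = r + (- r + (g + - r) + - (- r))" by (simp add: add.assoc del: add_uminus_conv_diff)
    ultimately have "g \<in> (+) r ` N" by blast
    then have "(+) g ` N = (+) r ` N" by (rule coset_eqI[OF N])
    then show "r = rep ((+) g ` N)" using 1 g' by simp
  qed
  moreover have "finite R" "R \<noteq> {}" unfolding R_def using fin by auto
  ultimately show thesis using that by blast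
qed

text \<open>\<open>qmat A\<close> is the image of A under the regular representation of the finite quotient G/N;
  row and column indices enumerate pairs of a matrix index and a coset representative.\<close>

locale finite_quotient =
  fixes N R :: "'g::group_add set" and p n :: nat and e :: "nat \<Rightarrow> nat \<times> 'g"
  assumes normal: "normal_subgrp N" and finR: "finite R" and neR: "R \<noteq> {}"
    and transversal: "\<And>g. \<exists>!r. r \<in> R \<and> g + - r \<in> N"
    and enum: "bij_betw e {..<n} ({..<p} \<times> R)"
begin

lemma sum_enum: "(\<Sum>a<n. f (fst (e a)) (snd (e a))) = (\<Sum>i<p. \<Sum>r\<in>R. f i r)"
proof -
  have "(\<Sum>a<n. f (fst (e a)) (snd (e a))) = (\<Sum>a<n. (\<lambda>(i, r). f i r) (e a))"
    by (simp add: case_prod_unfold)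
  also have "\<dots> = (\<Sum>(i, r)\<in>{..<p} \<times> R. f i r)"
    by (rule sum.reindex_bij_betw[OF enum])
  finally show ?thesis by (simp add: sum.cartesian_product)
qed

lemma n_eq: "n = p * card R"
  using bij_betw_same_card[OF enum] by (simp add: card_cartesian_product)

lemma enum_in: "a < n \<Longrightarrow> fst (e a) < p" "a < n \<Longrightarrow> snd (e a) \<in> R"
  using bij_betwE[OF enum] by (auto simp: mem_Times_iff)

lemma N_cancel: "u \<in> N \<Longrightarrow> u + v \<in> N \<longleftrightarrow> v \<in> N"
proof -
  assume u: "u \<in> N"
  have "v \<in> N" if "u + v \<in> N"
    using normal_subgrpD(2)[OF normal normal_subgrpD(3)[OF normal u] that] by (simp add: add.assoc[symmetric])
  then show ?thesis using normal_subgrpD(2)[OF normal u] by blast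
qed

lemma N_uminus: "- u \<in> N \<longleftrightarrow> u \<in> N"
  using normal_subgrpD(3)[OF normal] by (metis minus_minus)

text \<open>Exactly one representative r lies in the coset of u, and for it r + v and u + v are in N
  together. This is the multiplicativity of the regular representation of G/N.\<close>

lemma sum_transversal:
  "(\<Sum>r\<in>R. of_bool (u + - r \<in> N) * of_bool (r + v \<in> N)) = (of_bool (u + v \<in> N) :: 'a::semiring_1)"
proof -
  obtain r0 where r0: "r0 \<in> R" "u + - r0 \<in> N" "\<And>r. r \<in> R \<Longrightarrow> u + - r \<in> N \<Longrightarrow> r = r0"
    using transversal[of u] by blast
  have "u + v = (u + - r0) + (r0 + v)" by (simp add: add.assoc del: add_uminus_conv_diff)
  then have eq: "r0 + v \<in> N \<longleftrightarrow> u + v \<in> N" using N_cancel[OF r0(2)] by metis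
  have "(\<Sum>r\<in>R. of_bool (u + - r \<in> N) * of_bool (r + v \<in> N)) = (\<Sum>r\<in>R. if r = r0 then of_bool (u + v \<in> N) else (0::'a))"
  proof (rule sum.cong[OF refl])
    fix r assume r: "r \<in> R"
    show "of_bool (u + - r \<in> N) * of_bool (r + v \<in> N) = (if r = r0 then of_bool (u + v \<in> N) else (0::'a))"
    proof (cases "r = r0")
      case True
      then show ?thesis using r0(2) eq by simp
    next
      case False
      then have "u + - r \<notin> N" using r0(3) r by blast
      then show ?thesis using False by simp
    qed
  qed
  then show ?thesis using r0 finR by simp
qed

lemma card_transversal_translate: "card (R \<inter> {r. u + - r \<in> N}) = 1"
proof -
  obtain r0 where "r0 \<in> R" "u + - r0 \<in> N" "\<And>r. r \<in> R \<Longrightarrow> u + - r \<in> N \<Longrightarrow> r = r0"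
    using transversal[of u] by blast
  then have "R \<inter> {r. u + - r \<in> N} = {r0}" by blast
  then show ?thesis by simp
qed

definition qmat :: "'g cgmat \<Rightarrow> complex mat" where
  "qmat A = mat n n (\<lambda>(a, b). \<Sum>g\<in>supp (A (fst (e a)) (fst (e b))).
     of_bool (snd (e a) + g + - snd (e b) \<in> N) * A (fst (e a)) (fst (e b)) g)"

lemma qmat_carrier [simp]: "qmat A \<in> carrier_mat n n"
  by (simp add: qmat_def)

lemma dim_qmat [simp]: "dim_row (qmat A) = n" "dim_col (qmat A) = n"
  by (simp_all add: qmat_def)

lemma qmat_index:
  assumes "msupp S A" "a < n" "b < n"
  shows "qmat A $$ (a, b) = (\<Sum>g\<in>S. of_bool (snd (e a) + g + - snd (e b) \<in> N) * A (fst (e a)) (fst (e b)) g)"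
proof -
  have "(\<Sum>g\<in>supp (A (fst (e a)) (fst (e b))). of_bool (snd (e a) + g + - snd (e b) \<in> N) * A (fst (e a)) (fst (e b)) g)
    = (\<Sum>g\<in>S. of_bool (snd (e a) + g + - snd (e b) \<in> N) * A (fst (e a)) (fst (e b)) g)"
    using assms by (intro sum.mono_neutral_left) (auto simp: msupp_def supp_def)
  then show ?thesis using assms by (simp add: qmat_def)
qed

lemma qmat_mult:
  assumes A: "msupp S A" and B: "msupp T B"
  shows "qmat (mmult p A B) = qmat A * qmat B"
proof (rule eq_matI)
  fix a b assume "a < dim_row (qmat A * qmat B)" "b < dim_col (qmat A * qmat B)"
  then have ab: "a < n" "b < n" by (auto simp: qmat_def)
  define i j x y where "i = fst (e a)" and "j = fst (e b)" and "x = snd (e a)" and "y = snd (e b)"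
  have fin: "finite S" "finite T" using A B by (auto simp: msupp_def)
  have "(qmat A * qmat B) $$ (a, b) = (\<Sum>c<n. qmat A $$ (a, c) * qmat B $$ (c, b))"
    using ab by (simp add: scalar_prod_def lessThan_atLeast0 qmat_def)
  also have "\<dots> = (\<Sum>c<n. (\<Sum>g\<in>S. of_bool (x + g + - snd (e c) \<in> N) * A i (fst (e c)) g)
      * (\<Sum>h\<in>T. of_bool (snd (e c) + h + - y \<in> N) * B (fst (e c)) j h))"
    using ab by (intro sum.cong refl) (simp add: qmat_index[OF A] qmat_index[OF B] i_def j_def x_def y_def)
  also have "\<dots> = (\<Sum>l<p. \<Sum>r\<in>R. (\<Sum>g\<in>S. of_bool (x + g + - r \<in> N) * A i l g)
      * (\<Sum>h\<in>T. of_bool (r + h + - y \<in> N) * B l j h))"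
    by (rule sum_enum)
  also have "\<dots> = (\<Sum>l<p. \<Sum>r\<in>R. \<Sum>g\<in>S. \<Sum>h\<in>T. (of_bool (x + g + - r \<in> N) * of_bool (r + (h + - y) \<in> N)) * (A i l g * B l j h))"
    by (simp only: sum_product mult_ac add.assoc)
  also have "\<dots> = (\<Sum>l<p. \<Sum>g\<in>S. \<Sum>h\<in>T. \<Sum>r\<in>R. (of_bool (x + g + - r \<in> N) * of_bool (r + (h + - y) \<in> N)) * (A i l g * B l j h))"
    by (intro sum.cong[OF refl] sum_swap3)
  also have "\<dots> = (\<Sum>l<p. \<Sum>g\<in>S. \<Sum>h\<in>T. of_bool (x + g + (h + - y) \<in> N) * (A i l g * B l j h))"
    by (simp only: sum_distrib_right[symmetric] sum_transversal)
  also have "\<dots> = (\<Sum>l<p. \<Sum>h\<in>T. \<Sum>g\<in>S. of_bool (x + g + (h + - y) \<in> N) * (A i l g * B l j h))"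
    by (intro sum.cong[OF refl] sum.swap)
  also have "\<dots> = (\<Sum>l<p. \<Sum>h\<in>T. (\<Sum>g\<in>S. of_bool (x + (g + h) + - y \<in> N) * A i l g) * B l j h)"
    by (simp only: sum_distrib_right mult.assoc add.assoc)
  also have "\<dots> = (\<Sum>l<p. \<Sum>h\<in>T. (\<Sum>m\<in>addset S T. of_bool (x + m + - y \<in> N) * A i l (m + - h)) * B l j h)"
    by (intro sum.cong[OF refl] arg_cong[where f = "\<lambda>z. z * B _ j _"],
        rule sum_translate[where x = "\<lambda>m. of_bool (x + m + - y \<in> N)", symmetric])
       (use fin A in \<open>auto simp: msuppD\<close>)
  also have "\<dots> = (\<Sum>l<p. \<Sum>h\<in>T. \<Sum>m\<in>addset S T. of_bool (x + m + - y \<in> N) * (A i l (m + - h) * B l j h))"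
    by (simp only: sum_distrib_right mult.assoc)
  also have "\<dots> = (\<Sum>m\<in>addset S T. \<Sum>l<p. \<Sum>h\<in>T. of_bool (x + m + - y \<in> N) * (A i l (m + - h) * B l j h))"
    by (rule sum_swap3[symmetric])
  also have "\<dots> = (\<Sum>m\<in>addset S T. of_bool (x + m + - y \<in> N) * mmult p A B i j m)"
    unfolding mmult_vmul vmul_eq[OF B] by (simp only: sum_distrib_left)
  also have "\<dots> = qmat (mmult p A B) $$ (a, b)"
    using qmat_index[OF msupp_mmult[OF A B] ab] by (simp add: i_def j_def x_def y_def)
  finally show "qmat (mmult p A B) $$ (a, b) = (qmat A * qmat B) $$ (a, b)" ..
qed (auto simp: qmat_def)

lemma qmat_mstar:
  assumes A: "msupp S A"
  shows "qmat (mstar A) = hadj (qmat A)"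
proof (rule eq_matI)
  fix a b assume "a < dim_row (hadj (qmat A))" "b < dim_col (hadj (qmat A))"
  then have ab: "a < n" "b < n" by (auto simp: qmat_def)
  define i j x y where "i = fst (e a)" and "j = fst (e b)" and "x = snd (e a)" and "y = snd (e b)"
  have "qmat (mstar A) $$ (a, b) = (\<Sum>g\<in>uminus ` S. of_bool (x + g + - y \<in> N) * mstar A i j g)"
    using qmat_index[OF msupp_mstar[OF A] ab] by (simp add: i_def j_def x_def y_def)
  also have "\<dots> = (\<Sum>g\<in>S. of_bool (x + - g + - y \<in> N) * cnj (A j i g))"
    by (subst sum.reindex) (auto simp: mstar_def grp_star_def)
  also have "\<dots> = cnj (\<Sum>g\<in>S. of_bool (y + g + - x \<in> N) * A j i g)"
  proof -
    have "x + - g + - y \<in> N \<longleftrightarrow> y + g + - x \<in> N" for g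
      using N_uminus[of "x + - g + - y"] by (simp add: minus_add add.assoc del: add_uminus_conv_diff)
    moreover have "cnj (of_bool b * z) = of_bool b * cnj z" for b z by (cases b) simp_all
    ultimately show ?thesis by (simp only: cnj_sum)
  qed
  also have "\<dots> = hadj (qmat A) $$ (a, b)"
    using ab qmat_index[OF A ab(2) ab(1)] by (simp add: qmat_def[of A] i_def j_def x_def y_def)
  finally show "qmat (mstar A) $$ (a, b) = hadj (qmat A) $$ (a, b)" .
qed (auto simp: qmat_def)

lemma qmat_mone: "qmat mone = 1\<^sub>m n"
proof (rule eq_matI)
  fix a b assume "a < dim_row (1\<^sub>m n :: complex mat)" "b < dim_col (1\<^sub>m n :: complex mat)"
  then have ab: "a < n" "b < n" by auto
  have "snd (e a) + - snd (e b) \<in> N \<longleftrightarrow> snd (e a) = snd (e b)"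
  proof
    assume "snd (e a) + - snd (e b) \<in> N"
    moreover have "snd (e a) + - snd (e a) \<in> N" using normal_subgrpD(1)[OF normal] by simp
    ultimately show "snd (e a) = snd (e b)"
      using transversal[of "snd (e a)"] enum_in(2) ab by blast
  qed (use normal_subgrpD(1)[OF normal] in simp)
  then have "qmat mone $$ (a, b) = of_bool (e a = e b)"
    using qmat_index[OF msupp_mone ab] by (auto simp: mone_def prod_eq_iff)
  also have "e a = e b \<longleftrightarrow> a = b"
    using enum ab by (auto simp: bij_betw_def inj_on_def)
  finally show "qmat mone $$ (a, b) = 1\<^sub>m n $$ (a, b)" using ab by simp
qed (auto simp: qmat_def)

lemma pow_mat_Suc_left:
  assumes "(A :: complex mat) \<in> carrier_mat m m"
  shows "A * A ^\<^sub>m k = A ^\<^sub>m Suc k"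
proof (induction k)
  case 0
  then show ?case using assms by simp
next
  case (Suc k)
  have c: "A ^\<^sub>m k \<in> carrier_mat m m" using assms by simp
  have "A * A ^\<^sub>m Suc k = (A * A ^\<^sub>m k) * A"
    using assoc_mult_mat[OF assms c assms] by simp
  then show ?case by (simp add: Suc)
qed

lemma qmat_mpow: "msupp S A \<Longrightarrow> qmat (mpow p A k) = qmat A ^\<^sub>m k"
proof (induction k)
  case 0
  then show ?case using qmat_carrier[of A] by (simp add: qmat_mone)
next
  case (Suc k)
  then show ?case
    using qmat_mult[OF Suc.prems msupp_mpow[OF Suc.prems, of k p]] pow_mat_Suc_left[OF qmat_carrier, of A k] by simp
qed

text \<open>By normality r + g - r lies in N exactly when g does, and N meets the support at most in
  0. So each diagonal entry is the identity coefficient: the finite trace equals the von Neumann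
  trace exactly, up to the factor \<open>card R\<close>, and not merely in a limit.\<close>

lemma qmat_trace:
  assumes A: "msupp S A" and S: "S \<inter> N \<subseteq> {0}"
  shows "(\<Sum>a<n. qmat A $$ (a, a)) = of_nat (card R) * trN p A"
proof -
  have conj: "r + g + - r \<in> N \<longleftrightarrow> g \<in> N" for r g
  proof
    assume "r + g + - r \<in> N"
    then have "- r + (r + g + - r) + - (- r) \<in> N" by (rule normal_subgrpD(4)[OF normal])
    then show "g \<in> N" by (simp add: add.assoc)
  qed (rule normal_subgrpD(4)[OF normal])
  have "(\<Sum>a<n. qmat A $$ (a, a)) = (\<Sum>a<n. \<Sum>g\<in>S. of_bool (g \<in> N) * A (fst (e a)) (fst (e a)) g)"
    by (rule sum.cong[OF refl]) (simp add: qmat_index[OF A] conj del: add_uminus_conv_diff)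
  also have "\<dots> = (\<Sum>i<p. \<Sum>r\<in>R. \<Sum>g\<in>S. of_bool (g \<in> N) * A i i g)"
    by (rule sum_enum)
  also have "\<dots> = (\<Sum>i<p. \<Sum>r\<in>R. A i i 0)"
  proof (intro sum.cong[OF refl])
    fix i
    have "(\<Sum>g\<in>S. of_bool (g \<in> N) * A i i g) = (\<Sum>g\<in>S. if g = 0 then A i i 0 else 0)"
      using S normal_subgrpD(1)[OF normal] by (intro sum.cong refl) auto
    also have "\<dots> = A i i 0" using A by (auto simp: msuppD)
    finally show "(\<Sum>g\<in>S. of_bool (g \<in> N) * A i i g) = A i i 0" .
  qed
  finally show ?thesis by (simp add: trN_def sum_distrib_left)
qed

text \<open>For a fixed row, each group element g reaches exactly one coset, so it is counted once
  for each matrix column. The bound mentions neither N nor R.\<close>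

lemma qmat_row_sum:
  assumes A: "msupp S A" and a: "a < n"
  shows "(\<Sum>b<n. cmod (qmat A $$ (a, b))) \<le> (\<Sum>i<p. \<Sum>j<p. \<Sum>g\<in>S. cmod (A i j g))"
proof -
  define i x where "i = fst (e a)" and "x = snd (e a)"
  have "(\<Sum>b<n. cmod (qmat A $$ (a, b))) \<le> (\<Sum>b<n. \<Sum>g\<in>S. of_bool (x + g + - snd (e b) \<in> N) * cmod (A i (fst (e b)) g))"
  proof (rule sum_mono)
    fix b assume "b \<in> {..<n}"
    then show "cmod (qmat A $$ (a, b)) \<le> (\<Sum>g\<in>S. of_bool (x + g + - snd (e b) \<in> N) * cmod (A i (fst (e b)) g))"
      using qmat_index[OF A a, of b] by (auto simp: i_def x_def norm_mult intro!: order.trans[OF norm_sum] sum_mono)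
  qed
  also have "\<dots> = (\<Sum>j<p. \<Sum>r\<in>R. \<Sum>g\<in>S. of_bool (x + g + - r \<in> N) * cmod (A i j g))"
    by (rule sum_enum)
  also have "\<dots> = (\<Sum>j<p. \<Sum>g\<in>S. \<Sum>r\<in>R. of_bool (x + g + - r \<in> N) * cmod (A i j g))"
    by (intro sum.cong[OF refl] sum.swap)
  also have "\<dots> = (\<Sum>j<p. \<Sum>g\<in>S. cmod (A i j g))"
    using finR card_transversal_translate
    by (simp add: sum_distrib_right[symmetric] del: add_uminus_conv_diff)
  also have "\<dots> \<le> (\<Sum>i<p. \<Sum>j<p. \<Sum>g\<in>S. cmod (A i j g))"
    using enum_in(1)[OF a] by (intro member_le_sum[of i "{..<p}" "\<lambda>i. \<Sum>j<p. \<Sum>g\<in>S. cmod (A i j g)"]) (auto simp: i_def intro!: sum_nonneg)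
  finally show ?thesis .
qed

end

lemma finite_quotient_exists:
  fixes F :: "'g::group_add set"
  assumes "residually_finite_grp TYPE('g)" "finite F"
  obtains N R :: "'g set" and n e where "finite_quotient N R p n e" "F \<inter> N \<subseteq> {0}"
proof -
  obtain N where N: "fin_normal N" "N \<inter> F \<subseteq> {0}"
    using residually_finite_avoid[OF assms] .
  obtain R where R: "finite R" "R \<noteq> {}" "\<And>g. \<exists>!r. r \<in> R \<and> g + - r \<in> N"
    using fin_normal_transversal[OF N(1)] by blast
  obtain e where "bij_betw e {0..<card ({..<p} \<times> R)} ({..<p} \<times> R)"
    using ex_bij_betw_nat_finite[of "{..<p} \<times> R"] R by auto
  then have "finite_quotient N R p (card ({..<p} \<times> R)) e"
    using R N by unfold_locales (auto simp: fin_normal_def lessThan_atLeast0)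
  then show thesis using that N by blast
qed

section \<open>Measures on a compact interval and their moments\<close>

locale interval_measure = finite_measure \<mu> for \<mu> :: "real measure" +
  fixes K :: real
  assumes sets_eq [simp, measurable_cong]: "sets \<mu> = sets borel"
    and AE_interval: "AE x in \<mu>. 0 \<le> x \<and> x \<le> K"
begin

lemma integrable_interval:
  fixes f :: "real \<Rightarrow> 'b::{banach, second_countable_topology}"
  assumes "f \<in> borel_measurable borel" "\<And>x. 0 \<le> x \<Longrightarrow> x \<le> K \<Longrightarrow> norm (f x) \<le> B"
  shows "integrable \<mu> f"
proof (rule integrable_const_bound[of _ B])
  show "AE x in \<mu>. norm (f x) \<le> B" using AE_interval by eventually_elim (use assms in auto)
qed (use assms in measurable)

lemma integrable_power: "integrable \<mu> (\<lambda>x. x ^ k)"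
  by (rule integrable_interval[of _ "K ^ k"]) (auto intro: power_mono)

lemma integrable_poly: "integrable \<mu> (\<lambda>x. \<Sum>i\<le>n. a i * x ^ i)"
  by (intro Bochner_Integration.integrable_sum integrable_mult_right integrable_power)

lemma integral_poly: "(\<integral>x. (\<Sum>i\<le>n. a i * x ^ i) \<partial>\<mu>) = (\<Sum>i\<le>n. a i * (\<integral>x. x ^ i \<partial>\<mu>))"
  by (subst Bochner_Integration.integral_sum) (auto intro: integrable_power)

text \<open>The total mass is written as the zeroth moment, since moments are what the trace formula
  provides.\<close>

lemma integral_approx:
  fixes f :: "real \<Rightarrow> real"
  assumes f: "f \<in> borel_measurable borel" and le: "\<And>x. 0 \<le> x \<Longrightarrow> x \<le> K \<Longrightarrow> \<bar>f x - (\<Sum>i\<le>n. a i * x ^ i)\<bar> \<le> d"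
  shows "\<bar>(\<integral>x. f x \<partial>\<mu>) - (\<Sum>i\<le>n. a i * (\<integral>x. x ^ i \<partial>\<mu>))\<bar> \<le> d * (\<integral>x. x ^ 0 \<partial>\<mu>)"
proof -
  have int: "integrable \<mu> (\<lambda>x. f x - (\<Sum>i\<le>n. a i * x ^ i))"
    by (rule integrable_interval[of _ d]) (use f le in auto)
  have "integrable \<mu> (\<lambda>x. f x - (\<Sum>i\<le>n. a i * x ^ i) + (\<Sum>i\<le>n. a i * x ^ i))"
    by (intro Bochner_Integration.integrable_add int integrable_poly)
  then have "integrable \<mu> f" by simp
  then have "(\<integral>x. f x \<partial>\<mu>) - (\<Sum>i\<le>n. a i * (\<integral>x. x ^ i \<partial>\<mu>)) = (\<integral>x. f x - (\<Sum>i\<le>n. a i * x ^ i) \<partial>\<mu>)"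
    using integrable_poly[of a n] by (simp add: integral_poly)
  also have "\<bar>\<dots>\<bar> \<le> (\<integral>x. \<bar>f x - (\<Sum>i\<le>n. a i * x ^ i)\<bar> \<partial>\<mu>)"
    by (rule integral_abs_bound)
  also have "\<dots> \<le> (\<integral>x. d \<partial>\<mu>)"
  proof (rule integral_mono_AE)
    show "AE x in \<mu>. \<bar>f x - (\<Sum>i\<le>n. a i * x ^ i)\<bar> \<le> d"
      using AE_interval by eventually_elim (use le in auto)
  qed (use int in auto)
  finally show ?thesis by (simp add: mult.commute)
qed

end

section \<open>Uniqueness and existence for the moment problem on [0, K]\<close>

lemma poly_approx_interval:
  fixes f :: "real \<Rightarrow> real"
  assumes "continuous_on {0..K} f" "0 < d"
  obtains a n where "\<And>x. 0 \<le> x \<Longrightarrow> x \<le> K \<Longrightarrow> \<bar>f x - (\<Sum>i\<le>n. a i * x ^ i)\<bar> \<le> d"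
proof -
  obtain g where g: "real_polynomial_function g" "\<And>x. x \<in> {0..K} \<Longrightarrow> \<bar>f x - g x\<bar> < d"
    using Stone_Weierstrass_real_polynomial_function[of "{0..K}" f d] assms by auto
  obtain a n where "g = (\<lambda>x. \<Sum>i\<le>n. a i * x ^ i)"
    using g(1) real_polynomial_function_iff_sum by blast
  then have "\<bar>f x - (\<Sum>i\<le>n. a i * x ^ i)\<bar> \<le> d" if "0 \<le> x" "x \<le> K" for x
    using g(2)[of x] that by simp
  then show thesis by (rule that)
qed

lemma integral_continuous_eq:
  fixes f :: "real \<Rightarrow> real"
  assumes "interval_measure \<mu> K" "interval_measure \<nu> K"
    and mom: "\<And>k. (\<integral>x. x ^ k \<partial>\<mu>) = (\<integral>x. x ^ k \<partial>\<nu>)" and f: "continuous_on UNIV f"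
  shows "(\<integral>x. f x \<partial>\<mu>) = (\<integral>x. f x \<partial>\<nu>)"
proof -
  interpret \<mu>: interval_measure \<mu> K by fact
  interpret \<nu>: interval_measure \<nu> K by fact
  define m where "m = (\<integral>x. x ^ 0 \<partial>\<mu>)"
  have m: "0 \<le> m" unfolding m_def by simp
  have "\<bar>(\<integral>x. f x \<partial>\<mu>) - (\<integral>x. f x \<partial>\<nu>)\<bar> \<le> 0 + e" if "0 < e" for e
  proof -
    \<comment> \<open>Two approximation errors d * m must add up to at most e; the summand 1 keeps
      the denominator positive when the mass m is 0.\<close>
    define d where "d = e / (2 * (m + 1))"
    have d: "0 < d" using m that by (simp add: d_def)
    obtain a n where a: "\<And>x. 0 \<le> x \<Longrightarrow> x \<le> K \<Longrightarrow> \<bar>f x - (\<Sum>i\<le>n. a i * x ^ i)\<bar> \<le> d"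
      using poly_approx_interval[of K f d] f d continuous_on_subset by blast
    have fm: "f \<in> borel_measurable borel" using f by (rule borel_measurable_continuous_onI)
    have "\<bar>(\<integral>x. f x \<partial>\<mu>) - (\<Sum>i\<le>n. a i * (\<integral>x. x ^ i \<partial>\<mu>))\<bar> \<le> d * m"
      unfolding m_def by (rule \<mu>.integral_approx[OF fm a])
    moreover have "\<bar>(\<integral>x. f x \<partial>\<nu>) - (\<Sum>i\<le>n. a i * (\<integral>x. x ^ i \<partial>\<mu>))\<bar> \<le> d * m"
      unfolding m_def mom by (rule \<nu>.integral_approx[OF fm a])
    moreover have "d * m + d * m \<le> e"
    proof -
      have "m + 1 \<noteq> 0" using m by simp
      then have "2 * (d * (m + 1)) = e" by (simp add: d_def field_simps)
      moreover have "d * m \<le> d * (m + 1)" using d by simp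
      ultimately show ?thesis by linarith
    qed
    ultimately show ?thesis by linarith
  qed
  then have "\<bar>(\<integral>x. f x \<partial>\<mu>) - (\<integral>x. f x \<partial>\<nu>)\<bar> \<le> 0" by (rule field_le_epsilon)
  then show ?thesis by simp
qed

text \<open>Cosine and sine are continuous, so equal moments give equal characteristic functions
  after normalisation to mass 1, and Levy's theorem applies. Mass 0 cannot be normalised and is
  treated apart.\<close>

lemma interval_measure_unique:
  assumes "interval_measure \<mu> K" "interval_measure \<nu> K"
    and mom: "\<And>k. (\<integral>x. x ^ k \<partial>\<mu>) = (\<integral>x. x ^ k \<partial>\<nu>)"
  shows "\<mu> = \<nu>"
proof -
  interpret \<mu>: interval_measure \<mu> K by fact
  interpret \<nu>: interval_measure \<nu> K by fact
  have sp [simp]: "space \<mu> = UNIV" "space \<nu> = UNIV"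
    using sets_eq_imp_space_eq[OF \<mu>.sets_eq] sets_eq_imp_space_eq[OF \<nu>.sets_eq] by simp_all
  define m where "m = measure \<mu> UNIV"
  have m\<nu>: "measure \<nu> UNIV = m"
    using mom[of 0] by (simp add: m_def)
  have em: "emeasure \<mu> UNIV = ennreal m" "emeasure \<nu> UNIV = ennreal m"
    using \<mu>.emeasure_eq_measure \<nu>.emeasure_eq_measure m\<nu> by (simp_all add: m_def)
  show ?thesis
  proof (cases "m = 0")
    case True
    then have "emeasure \<mu> A = 0" "emeasure \<nu> A = 0" for A
      using emeasure_space[of \<mu> A] emeasure_space[of \<nu> A] em by auto
    then show ?thesis by (intro measure_eqI) auto
  next
    case False
    then have m: "0 < m" by (simp add: m_def zero_less_measure_iff)
    define nrm where "nrm \<xi> = density \<xi> (\<lambda>_. ennreal (1 / m))" for \<xi> :: "real measure"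
    have emn: "emeasure (nrm \<xi>) A = ennreal (1 / m) * emeasure \<xi> A" if "A \<in> sets \<xi>" for A \<xi>
      unfolding nrm_def using that by (simp add: emeasure_density_const)
    have rd: "real_distribution (nrm \<xi>)" if "sets \<xi> = sets borel" "emeasure \<xi> UNIV = ennreal m" for \<xi>
    proof -
      have [simp]: "space \<xi> = UNIV" using sets_eq_imp_space_eq[OF that(1)] by simp
      have "emeasure (nrm \<xi>) UNIV = 1"
        using that m by (simp add: emn ennreal_mult[symmetric])
      then have "prob_space (nrm \<xi>)"
        by (intro prob_spaceI) (simp add: nrm_def)
      then show ?thesis using that(1)
        by (intro real_distribution.intro real_distribution_axioms.intro) (auto simp: nrm_def)
    qed
    have int: "integral\<^sup>L (nrm \<xi>) f = (\<integral>x. f x \<partial>\<xi>) / m"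
      if "sets \<xi> = sets borel" "f \<in> borel_measurable borel" for \<xi> and f :: "real \<Rightarrow> real"
      unfolding nrm_def using that m
      by (subst integral_density) (auto cong: measurable_cong_sets)
    have "char (nrm \<mu>) t = char (nrm \<nu>) t" for t
    proof -
      interpret M1: real_distribution "nrm \<mu>" using rd em by simp
      interpret M2: real_distribution "nrm \<nu>" using rd em by simp
      have i: "integrable (nrm \<mu>) (\<lambda>x. iexp (t * x))" "integrable (nrm \<nu>) (\<lambda>x. iexp (t * x))"
        by (auto intro!: M1.integrable_const_bound[of _ 1] M2.integrable_const_bound[of _ 1])
      have c: "(\<lambda>x. cos (t * x)) \<in> borel_measurable borel" "(\<lambda>x. sin (t * x)) \<in> borel_measurable borel"
        by auto
      have "(\<integral>x. cos (t * x) \<partial>\<mu>) = (\<integral>x. cos (t * x) \<partial>\<nu>)" "(\<integral>x. sin (t * x) \<partial>\<mu>) = (\<integral>x. sin (t * x) \<partial>\<nu>)"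
        by (intro integral_continuous_eq[OF assms] continuous_intros)+
      then have "integral\<^sup>L (nrm \<mu>) (\<lambda>x. Re (iexp (t * x))) = integral\<^sup>L (nrm \<nu>) (\<lambda>x. Re (iexp (t * x)))"
        "integral\<^sup>L (nrm \<mu>) (\<lambda>x. Im (iexp (t * x))) = integral\<^sup>L (nrm \<nu>) (\<lambda>x. Im (iexp (t * x)))"
        using c by (simp_all add: Re_exp Im_exp int)
      then show ?thesis
        unfolding char_def using integral_Re[OF i(1)] integral_Re[OF i(2)] integral_Im[OF i(1)] integral_Im[OF i(2)]
        by (simp add: complex_eq_iff)
    qed
    then have eq: "nrm \<mu> = nrm \<nu>"
      using rd em by (intro Levy_uniqueness) auto
    show ?thesis
    proof (rule measure_eqI)
      fix A assume A: "A \<in> sets \<mu>"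
      have "ennreal (1 / m) * emeasure \<mu> A = ennreal (1 / m) * emeasure \<nu> A"
        using emn[of A \<mu>] emn[of A \<nu>] A eq by simp
      then show "emeasure \<mu> A = emeasure \<nu> A"
        using m by (simp add: ennreal_mult_cancel_left)
    qed simp
  qed
qed

text \<open>The normalised counting measures of the lists f are all carried by [0, K], hence tight,
  and have a weak limit along a subsequence. Each scaled moment is exactly m k from degree k on, so
  the limit has the right moments; c supplies the total mass.\<close>

lemma interval_measure_exists:
  fixes m :: "nat \<Rightarrow> real"
  assumes c: "0 \<le> c" and K: "0 \<le> K"
    and ap: "\<And>d. \<exists>n f. 0 < n \<and> (\<forall>i<n. 0 \<le> f i \<and> f i \<le> K) \<and> (\<forall>k\<le>d. c * ((\<Sum>i<n. f i ^ k) / real n) = m k)"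
  shows "\<exists>\<mu>. interval_measure \<mu> K \<and> (\<forall>k. (\<integral>x. x ^ k \<partial>\<mu>) = m k)"
proof -
  obtain n f where n: "\<And>d. 0 < n d" and f: "\<And>d i. i < n d \<Longrightarrow> 0 \<le> f d i \<and> f d i \<le> K"
    and mom: "\<And>d k. k \<le> d \<Longrightarrow> c * ((\<Sum>i<n d. f d i ^ k) / real (n d)) = m k"
    using ap by metis
  define P where "P d = measure_pmf (pmf_of_set {..<n d})" for d
  define M where "M d = distr (P d) borel (f d)" for d
  have set_pmf: "set_pmf (pmf_of_set {..<n d}) = {..<n d}" for d
    using n[of d] by (intro set_pmf_of_set) auto
  have fmeas: "f d \<in> measurable (P d) borel" for d by (simp add: P_def)
  have rd: "real_distribution (M d)" for d
    unfolding M_def P_def by (rule prob_space.real_distribution_distr) (auto intro: prob_space_measure_pmf)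
  have intM: "(\<integral>x. g x \<partial>M d) = (\<Sum>i<n d. g (f d i)) / real (n d)"
    if "g \<in> borel_measurable borel" for g :: "real \<Rightarrow> real" and d
  proof -
    have "(\<integral>x. g x \<partial>M d) = (\<integral>i. g (f d i) \<partial>P d)"
      unfolding M_def by (rule integral_distr[OF fmeas that])
    also have "\<dots> = (\<Sum>i<n d. g (f d i)) / real (n d)"
      unfolding P_def using n[of d] by (subst integral_pmf_of_set) auto
    finally show ?thesis .
  qed
  have AEM: "AE x in M d. 0 \<le> x \<and> x \<le> K" for d
    unfolding M_def
    by (subst AE_distr_iff[OF fmeas]) (simp, unfold P_def AE_measure_pmf_iff set_pmf, use f in auto)
  have "tight M"
    unfolding tight_def
  proof (intro conjI allI impI rd)
    fix \<epsilon> :: real assume \<epsilon>: "0 < \<epsilon>"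
    have "measure (M d) {-1<..K} = 1" for d
    proof -
      interpret real_distribution "M d" by (rule rd)
      have "AE x in M d. x \<in> {-1<..K}" using AEM[of d] by eventually_elim auto
      then show ?thesis by (subst prob_eq_1) auto
    qed
    then show "\<exists>a b. a < b \<and> (\<forall>d. 1 - \<epsilon> < measure (M d) {a<..b})"
      using K \<epsilon> by (intro exI[of _ "-1"] exI[of _ K]) auto
  qed
  then obtain r L where r: "strict_mono r" and L: "real_distribution L" and conv: "weak_conv_m (M \<circ> id \<circ> r) L"
    using tight_imp_convergent_subsubsequence[of M id] strict_mono_id by blast
  interpret L: real_distribution L by (rule L)
  have lim: "(\<lambda>d. (\<integral>x. g x \<partial>M (r d))) \<longlonglongrightarrow> (\<integral>x. g x \<partial>L)"
    if "\<And>x. isCont g x" "\<And>x. norm (g x) \<le> B" for g :: "real \<Rightarrow> real" and B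
    using weak_conv_imp_integral_bdd_continuous_conv[of "M \<circ> id \<circ> r" L g B] rd L conv that by auto
  \<comment> \<open>Weak convergence tests only bounded continuous functions on the whole line.
    Clamping to [0, K] makes the powers bounded without changing them on the supports.\<close>
  define cl where "cl x = max 0 (min K x)" for x :: real
  have cl: "0 \<le> cl x" "cl x \<le> K" "0 \<le> x \<Longrightarrow> x \<le> K \<Longrightarrow> cl x = x" for x
    using K by (auto simp: cl_def)
  have clc: "isCont cl x" for x unfolding cl_def by (intro continuous_intros)
  have AEL: "AE x in L. 0 \<le> x \<and> x \<le> K"
  proof -
    \<comment> \<open>A bounded continuous function that vanishes exactly on [0, K]; its integral is
      0 along the sequence and so in the limit.\<close>
    define h where "h x = min 1 \<bar>x - cl x\<bar>" for x
    have h0: "0 \<le> h x" for x by (simp add: h_def)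
    have hc: "isCont h x" for x unfolding h_def by (intro continuous_intros clc)
    then have hm: "h \<in> borel_measurable borel"
      by (intro borel_measurable_continuous_onI continuous_at_imp_continuous_on) auto
    have "(\<integral>x. h x \<partial>M d) = 0" for d
      unfolding intM[OF hm] using f cl by (auto simp: h_def intro!: sum.neutral)
    then have "(\<integral>x. h x \<partial>L) = 0"
      using lim[of h 1] hc LIMSEQ_unique[of "\<lambda>_. 0::real" 0] by (force simp: h_def)
    moreover have "integrable L h"
      by (rule L.integrable_const_bound[of _ 1]) (use hm in \<open>auto simp: h_def\<close>)
    ultimately have "AE x in L. h x = 0"
      using integral_nonneg_eq_0_iff_AE[of L h] h0 by simp
    then show ?thesis
    proof eventually_elim
      case (elim x)
      then have "x = cl x" by (auto simp: h_def min_def split: if_splits)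
      then show ?case using cl by metis
    qed
  qed
  have momL: "c * (\<integral>x. x ^ k \<partial>L) = m k" for k
  proof -
    have gc: "isCont (\<lambda>x. cl x ^ k) x" for x by (intro continuous_intros clc)
    then have gm: "(\<lambda>x. cl x ^ k) \<in> borel_measurable borel"
      by (intro borel_measurable_continuous_onI continuous_at_imp_continuous_on) auto
    have "(\<lambda>d. c * (\<integral>x. cl x ^ k \<partial>M (r d))) \<longlonglongrightarrow> c * (\<integral>x. cl x ^ k \<partial>L)"
      by (intro tendsto_mult_left lim[of _ "K ^ k"] gc) (auto simp: cl power_mono)
    moreover have "\<forall>\<^sub>F d in sequentially. c * (\<integral>x. cl x ^ k \<partial>M (r d)) = m k"
    proof (rule eventually_sequentiallyI[of k])
      fix d assume "k \<le> d"
      then have "k \<le> r d" using seq_suble[OF r, of d] by simp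
      have "(\<integral>x. cl x ^ k \<partial>M (r d)) = (\<Sum>i<n (r d). f (r d) i ^ k) / real (n (r d))"
        unfolding intM[OF gm] using f cl by (auto intro!: sum.cong arg_cong2[where f = "(/)"])
      then show "c * (\<integral>x. cl x ^ k \<partial>M (r d)) = m k" using mom[OF \<open>k \<le> r d\<close>] by simp
    qed
    ultimately have "c * (\<integral>x. cl x ^ k \<partial>L) = m k"
      using tendsto_cong[of "\<lambda>d. c * (\<integral>x. cl x ^ k \<partial>M (r d))" "\<lambda>_. m k" sequentially]
        LIMSEQ_unique tendsto_const by blast
    also have "(\<integral>x. cl x ^ k \<partial>L) = (\<integral>x. x ^ k \<partial>L)"
      by (rule integral_cong_AE) (use gm AEL cl(3) in auto)
    finally show ?thesis .
  qed
  define \<mu> where "\<mu> = density L (\<lambda>_. ennreal c)"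
  have "(\<integral>x. x ^ k \<partial>\<mu>) = m k" for k
    unfolding \<mu>_def using c by (subst integral_density) (auto simp: momL)
  moreover have "interval_measure \<mu> K"
  proof (intro interval_measure.intro interval_measure_axioms.intro)
    show "finite_measure \<mu>"
      by (rule finite_measureI) (simp add: \<mu>_def emeasure_density_const ennreal_mult_eq_top_iff)
    show "AE x in \<mu>. 0 \<le> x \<and> x \<le> K"
      unfolding \<mu>_def using AEL by (subst AE_density) auto
  qed (simp add: \<mu>_def)
  ultimately show ?thesis by blast
qed

section \<open>Regularised logarithmic integrals and the mass at zero\<close>

context interval_measure
begin

definition ulog :: "real \<Rightarrow> real" where
  "ulog \<epsilon> = (\<integral>x. ln (x + \<epsilon>) \<partial>\<mu>)"

lemma integrable_ln:
  assumes "0 < \<epsilon>" shows "integrable \<mu> (\<lambda>x. ln (x + \<epsilon>))"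
proof (rule integrable_interval[of _ "\<bar>ln \<epsilon>\<bar> + \<bar>ln (K + \<epsilon>)\<bar>"])
  fix x assume "0 \<le> x" "x \<le> K"
  then have "ln \<epsilon> \<le> ln (x + \<epsilon>)" "ln (x + \<epsilon>) \<le> ln (K + \<epsilon>)" using assms by simp_all
  then show "norm (ln (x + \<epsilon>)) \<le> \<bar>ln \<epsilon>\<bar> + \<bar>ln (K + \<epsilon>)\<bar>" unfolding real_norm_def by linarith
qed simp

lemma ulog_mono:
  assumes "0 < \<delta>" "\<delta> \<le> \<epsilon>" shows "ulog \<delta> \<le> ulog \<epsilon>"
  unfolding ulog_def
proof (rule integral_mono_AE)
  show "AE x in \<mu>. ln (x + \<delta>) \<le> ln (x + \<epsilon>)"
    using AE_interval by eventually_elim (use assms in auto)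
qed (use assms in \<open>auto intro: integrable_ln\<close>)

text \<open>On [0, K] the functions (1 - x / K)^n are bounded by 1 and tend to the indicator of 0.
  For a spectral measure, the mass of {0} is the von Neumann dimension of the kernel.\<close>

lemma power_limit:
  assumes K: "0 < K"
  shows "(\<lambda>n. \<integral>x. (1 - x / K) ^ n \<partial>\<mu>) \<longlonglongrightarrow> measure \<mu> {0}"
proof -
  have "(\<lambda>n. \<integral>x. (1 - x / K) ^ n \<partial>\<mu>) \<longlonglongrightarrow> (\<integral>x. indicator {0} x \<partial>\<mu>)"
  proof (rule integral_dominated_convergence[where w = "\<lambda>_. 1"])
    show "AE x in \<mu>. (\<lambda>n. (1 - x / K) ^ n) \<longlonglongrightarrow> indicator {0} x"
      using AE_interval
    proof eventually_elim
      case (elim x)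
      show ?case
      proof (cases "x = 0")
        case False
        then have "\<bar>1 - x / K\<bar> < 1" using elim K by (auto simp: field_simps abs_less_iff)
        then show ?thesis using False by (simp add: LIMSEQ_power_zero)
      qed simp
    qed
    show "AE x in \<mu>. norm ((1 - x / K) ^ n) \<le> 1" for n
      using AE_interval
    proof eventually_elim
      case (elim x)
      then have "\<bar>1 - x / K\<bar> \<le> 1" using K by (auto simp: field_simps abs_le_iff)
      then show ?case by (simp add: power_abs power_le_one)
    qed
  qed simp_all
  then show ?thesis by simp
qed

lemma integral_power_binomial:
  "(\<integral>x. (1 - x / c) ^ n \<partial>\<mu>) = (\<Sum>k\<le>n. (n choose k) * (- 1 / c) ^ k * (\<integral>x. x ^ k \<partial>\<mu>))"
proof -
  have "(1 - x / c) ^ n = (\<Sum>k\<le>n. ((n choose k) * (- 1 / c) ^ k) * x ^ k)" for x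
  proof -
    have "(1 - x / c) ^ n = ((- 1 / c) * x + 1) ^ n" by simp
    also have "\<dots> = (\<Sum>k\<le>n. of_nat (n choose k) * ((- 1 / c) * x) ^ k * 1 ^ (n - k))"
      by (rule binomial_ring)
    also have "\<dots> = (\<Sum>k\<le>n. ((n choose k) * (- 1 / c) ^ k) * x ^ k)"
      by (simp only: power_one mult_1_right power_mult_distrib mult.assoc)
    finally show ?thesis .
  qed
  then show ?thesis by (simp only: integral_poly)
qed

lemma ulog_tendsto_integral:
  assumes z: "measure \<mu> {0} = 0" and cls: "(\<integral>\<^sup>+ x. ennreal (indicator {0<..<1} x * - ln x) \<partial>\<mu>) < \<infinity>"
  shows "(\<lambda>n. ulog (1 / real (Suc n))) \<longlonglongrightarrow> (\<integral>x. indicator {0<..} x * ln x \<partial>\<mu>)"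
proof -
  have AEpos: "AE x in \<mu>. x \<noteq> 0"
    using z by (intro AE_I[of _ _ "{0}"]) (auto simp: emeasure_eq_measure)
  have int1: "integrable \<mu> (\<lambda>x. indicator {0<..<1} x * - ln x)"
  proof (rule integrableI_nonneg)
    show "AE x in \<mu>. 0 \<le> indicator {0<..<1} x * - ln x" by (auto simp: indicator_def)
  qed (use cls in auto)
  \<comment> \<open>Below 1 the regularised logarithm is bounded below by ln x, which the
    determinant class hypothesis makes integrable; above, a regulariser of at most 1 gives the bound
    ln (K + 1).\<close>
  define w where "w x = indicator {0<..<1} x * - ln x + \<bar>ln (K + 1)\<bar>" for x :: real
  have intw: "integrable \<mu> w" unfolding w_def using int1 by (intro Bochner_Integration.integrable_add) auto
  show ?thesis unfolding ulog_def
  proof (rule integral_dominated_convergence[where w = w])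
    show "AE x in \<mu>. (\<lambda>n. ln (x + 1 / real (Suc n))) \<longlonglongrightarrow> indicator {0<..} x * ln x"
      using AE_interval AEpos
    proof eventually_elim
      case (elim x)
      then have "0 < x" by simp
      have "(\<lambda>n. ln (x + 1 / real (Suc n))) \<longlonglongrightarrow> ln (x + 0)"
        by (intro tendsto_intros LIMSEQ_inverse_real_of_nat[unfolded inverse_eq_divide]) (use \<open>0 < x\<close> in auto)
      then show ?case using \<open>0 < x\<close> by simp
    qed
    show "AE x in \<mu>. norm (ln (x + 1 / real (Suc n))) \<le> w x" for n
      using AE_interval AEpos
    proof eventually_elim
      case (elim x)
      then have x: "0 < x" "x \<le> K" by simp_all
      have "1 / real (Suc n) \<le> 1" by simp
      then have "ln (x + 1 / real (Suc n)) \<le> ln (K + 1)" 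
        using x by (intro ln_mono add_mono add_pos_pos) auto
      moreover have "ln x \<le> ln (x + 1 / real (Suc n))" using x by (subst ln_le_cancel_iff) (auto intro: add_pos_pos)
      moreover have "indicator {0<..<1} x * - ln x \<ge> - ln x \<and> indicator {0<..<1} x * - ln x \<ge> 0"
        using x by (auto simp: indicator_def)
      ultimately show ?case unfolding w_def real_norm_def by linarith
    qed
  qed (use intw in auto)
qed

text \<open>An atom at 0 contributes - ln (n + 1) times its mass, which no bounded upper part
  compensates. Without an atom the integrals decrease; if they stayed bounded, monotone convergence
  would make - ln x integrable and contradict the failure of determinant class.\<close>

lemma ulog_at_bot:
  assumes not: "\<not> (measure \<mu> {0} = 0 \<and> (\<integral>\<^sup>+ x. ennreal (indicator {0<..<1} x * - ln x) \<partial>\<mu>) < \<infinity>)"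
    and K: "0 \<le> K"
  shows "filterlim (\<lambda>n. ulog (1 / real (Suc n))) at_bot sequentially"
proof (cases "measure \<mu> {0} = 0")
  case False
  then have c: "0 < measure \<mu> {0}" by (simp add: zero_less_measure_iff)
  define C where "C = ln (K + 1) * measure \<mu> (space \<mu>)"
  have ind: "integrable \<mu> (indicator {0} :: real \<Rightarrow> real)"
    by (rule integrable_real_indicator) (auto simp: less_top[symmetric])
  have le: "ulog (1 / real (Suc n)) \<le> - ln (real (Suc n)) * measure \<mu> {0} + C" for n
  proof -
    have "ulog (1 / real (Suc n)) \<le> (\<integral>x. - ln (real (Suc n)) * indicator {0} x + ln (K + 1) \<partial>\<mu>)"
      unfolding ulog_def
    proof (rule integral_mono_AE)
      show "AE x in \<mu>. ln (x + 1 / real (Suc n)) \<le> - ln (real (Suc n)) * indicator {0} x + ln (K + 1)"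
        using AE_interval
      proof eventually_elim
        case (elim x)
        have "1 / real (Suc n) \<le> 1" by simp
        then have "ln (x + 1 / real (Suc n)) \<le> ln (K + 1)" if "x \<noteq> 0"
          using elim that by (intro ln_mono add_mono add_pos_pos) auto
        moreover have "ln (1 / real (Suc n)) = - ln (real (Suc n))" by (simp add: ln_div del: of_nat_Suc)
        moreover have "0 \<le> ln (K + 1)" using K by simp
        ultimately show ?case by (cases "x = 0") (auto simp del: of_nat_Suc)
      qed
      show "integrable \<mu> (\<lambda>x. - ln (real (Suc n)) * indicator {0} x + ln (K + 1))"
        by (intro Bochner_Integration.integrable_add integrable_mult_right integrable_const ind)
    qed (rule integrable_ln, simp)
    also have "\<dots> = - ln (real (Suc n)) * measure \<mu> {0} + C"
      by (subst Bochner_Integration.integral_add) (auto simp: C_def mult.commute ind simp del: of_nat_Suc)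
    finally show ?thesis .
  qed
  have "filterlim (\<lambda>n. - (ln (real (Suc n)) * measure \<mu> {0} + - C)) at_bot sequentially"
    using c by real_asymp
  then show ?thesis
    by (rule filterlim_at_bot_mono) (use le in \<open>auto simp del: of_nat_Suc\<close>)
next
  case True
  then have ncls: "\<not> (\<integral>\<^sup>+ x. ennreal (indicator {0<..<1} x * - ln x) \<partial>\<mu>) < \<infinity>" using not by simp
  have AEpos: "AE x in \<mu>. x \<noteq> 0"
    using True by (intro AE_I[of _ _ "{0}"]) (auto simp: emeasure_eq_measure)
  have dec: "ulog (1 / real (Suc n)) \<le> ulog (1 / real (Suc k))" if "k \<le> n" for k n
    using that by (intro ulog_mono) (auto simp: field_simps)
  show ?thesis
  proof (rule ccontr)
    assume "\<not> ?thesis"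
    then obtain Z where Z: "\<And>N. \<exists>n\<ge>N. Z < ulog (1 / real (Suc n))"
      unfolding filterlim_at_bot eventually_sequentially by (meson not_le)
    have lb: "Z \<le> ulog (1 / real (Suc n))" for n
      using Z[of n] dec by (meson less_imp_le order_trans)
    have "decseq (\<lambda>n. ulog (1 / real (Suc n)))" using dec by (simp add: decseq_def)
    then obtain L where L: "(\<lambda>n. ulog (1 / real (Suc n))) \<longlonglongrightarrow> L"
      using decseq_convergent lb by blast
    have "integrable \<mu> (\<lambda>x. - ln x)"
    proof (rule integrable_monotone_convergence[where f = "\<lambda>n x. - ln (x + 1 / real (Suc n))" and x = "- L"])
      show "AE x in \<mu>. mono (\<lambda>n. - ln (x + 1 / real (Suc n)))"
        using AE_interval
      proof eventually_elim
        case (elim x)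
        have "1 / real (Suc n) \<le> 1 / real (Suc k)" if "k \<le> n" for k n using that by (simp add: field_simps)
        then have "ln (x + 1 / real (Suc n)) \<le> ln (x + 1 / real (Suc k))" if "k \<le> n" for k n
          using elim that by (intro ln_mono add_left_mono add_nonneg_pos) auto
        then show ?case by (simp add: mono_def)
      qed
      show "AE x in \<mu>. (\<lambda>n. - ln (x + 1 / real (Suc n))) \<longlonglongrightarrow> - ln x"
        using AE_interval AEpos
      proof eventually_elim
        case (elim x)
        then have "0 < x" by simp
        have "(\<lambda>n. - ln (x + 1 / real (Suc n))) \<longlonglongrightarrow> - ln (x + 0)"
          by (intro tendsto_intros LIMSEQ_inverse_real_of_nat[unfolded inverse_eq_divide]) (use \<open>0 < x\<close> in auto)
        then show ?case by simp
      qed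
      show "(\<lambda>n. \<integral>x. - ln (x + 1 / real (Suc n)) \<partial>\<mu>) \<longlonglongrightarrow> - L"
        using tendsto_minus[OF L] by (simp add: ulog_def)
    qed (auto intro: integrable_ln)
    then have "integrable \<mu> (\<lambda>x. indicator {0<..<1} x * - ln x)"
      by (rule integrable_real_mult_indicator[rotated, where 'a = real, unfolded mult.commute[of _ "indicator _ _"]]) auto
    then have "(\<integral>\<^sup>+ x. ennreal (indicator {0<..<1} x * - ln x) \<partial>\<mu>) < \<infinity>"
      by (subst (asm) integrable_iff_bounded) (auto simp: indicator_def abs_mult cong: nn_integral_cong elim!: order.strict_trans1[rotated] intro!: nn_integral_mono)
    then show False using ncls by blast
  qed
qed

end

section \<open>Injectivity and the atom at zero\<close>

text \<open>The right side is the squared l2 norm of row i of R^n - R^m with R = 1 - A A^* / K,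
  expanded through \<open>pairing_kernel_approx_kernel_approx\<close>. It makes the approximants
  Cauchy once their traces converge.\<close>

lemma kernel_approx_diff_bound:
  assumes A: "msupp S A" and i: "i < p" and j: "j < p"
  shows "(cmod (kernel_approx p K A n i j g - kernel_approx p K A m i j g))\<^sup>2
    \<le> Re (kernel_approx p K A (n + n) i i 0) - 2 * Re (kernel_approx p K A (n + m) i i 0) + Re (kernel_approx p K A (m + m) i i 0)"
proof -
  define a b where "a = kernel_approx p K A n i" and "b = kernel_approx p K A m i"
  obtain T1 T2 where T: "msupp T1 (kernel_approx p K A n)" "msupp T2 (kernel_approx p K A m)"
    using msupp_kernel_approx[OF A] by metis
  define U where "U = insert g (T1 \<union> T2)"
  have U: "finite U" "\<And>j g. g \<notin> U \<Longrightarrow> a j g = 0" "\<And>j g. g \<notin> U \<Longrightarrow> b j g = 0"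
    using msuppD(1,2)[OF T(1)] msuppD(1,2)[OF T(2)] by (auto simp: U_def a_def b_def)
  have eq: "Re (pairing p x y) = (\<Sum>j<p. \<Sum>g\<in>U. Re (x j g * cnj (y j g)))"
    if "\<And>j g. g \<notin> U \<Longrightarrow> y j g = 0" for x y
    using pairing_eq[of U y p x] U(1) that by (simp add: Re_sum)
  have pt: "(cmod (u - v))\<^sup>2 = Re (u * cnj u) - 2 * Re (u * cnj v) + Re (v * cnj v)" for u v
    unfolding cmod_power2 by (simp add: power2_eq_square algebra_simps)
  have "(cmod (a j g - b j g))\<^sup>2 \<le> (\<Sum>g\<in>U. (cmod (a j g - b j g))\<^sup>2)"
    using U(1) by (intro member_le_sum[of g U "\<lambda>g. (cmod (a j g - b j g))\<^sup>2"]) (auto simp: U_def)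
  also have "\<dots> \<le> (\<Sum>j<p. \<Sum>g\<in>U. (cmod (a j g - b j g))\<^sup>2)"
    using j by (intro member_le_sum[of j "{..<p}" "\<lambda>j. \<Sum>g\<in>U. (cmod (a j g - b j g))\<^sup>2"]) (auto intro: sum_nonneg)
  also have "\<dots> = Re (pairing p a a) - 2 * Re (pairing p a b) + Re (pairing p b b)"
  proof -
    have "Re (pairing p a a) = (\<Sum>j<p. \<Sum>g\<in>U. Re (a j g * cnj (a j g)))"
      "Re (pairing p a b) = (\<Sum>j<p. \<Sum>g\<in>U. Re (a j g * cnj (b j g)))"
      "Re (pairing p b b) = (\<Sum>j<p. \<Sum>g\<in>U. Re (b j g * cnj (b j g)))"
      by (intro eq; use U in blast)+
    then show ?thesis unfolding pt by (simp only: sum.distrib sum_subtractf sum_distrib_left)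
  qed
  finally show ?thesis by (simp add: a_def b_def pairing_kernel_approx_kernel_approx[OF A i])
qed

lemma Re_pairing_self:
  assumes "finite T" "\<And>j g. g \<notin> T \<Longrightarrow> x j g = 0"
  shows "Re (pairing p x x) = (\<Sum>j<p. \<Sum>g\<in>T. (cmod (x j g))\<^sup>2)"
proof -
  have "pairing p x x = complex_of_real (\<Sum>j<p. \<Sum>g\<in>T. (cmod (x j g))\<^sup>2)"
    unfolding of_real_sum complex_norm_square by (rule pairing_eq) (use assms in auto)
  then show ?thesis by simp
qed

text \<open>F is independent of the support T: a singleton bounds one coefficient, the empty set
  gives nonnegativity, and arbitrary F give square summability of a limit row.\<close>

lemma pairing_self_bound:
  assumes "finite T" "\<And>j g. g \<notin> T \<Longrightarrow> x j g = 0" "j < p" "finite F"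
  shows "(\<Sum>g\<in>F. (cmod (x j g))\<^sup>2) \<le> Re (pairing p x x)"
proof -
  have "(\<Sum>g\<in>F. (cmod (x j g))\<^sup>2) \<le> (\<Sum>g\<in>T \<union> F. (cmod (x j g))\<^sup>2)"
    using assms by (intro sum_mono2) auto
  also have "\<dots> \<le> (\<Sum>j<p. \<Sum>g\<in>T \<union> F. (cmod (x j g))\<^sup>2)"
    using assms(3) by (intro member_le_sum[of j "{..<p}" "\<lambda>j. \<Sum>g\<in>T \<union> F. (cmod (x j g))\<^sup>2"]) (auto intro: sum_nonneg)
  also have "\<dots> = Re (pairing p x x)"
    using Re_pairing_self[of "T \<union> F" x p] assms by simp
  finally show ?thesis .
qed

context interval_measure
begin

lemma trN_kernel_approx_integral:
  fixes A :: "'g::group_add cgmat"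
  assumes A: "msupp S A" and mom: "\<And>k. trN p (mpow p (mmult p A (mstar A)) k) = complex_of_real (\<integral>x. x ^ k \<partial>\<mu>)"
  shows "(\<Sum>i<p. kernel_approx p K A n i i 0) = complex_of_real (\<integral>x. (1 - x / K) ^ n \<partial>\<mu>)"
  using trN_kernel_approx[OF A mom, of K n] integral_power_binomial[of K n] by (simp add: trN_def)

text \<open>A kernel row has a constant pairing with the rows of (1 - A A^* / K)^n, namely one of
  its coefficients. The squared norms of these rows are at most the trace of the 2n-th power, which
  tends to the mass of {0}, so Cauchy-Schwarz forces the coefficient to be 0.\<close>

lemma op_injective_if_no_atom:
  fixes A :: "'g::group_add cgmat"
  assumes A: "msupp S A" and K: "0 < K"
    and mom: "\<And>k. trN p (mpow p (mmult p A (mstar A)) k) = complex_of_real (\<integral>x. x ^ k \<partial>\<mu>)"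
    and z: "measure \<mu> {0} = 0"
  shows "op_injective p A"
  unfolding op_injective_def
proof (intro allI impI ext)
  fix x :: "nat \<Rightarrow> 'g \<Rightarrow> complex" and i g0
  assume x: "\<forall>i<p. x i \<in> l2" and ker: "\<forall>j<p. (\<lambda>g. \<Sum>i<p. conv (x i) (A i j) g) = (\<lambda>_. 0)" and i: "i < p"
  define t where "t n = (\<integral>x. (1 - x / K) ^ n \<partial>\<mu>)" for n
  have t: "t \<longlonglongrightarrow> 0" unfolding t_def using power_limit[OF K] z by simp
  \<comment> \<open>Left translation commutes with right multiplication by A, so the coefficient at
    g0 may be moved to the identity, where \<open>pairing_mone\<close> reads it off.\<close>
  define y where "y j h = x j (g0 + h)" for j h
  have ker': "vmul p y A j h = 0" if "j < p" for j h
  proof -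
    have "vmul p y A j h = (\<Sum>i<p. conv (x i) (A i j) (g0 + h))"
      by (simp add: vmul_def conv_def y_def add.assoc del: add_uminus_conv_diff)
    then show ?thesis using fun_cong[OF ker[rule_format, OF that], of "g0 + h"] by simp
  qed
  have const: "pairing p y (kernel_approx p K A n i) = y i 0" for n
  proof (induction n)
    case 0
    then show ?case by (simp add: pairing_mone[OF i])
  next
    case (Suc n)
    have "pairing p (vmul p y A) (vmul p (kernel_approx p K A n i) A) = 0"
      unfolding pairing_def using ker' by (intro sum.neutral ballI) auto
    then show ?case unfolding pairing_kernel_approx_Suc[OF A] using Suc by simp
  qed
  define B where "B = (\<Sum>j<p. infsum (\<lambda>g. (cmod (x j g))\<^sup>2) UNIV)"
  have yB: "(\<Sum>j<p. \<Sum>g\<in>U. (cmod (y j g))\<^sup>2) \<le> B" if U: "finite U" for U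
    unfolding B_def
  proof (rule sum_mono)
    fix j assume "j \<in> {..<p}"
    then have s: "(\<lambda>g. (cmod (x j g))\<^sup>2) summable_on UNIV" using x by (auto simp: l2_def)
    have "(\<Sum>g\<in>U. (cmod (y j g))\<^sup>2) = (\<Sum>g\<in>(+) g0 ` U. (cmod (x j g))\<^sup>2)"
      by (subst sum.reindex) (auto simp: y_def)
    also have "\<dots> \<le> infsum (\<lambda>g. (cmod (x j g))\<^sup>2) UNIV"
      using U s by (intro finite_sum_le_infsum) auto
    finally show "(\<Sum>g\<in>U. (cmod (y j g))\<^sup>2) \<le> infsum (\<lambda>g. (cmod (x j g))\<^sup>2) UNIV" .
  qed
  have B0: "0 \<le> B" using yB[of "{}"] by simp
  \<comment> \<open>The exponent n + n makes this diagonal entry a squared norm, so one entry is at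
    most the whole trace.\<close>
  have diag: "0 \<le> Re (kernel_approx p K A (n + n) k k 0)" if "k < p" for n k
  proof -
    obtain T where T: "msupp T (kernel_approx p K A n)" using msupp_kernel_approx[OF A] by blast
    have "(\<Sum>g\<in>{}. (cmod (kernel_approx p K A n k k g))\<^sup>2) \<le> Re (pairing p (kernel_approx p K A n k) (kernel_approx p K A n k))"
      by (rule pairing_self_bound[of T]) (use T that in \<open>auto simp: msupp_def supp_def subset_iff\<close>)
    then show ?thesis by (simp add: pairing_kernel_approx_kernel_approx[OF A that])
  qed
  have diag_le: "Re (kernel_approx p K A (n + n) i i 0) \<le> t (n + n)" for n
  proof -
    have "Re (kernel_approx p K A (n + n) i i 0) \<le> (\<Sum>k<p. Re (kernel_approx p K A (n + n) k k 0))"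
      using i diag by (intro member_le_sum[of i "{..<p}" "\<lambda>k. Re (kernel_approx p K A (n + n) k k 0)"]) auto
    also have "\<dots> = t (n + n)"
      using arg_cong[OF trN_kernel_approx_integral[OF A mom, of "n + n"], of Re] by (simp add: t_def Re_sum)
    finally show ?thesis .
  qed
  have bound: "(cmod (y i 0))\<^sup>2 \<le> B * t (n + n)" for n
  proof -
    define r where "r = kernel_approx p K A n i"
    obtain T where T: "msupp T (kernel_approx p K A n)" using msupp_kernel_approx[OF A] by blast
    have Tf: "finite T" "\<And>j g. g \<notin> T \<Longrightarrow> r j g = 0" using T by (auto simp: r_def msupp_def supp_def subset_iff)
    have rr: "(\<Sum>j<p. \<Sum>g\<in>T. (cmod (r j g))\<^sup>2) = Re (kernel_approx p K A (n + n) i i 0)"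
    proof -
      have "Re (pairing p r r) = (\<Sum>j<p. \<Sum>g\<in>T. (cmod (r j g))\<^sup>2)"
        by (rule Re_pairing_self[OF Tf])
      then show ?thesis by (simp add: r_def pairing_kernel_approx_kernel_approx[OF A i])
    qed
    have "y i 0 = (\<Sum>j<p. \<Sum>g\<in>T. y j g * cnj (r j g))"
      using const[of n] pairing_eq[of T r p y] Tf by (simp add: r_def)
    also have "\<dots> = (\<Sum>(j, g)\<in>{..<p} \<times> T. y j g * cnj (r j g))"
      by (simp add: sum.cartesian_product)
    finally have "cmod (y i 0) \<le> (\<Sum>(j, g)\<in>{..<p} \<times> T. \<bar>cmod (y j g)\<bar> * \<bar>cmod (r j g)\<bar>)"
      by (simp only:) (rule order.trans[OF norm_sum], auto simp: norm_mult case_prod_unfold)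
    also have "\<dots> \<le> L2_set (\<lambda>(j, g). cmod (y j g)) ({..<p} \<times> T) * L2_set (\<lambda>(j, g). cmod (r j g)) ({..<p} \<times> T)"
      using L2_set_mult_ineq[of "\<lambda>(j, g). cmod (y j g)" "\<lambda>(j, g). cmod (r j g)" "{..<p} \<times> T"]
      by (simp add: case_prod_unfold)
    finally have "(cmod (y i 0))\<^sup>2 \<le> (L2_set (\<lambda>(j, g). cmod (y j g)) ({..<p} \<times> T) * L2_set (\<lambda>(j, g). cmod (r j g)) ({..<p} \<times> T))\<^sup>2"
      by (rule power_mono) simp
    also have "\<dots> = (\<Sum>j<p. \<Sum>g\<in>T. (cmod (y j g))\<^sup>2) * (\<Sum>j<p. \<Sum>g\<in>T. (cmod (r j g))\<^sup>2)"
      unfolding power_mult_distrib L2_set_def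
      by (simp add: sum_nonneg case_prod_unfold sum.cartesian_product)
    also have "\<dots> \<le> B * t (n + n)"
      unfolding rr by (intro mult_mono yB Tf diag_le B0 diag i)
    finally show ?thesis .
  qed
  have "(\<lambda>n. B * t (n + n)) \<longlonglongrightarrow> B * 0"
    by (intro tendsto_mult_left filterlim_compose[OF t]) (rule filterlim_at_top_mono[OF filterlim_ident], simp)
  then have "(cmod (y i 0))\<^sup>2 \<le> 0"
    using bound by (intro LIMSEQ_le_const[of "\<lambda>n. B * t (n + n)"]) auto
  then show "x i g0 = 0" by (simp add: y_def)
qed

text \<open>With an atom, the rows of (1 - A A^* / K)^n converge entrywise to the rows of the kernel
  projection. Its trace is the nonzero mass of {0}, so some limit row is nonzero; that row lies in
  l2 and is annihilated by A, which contradicts injectivity.\<close>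

lemma no_atom_if_op_injective:
  fixes A :: "'g::group_add cgmat"
  assumes A: "msupp S A" and K: "0 < K"
    and mom: "\<And>k. trN p (mpow p (mmult p A (mstar A)) k) = complex_of_real (\<integral>x. x ^ k \<partial>\<mu>)"
    and inj: "op_injective p A"
  shows "measure \<mu> {0} = 0"
proof (rule ccontr)
  assume c: "measure \<mu> {0} \<noteq> 0"
  define t where "t n = (\<integral>x. (1 - x / K) ^ n \<partial>\<mu>)" for n
  have t: "t \<longlonglongrightarrow> measure \<mu> {0}" unfolding t_def by (rule power_limit[OF K])
  define q where "q n = kernel_approx p K A n" for n
  have tsum: "(\<Sum>i<p. q n i i 0) = complex_of_real (t n)" for n
    unfolding q_def t_def by (rule trN_kernel_approx_integral[OF A mom])
  have tsumR: "(\<Sum>i<p. Re (q n i i 0)) = t n" for n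
    using arg_cong[OF tsum[of n], of Re] by (simp add: Re_sum)
  have qT: "\<exists>T. msupp T (q n)" for n unfolding q_def by (rule msupp_kernel_approx[OF A])
  have sq: "Re (pairing p (q n i) (q n i)) = Re (q (n + n) i i 0)" if "i < p" for n i
    unfolding q_def by (simp add: pairing_kernel_approx_kernel_approx[OF A that])
  have row: "(\<Sum>g\<in>F. (cmod (q n i j g))\<^sup>2) \<le> t (n + n)" if ij: "i < p" "j < p" and F: "finite F" for n i j F
  proof -
    obtain T where T: "msupp T (q n)" using qT by blast
    have b: "(\<Sum>g\<in>F'. (cmod (q n k l g))\<^sup>2) \<le> Re (q (n + n) k k 0)" if "k < p" "l < p" "finite F'" for k l F'
      using pairing_self_bound[of T "q n k" l p F'] T that sq[OF that(1)] by (auto simp: msupp_def supp_def subset_iff)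
    have nn: "0 \<le> Re (q (n + n) k k 0)" if "k < p" for k using b[OF that that, of "{}"] by simp
    have "Re (q (n + n) i i 0) \<le> (\<Sum>k<p. Re (q (n + n) k k 0))"
      using ij nn by (intro member_le_sum[of i "{..<p}" "\<lambda>k. Re (q (n + n) k k 0)"]) auto
    then show ?thesis using b[OF ij F] tsumR[of "n + n"] by simp
  qed
  have diff: "(cmod (q n i j g - q m i j g))\<^sup>2 \<le> t (n + n) - 2 * t (n + m) + t (m + m)"
    if "i < p" "j < p" for n m i j g
  proof -
    define D where "D k = Re (q (n + n) k k 0) - 2 * Re (q (n + m) k k 0) + Re (q (m + m) k k 0)" for k
    have D: "(cmod (q n k l h - q m k l h))\<^sup>2 \<le> D k" if "k < p" "l < p" for k l h
      unfolding D_def q_def by (rule kernel_approx_diff_bound[OF A that])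
    have nn: "0 \<le> D k" if "k < p" for k using D[OF that that, of 0] by (meson order_trans zero_le_power2)
    have "D i \<le> (\<Sum>k<p. D k)"
      using that nn by (intro member_le_sum[of i "{..<p}" D]) auto
    also have "\<dots> = t (n + n) - 2 * t (n + m) + t (m + m)"
      unfolding D_def tsumR[symmetric] by (simp add: sum.distrib sum_subtractf sum_distrib_left)
    finally show ?thesis using D[OF that, of g] by linarith
  qed
  have cau: "Cauchy (\<lambda>n. q n i j g)" if ij: "i < p" "j < p" for i j g
  proof (rule metric_CauchyI)
    fix e :: real assume e: "0 < e"
    \<comment> \<open>The bound in \<open>diff\<close> has coefficients 1, -2 and 1, so four errors
      of e^2 / 4 are spent.\<close>
    obtain M where M: "\<And>n. n \<ge> M \<Longrightarrow> dist (t n) (measure \<mu> {0}) < e\<^sup>2 / 4"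
      using metric_LIMSEQ_D[OF t, of "e\<^sup>2 / 4"] e by auto
    have "dist (q n i j g) (q m i j g) < e" if "n \<ge> M" "m \<ge> M" for n m
    proof -
      have "t (n + n) - 2 * t (n + m) + t (m + m) < e\<^sup>2"
        using M[of "n + n"] M[of "n + m"] M[of "m + m"] that unfolding dist_real_def by linarith
      then have "(cmod (q n i j g - q m i j g))\<^sup>2 < e\<^sup>2" using diff[OF ij, of n g m] by linarith
      then show ?thesis using e by (simp add: dist_norm power_less_imp_less_base)
    qed
    then show "\<exists>M. \<forall>m\<ge>M. \<forall>n\<ge>M. dist (q m i j g) (q n i j g) < e" by blast
  qed
  define x where "x i j g = lim (\<lambda>n. q n i j g)" for i j g
  have lim: "(\<lambda>n. q n i j g) \<longlonglongrightarrow> x i j g" if "i < p" "j < p" for i j g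
    unfolding x_def using cau[OF that] by (simp add: Cauchy_convergent_iff convergent_LIMSEQ_iff)
  have "(\<lambda>n. \<Sum>i<p. q n i i 0) \<longlonglongrightarrow> (\<Sum>i<p. x i i 0)"
    by (intro tendsto_sum lim) auto
  moreover have "(\<lambda>n. \<Sum>i<p. q n i i 0) \<longlonglongrightarrow> complex_of_real (measure \<mu> {0})"
    unfolding tsum by (intro tendsto_of_real t)
  ultimately have "(\<Sum>i<p. x i i 0) = complex_of_real (measure \<mu> {0})" by (rule LIMSEQ_unique)
  then obtain i where i: "i < p" "x i i 0 \<noteq> 0" using c by (metis (no_types, lifting) lessThan_iff of_real_eq_0_iff sum.neutral)
  have tt: "(\<lambda>n. t (n + n)) \<longlonglongrightarrow> measure \<mu> {0}"
    by (rule filterlim_compose[OF t]) (rule filterlim_at_top_mono[OF filterlim_ident], simp)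
  have "x i j \<in> l2" if j: "j < p" for j
  proof -
    have "(\<Sum>g\<in>F. (cmod (x i j g))\<^sup>2) \<le> measure \<mu> {0}" if F: "finite F" for F
    proof (rule LIMSEQ_le[OF _ tt])
      show "(\<lambda>n. \<Sum>g\<in>F. (cmod (q n i j g))\<^sup>2) \<longlonglongrightarrow> (\<Sum>g\<in>F. (cmod (x i j g))\<^sup>2)"
        by (intro tendsto_intros lim i j)
    qed (use row[OF i(1) j F] in auto)
    then have "(\<lambda>g. (cmod (x i j g))\<^sup>2) summable_on UNIV"
      by (intro nonneg_bdd_above_summable_on) (auto intro!: bdd_aboveI2)
    then show ?thesis by (simp add: l2_def)
  qed
  moreover have "(\<lambda>g. \<Sum>l<p. conv (x i l) (A l j) g) = (\<lambda>_. 0)" if j: "j < p" for j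
  proof
    fix g
    have "(\<lambda>n. vmul p (q n i) A j g) \<longlonglongrightarrow> vmul p (x i) A j g"
      unfolding vmul_eq[OF A] by (intro tendsto_intros lim i) auto
    moreover have "(\<lambda>n. vmul p (q n i) A j g) \<longlonglongrightarrow> 0"
    proof -
      \<comment> \<open>The recursion step gives the squared norm of row i of R^n A as K times the
        difference of the diagonal entries of R^(2 n) and R^(2 n + 1). Both traces have the same
        limit, so the product with A vanishes in the limit.\<close>
      have le: "(cmod (vmul p (q n i) A j g))\<^sup>2 \<le> K * (t (n + n) - t (n + Suc n))" for n
      proof -
        obtain T where T: "msupp T (q n)" using qT by blast
        have fin: "finite (addset T S)" using T A by (auto simp: msupp_def)
        have s0: "vmul p (q n k) A l h = 0" if "h \<notin> addset T S" for k l h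
          using vmul_supp[OF A, of T "q n k" h p l] T that by (auto simp: msuppD)
        have b: "(\<Sum>h\<in>F. (cmod (vmul p (q n k) A l h))\<^sup>2) \<le> K * (Re (q (n + n) k k 0) - Re (q (n + Suc n) k k 0))"
          if "k < p" "l < p" "finite F" for k l F
        proof -
          have "(\<Sum>h\<in>F. (cmod (vmul p (q n k) A l h))\<^sup>2) \<le> Re (pairing p (vmul p (q n k) A) (vmul p (q n k) A))"
            by (rule pairing_self_bound[OF fin s0 that(2,3)])
          also have "pairing p (vmul p (q n k) A) (vmul p (q n k) A)
              = complex_of_real K * (q (n + n) k k 0 - q (n + Suc n) k k 0)"
            using pairing_kernel_approx_Suc[OF A, of p "q n k" K n k] K
            unfolding q_def pairing_kernel_approx_kernel_approx[OF A that(1)] by (simp add: field_simps)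
          finally show ?thesis by simp
        qed
        have nn: "0 \<le> Re (q (n + n) k k 0) - Re (q (n + Suc n) k k 0)" if "k < p" for k
          using b[OF that that, of "{}"] K by (simp add: zero_le_mult_iff)
        have "(cmod (vmul p (q n i) A j g))\<^sup>2 \<le> K * (Re (q (n + n) i i 0) - Re (q (n + Suc n) i i 0))"
          using b[OF i(1) j, of "{g}"] by simp
        also have "\<dots> \<le> K * (\<Sum>k<p. Re (q (n + n) k k 0) - Re (q (n + Suc n) k k 0))"
          using i nn K by (intro mult_left_mono member_le_sum[of i "{..<p}" "\<lambda>k. Re (q (n + n) k k 0) - Re (q (n + Suc n) k k 0)"]) auto
        also have "\<dots> = K * (t (n + n) - t (n + Suc n))"
          unfolding sum_subtractf tsumR ..
        finally show ?thesis .
      qed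
      have "(\<lambda>n. t (n + Suc n)) \<longlonglongrightarrow> measure \<mu> {0}"
        by (rule filterlim_compose[OF t], rule filterlim_at_top_mono[OF filterlim_ident]) auto
      then have "(\<lambda>n. K * (t (n + n) - t (n + Suc n))) \<longlonglongrightarrow> K * (measure \<mu> {0} - measure \<mu> {0})"
        by (intro tendsto_intros tt)
      then have "(\<lambda>n. (cmod (vmul p (q n i) A j g))\<^sup>2) \<longlonglongrightarrow> 0"
        by (intro tendsto_sandwich[OF _ _ tendsto_const, of 0 "\<lambda>n. (cmod (vmul p (q n i) A j g))\<^sup>2" sequentially "\<lambda>n. K * (t (n + n) - t (n + Suc n))"])
           (use le in auto)
      from tendsto_real_sqrt[OF this] show ?thesis by (simp add: tendsto_norm_zero_iff)
    qed
    ultimately have "vmul p (x i) A j g = 0" by (rule LIMSEQ_unique)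
    then show "(\<Sum>l<p. conv (x i l) (A l j) g) = 0" by (simp add: vmul_def)
  qed
  ultimately have "x i i = (\<lambda>_. 0)" using inj i(1) unfolding op_injective_def by blast
  then show False using i(2) by simp
qed

end

section \<open>The spectral measure\<close>

definition gram :: "nat \<Rightarrow> 'g::group_add cgmat \<Rightarrow> 'g cgmat" where
  "gram p A = mmult p (mstar A) A"

definition gram_supp :: "'g::group_add set \<Rightarrow> 'g set" where
  "gram_supp S = addset (uminus ` S) S"

text \<open>A bound for the row sums of A^* A in every finite quotient, hence for all eigenvalues
  occurring there and for the support of the spectral measure. It is continuous in the coefficients
  of A.\<close>

definition gram_norm :: "nat \<Rightarrow> 'g::group_add set \<Rightarrow> 'g cgmat \<Rightarrow> real" where
  "gram_norm p S A = (\<Sum>i<p. \<Sum>j<p. \<Sum>g\<in>gram_supp S. cmod (gram p A i j g))"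

lemma msupp_gram: "msupp S A \<Longrightarrow> msupp (gram_supp S) (gram p A)"
  unfolding gram_def gram_supp_def by (intro msupp_mmult msupp_mstar)

lemma gram_norm_nonneg: "0 \<le> gram_norm p S A"
  unfolding gram_norm_def by (intro sum_nonneg) auto

context finite_quotient
begin

lemma qmat_gram: "msupp S A \<Longrightarrow> qmat (gram p A) = hadj (qmat A) * qmat A"
  unfolding gram_def by (simp add: qmat_mult[OF msupp_mstar] qmat_mstar)

lemma gram_eigenvalues:
  assumes A: "msupp S A"
  shows "\<exists>f :: nat \<Rightarrow> real. (\<forall>i<n. 0 \<le> f i \<and> f i \<le> gram_norm p S A)
    \<and> (\<forall>k. word_set (gram_supp S) k \<inter> N \<subseteq> {0} \<longrightarrow>
      complex_of_real (\<Sum>i<n. f i ^ k) = of_nat (card R) * trN p (mpow p (gram p A) k))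
    \<and> (\<forall>c. det (hadj (qmat A) * qmat A + complex_of_real c \<cdot>\<^sub>m 1\<^sub>m n) = complex_of_real (\<Prod>i<n. f i + c))"
proof -
  note G = msupp_gram[OF A, of p]
  have row: "(\<Sum>j<n. cmod ((hadj (qmat A) * qmat A) $$ (i, j))) \<le> gram_norm p S A" if "i < n" for i
    using qmat_row_sum[OF G that] unfolding qmat_gram[OF A] gram_norm_def .
  show ?thesis
  proof (rule gram_spectrum[OF qmat_carrier[of A] row], assumption, intro exI conjI allI impI)
    fix f :: "nat \<Rightarrow> real" and k
    assume tr: "\<And>k. (\<Sum>i<n. ((hadj (qmat A) * qmat A) ^\<^sub>m k) $$ (i,i)) = complex_of_real (\<Sum>i<n. f i ^ k)"
      and av: "word_set (gram_supp S) k \<inter> N \<subseteq> {0}"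
    show "complex_of_real (\<Sum>i<n. f i ^ k) = of_nat (card R) * trN p (mpow p (gram p A) k)"
      using qmat_trace[OF msupp_mpow[OF G, of k p] av] tr[of k] by (simp add: qmat_mpow[OF G] qmat_gram[OF A])
  qed auto
qed

lemma card_R_pos: "0 < card R"
  using finR neR by (simp add: card_gt_0_iff)

end

text \<open>Avoiding the supports of the powers up to d makes \<open>qmat_trace\<close> exact for
  all moments up to degree d.\<close>

lemma finite_quotient_word_set:
  fixes S :: "'g::group_add set"
  assumes "residually_finite_grp TYPE('g)" "finite S"
  obtains N R :: "'g set" and n e where "finite_quotient N R p n e" "\<And>k. k \<le> d \<Longrightarrow> word_set S k \<inter> N \<subseteq> {0}"
proof -
  have fin: "finite (\<Union>k\<le>d. word_set S k)" using assms(2) by simp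
  show thesis
    by (rule finite_quotient_exists[OF assms(1) fin, of p]) (rule that, auto)
qed

text \<open>Averages over the n = p * \<open>card R\<close> eigenvalues have mass 1, whereas the
  trace of the identity is p; hence the scaling by p. That the moments are real also comes from the
  quotients, where they are sums of real powers.\<close>

lemma spectral_measure_exists:
  fixes A :: "'g::group_add cgmat"
  assumes rf: "residually_finite_grp TYPE('g)" and A: "msupp S A" and p: "0 < p"
  shows "\<exists>\<mu>. interval_measure \<mu> (gram_norm p S A)
    \<and> (\<forall>k. complex_of_real (\<integral>x. x ^ k \<partial>\<mu>) = trN p (mpow p (gram p A) k))"
proof -
  have fin: "finite (gram_supp S)" using msupp_gram[OF A] by (auto simp: msupp_def)
  define m where "m k = Re (trN p (mpow p (gram p A) k))" for k
  have key: "\<exists>n f. 0 < n \<and> (\<forall>i<n. 0 \<le> f i \<and> f i \<le> gram_norm p S A)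
      \<and> (\<forall>k\<le>d. complex_of_real (real p * ((\<Sum>i<n. f i ^ k) / real n)) = trN p (mpow p (gram p A) k))" for d
  proof -
    obtain N R :: "'g set" and n e where fq: "finite_quotient N R p n e"
      and av: "\<And>k. k \<le> d \<Longrightarrow> word_set (gram_supp S) k \<inter> N \<subseteq> {0}"
      using finite_quotient_word_set[OF rf fin] by blast
    interpret finite_quotient N R p n e by (rule fq)
    obtain f where f: "\<And>i. i < n \<Longrightarrow> 0 \<le> f i \<and> f i \<le> gram_norm p S A"
      and tr: "\<And>k. word_set (gram_supp S) k \<inter> N \<subseteq> {0} \<Longrightarrow>
        complex_of_real (\<Sum>i<n. f i ^ k) = of_nat (card R) * trN p (mpow p (gram p A) k)"
      using gram_eigenvalues[OF A] by blast
    have n: "0 < n" "real n = real p * real (card R)" using n_eq card_R_pos p by auto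
    have "complex_of_real (real p * ((\<Sum>i<n. f i ^ k) / real n)) = trN p (mpow p (gram p A) k)" if "k \<le> d" for k
    proof -
      have "complex_of_real (real p * ((\<Sum>i<n. f i ^ k) / real n)) = complex_of_real (\<Sum>i<n. f i ^ k) / of_nat (card R)"
        unfolding n(2) using p by (simp del: of_real_sum)
      then show ?thesis unfolding tr[OF av[OF that]] using card_R_pos by simp
    qed
    then show ?thesis using n f by blast
  qed
  have real: "trN p (mpow p (gram p A) k) = complex_of_real (m k)" for k
    using key[of k] unfolding m_def by (metis Re_complex_of_real order_refl)
  have "\<exists>\<mu>. interval_measure \<mu> (gram_norm p S A) \<and> (\<forall>k. (\<integral>x. x ^ k \<partial>\<mu>) = m k)"
  proof (rule interval_measure_exists[where c = "real p"])
    show "\<exists>n f. 0 < n \<and> (\<forall>i<n. 0 \<le> f i \<and> f i \<le> gram_norm p S A)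
        \<and> (\<forall>k\<le>d. real p * ((\<Sum>i<n. f i ^ k) / real n) = m k)" for d
      using key[of d] unfolding real of_real_eq_iff .
  qed (auto simp: gram_norm_nonneg)
  then show ?thesis unfolding real of_real_eq_iff .
qed

lemma interval_measure_mono:
  assumes "interval_measure \<mu> K" "K \<le> L"
  shows "interval_measure \<mu> L"
proof -
  interpret interval_measure \<mu> K by fact
  show ?thesis
  proof
    show "AE x in \<mu>. 0 \<le> x \<and> x \<le> L"
      using AE_interval by eventually_elim (use assms(2) in auto)
  qed simp
qed

lemma interval_measureI:
  assumes "sets \<mu> = sets borel" "finite_measure \<mu>" "emeasure \<mu> (- {0..K}) = 0"
  shows "interval_measure \<mu> K"
proof (intro interval_measure.intro interval_measure_axioms.intro assms)
  show "AE x in \<mu>. 0 \<le> x \<and> x \<le> K"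
    by (rule AE_I[of _ _ "- {0..K}"]) (use assms in auto)
qed

lemma interval_measureD:
  assumes "interval_measure \<mu> K"
  shows "sets \<mu> = sets borel" "finite_measure \<mu>" "emeasure \<mu> (- {0..K}) = 0"
proof -
  interpret interval_measure \<mu> K by fact
  show "sets \<mu> = sets borel" "finite_measure \<mu>" by (simp_all add: finite_measure_axioms)
  have "AE x in \<mu>. x \<notin> - {0..K}" using AE_interval by eventually_elim auto
  then show "emeasure \<mu> (- {0..K}) = 0"
    by (subst (asm) AE_iff_measurable[of "- {0..K}"]) (auto simp: sets_eq_imp_space_eq[OF sets_eq])
qed

text \<open>Resolves the definite description in \<open>spec_measure\<close>. A competing measure
  comes with its own bound, so both are regarded on the larger of the two intervals before
  uniqueness is applied.\<close>

lemma spec_measure: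
  fixes A :: "'g::group_add cgmat"
  assumes rf: "residually_finite_grp TYPE('g)" and A: "msupp S A" and p: "0 < p"
  shows "interval_measure (spec_measure p A) (gram_norm p S A)"
    and "\<And>k. trN p (mpow p (gram p A) k) = complex_of_real (\<integral>x. x ^ k \<partial>spec_measure p A)"
proof -
  obtain \<mu> where \<mu>: "interval_measure \<mu> (gram_norm p S A)"
    and mom: "\<And>k. complex_of_real (\<integral>x. x ^ k \<partial>\<mu>) = trN p (mpow p (gram p A) k)"
    using spectral_measure_exists[OF assms] by blast
  have "spec_measure p A = \<mu>"
    unfolding spec_measure_def gram_def[symmetric]
  proof (rule the_equality)
    show "sets \<mu> = sets borel \<and> finite_measure \<mu> \<and> (\<exists>K. emeasure \<mu> (- {0..K}) = 0)
      \<and> (\<forall>n. complex_of_real (\<integral>x. x ^ n \<partial>\<mu>) = trN p (mpow p (gram p A) n))"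
      using interval_measureD[OF \<mu>] mom by blast
  next
    fix \<nu> :: "real measure"
    assume "sets \<nu> = sets borel \<and> finite_measure \<nu> \<and> (\<exists>K. emeasure \<nu> (- {0..K}) = 0)
      \<and> (\<forall>n. complex_of_real (\<integral>x. x ^ n \<partial>\<nu>) = trN p (mpow p (gram p A) n))"
    then obtain K where \<nu>: "interval_measure \<nu> K"
      and mom': "\<And>k. complex_of_real (\<integral>x. x ^ k \<partial>\<nu>) = trN p (mpow p (gram p A) k)"
      using interval_measureI by metis
    have "(\<integral>x. x ^ k \<partial>\<nu>) = (\<integral>x. x ^ k \<partial>\<mu>)" for k
      using mom[of k] mom'[of k] by (metis of_real_eq_iff)
    then show "\<nu> = \<mu>"
      by (intro interval_measure_unique[OF interval_measure_mono[OF \<nu>] interval_measure_mono[OF \<mu>],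
            of "max K (gram_norm p S A)"]) auto
  qed
  then show "interval_measure (spec_measure p A) (gram_norm p S A)"
    "\<And>k. trN p (mpow p (gram p A) k) = complex_of_real (\<integral>x. x ^ k \<partial>spec_measure p A)"
    using \<mu> mom by auto
qed

lemma trace_pow_mult_commute:
  fixes X Y :: "complex mat"
  assumes X: "X \<in> carrier_mat n n" and Y: "Y \<in> carrier_mat n n"
  shows "(\<Sum>i<n. ((X * Y) ^\<^sub>m k) $$ (i,i)) = (\<Sum>i<n. ((Y * X) ^\<^sub>m k) $$ (i,i))"
proof (cases k)
  case 0
  then show ?thesis using X Y by simp
next
  case (Suc l)
  have c [simp]: "(Y * X) ^\<^sub>m l \<in> carrier_mat n n" "(X * Y) ^\<^sub>m l \<in> carrier_mat n n" "Y * X \<in> carrier_mat n n"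
      "X * Y \<in> carrier_mat n n" for l
    using X Y by (auto intro!: pow_carrier_mat mult_carrier_mat[of _ n n])
  have "(X * Y) ^\<^sub>m Suc l = X * ((Y * X) ^\<^sub>m l * Y)" for l
  proof (induction l)
    case 0
    then show ?case using X Y by (simp add: left_mult_one_mat[of _ n n] left_mult_one_mat[of _ n])
  next
    case (Suc l)
    have "(X * Y) ^\<^sub>m Suc (Suc l) = X * ((Y * X) ^\<^sub>m l * Y) * (X * Y)" using Suc by simp
    also have "\<dots> = X * ((Y * X) ^\<^sub>m l * Y * (X * Y))"
      using X Y by (intro assoc_mult_mat[of _ n n _ n _ n] mult_carrier_mat[of _ n n]) auto
    also have "(Y * X) ^\<^sub>m l * Y * (X * Y) = (Y * X) ^\<^sub>m l * (Y * X * Y)"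
      using X Y by (simp add: assoc_mult_mat[of _ n n _ n _ n])
    also have "\<dots> = (Y * X) ^\<^sub>m Suc l * Y"
      using X Y by (simp add: assoc_mult_mat[of _ n n _ n _ n])
    finally show ?case .
  qed
  then have "(\<Sum>i<n. ((X * Y) ^\<^sub>m k) $$ (i,i)) = (\<Sum>i<n. (X * ((Y * X) ^\<^sub>m l * Y)) $$ (i,i))"
    using Suc by simp
  also have "\<dots> = (\<Sum>i<n. ((Y * X) ^\<^sub>m l * Y * X) $$ (i,i))"
    by (rule trace_mult_commute) (use X Y in \<open>auto intro!: mult_carrier_mat[of _ n n]\<close>)
  also have "(Y * X) ^\<^sub>m l * Y * X = (Y * X) ^\<^sub>m k"
    using X Y Suc by (simp add: assoc_mult_mat[of _ n n _ n _ n])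
  finally show ?thesis .
qed

text \<open>The determinant is defined from A^* A, but the kernel of right multiplication on rows is
  that of A A^*. Their moments agree because traces of finite matrices are cyclic; the quotient is
  chosen to avoid the supports of the powers of both.\<close>

lemma trN_mpow_mult_mstar:
  fixes A :: "'g::group_add cgmat"
  assumes rf: "residually_finite_grp TYPE('g)" and A: "msupp S A"
  shows "trN p (mpow p (mmult p A (mstar A)) k) = trN p (mpow p (gram p A) k)"
proof -
  define T where "T = addset S (uminus ` S) \<union> gram_supp S"
  have sub: "finite T" "gram_supp S \<subseteq> T" "addset S (uminus ` S) \<subseteq> T"
    using A by (auto simp: T_def gram_supp_def msupp_def)
  have G: "msupp T (gram p A)" and H: "msupp T (mmult p A (mstar A))"
    using msupp_gram[OF A, of p] msupp_mmult[OF A msupp_mstar[OF A], of p] sub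
    unfolding msupp_def by blast+
  have fin: "finite T" using G by (simp add: msupp_def)
  obtain N R :: "'g set" and n e where fq: "finite_quotient N R p n e"
    and av: "\<And>l. l \<le> k \<Longrightarrow> word_set T l \<inter> N \<subseteq> {0}"
    using finite_quotient_word_set[OF rf fin] by blast
  interpret finite_quotient N R p n e by (rule fq)
  have "of_nat (card R) * trN p (mpow p (mmult p A (mstar A)) k)
     = (\<Sum>i<n. ((qmat A * hadj (qmat A)) ^\<^sub>m k) $$ (i,i))"
    using qmat_trace[OF msupp_mpow[OF H, of k p] av] 
    by (simp add: qmat_mpow[OF H] qmat_mult[OF A msupp_mstar[OF A]] qmat_mstar[OF A])
  also have "\<dots> = (\<Sum>i<n. ((hadj (qmat A) * qmat A) ^\<^sub>m k) $$ (i,i))"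
    by (rule trace_pow_mult_commute) simp_all
  also have "\<dots> = of_nat (card R) * trN p (mpow p (gram p A) k)"
    using qmat_trace[OF msupp_mpow[OF G, of k p] av] by (simp add: qmat_mpow[OF G] qmat_gram[OF A])
  finally show ?thesis using card_R_pos by simp
qed

definition logint :: "nat \<Rightarrow> 'g::group_add cgmat \<Rightarrow> real \<Rightarrow> real" where
  "logint p A \<epsilon> = (\<integral>x. ln (x + \<epsilon>) \<partial>spec_measure p A)"

lemma logint_mono:
  fixes A :: "'g::group_add cgmat"
  assumes "residually_finite_grp TYPE('g)" "msupp S A" "0 < p" "0 < \<delta>" "\<delta> \<le> \<epsilon>"
  shows "logint p A \<delta> \<le> logint p A \<epsilon>"
  using interval_measure.ulog_mono[OF spec_measure(1)[OF assms(1-3)] assms(4,5)]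
  unfolding logint_def interval_measure.ulog_def[OF spec_measure(1)[OF assms(1-3)]] .

text \<open>The case distinction of \<open>detr\<close> becomes a single limit: injectivity is the
  absence of an atom at 0, and exactly when it or determinant class fails the logarithms tend to
  minus infinity, giving the value 0.\<close>

lemma detr_limit:
  fixes A :: "'g::group_add cgmat"
  assumes rf: "residually_finite_grp TYPE('g)" and A: "msupp S A" and p: "0 < p"
  shows "(\<lambda>n. exp (1 / 2 * logint p A (1 / real (Suc n)))) \<longlonglongrightarrow> detr p A"
proof -
  \<comment> \<open>The summand 1 makes K positive, as division by K in 1 - x / K requires, even for
    the zero matrix.\<close>
  define K where "K = gram_norm p S A + 1"
  have K: "0 < K" using gram_norm_nonneg[of p S A] by (simp add: K_def)
  interpret interval_measure "spec_measure p A" K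
    by (rule interval_measure_mono[OF spec_measure(1)[OF assms]]) (simp add: K_def)
  have mom: "\<And>k. trN p (mpow p (mmult p A (mstar A)) k) = complex_of_real (\<integral>x. x ^ k \<partial>spec_measure p A)"
    unfolding trN_mpow_mult_mstar[OF rf A] by (rule spec_measure(2)[OF assms])
  have inj: "op_injective p A \<longleftrightarrow> measure (spec_measure p A) {0} = 0"
    using op_injective_if_no_atom[OF A K mom] no_atom_if_op_injective[OF A K mom] by blast
  have u: "ulog = logint p A" by (rule ext) (simp add: ulog_def logint_def)
  show ?thesis
  proof (cases "op_injective p A \<and> det_class p A")
    case True
    then show ?thesis
      using tendsto_exp[OF tendsto_mult_left[OF ulog_tendsto_integral, of "1/2"]] inj
      unfolding detr_def det_class_def detFK_def u by simp
  next
    case False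
    then have "filterlim (\<lambda>n. ulog (1 / real (Suc n))) at_bot sequentially"
      using K inj by (intro ulog_at_bot) (auto simp: det_class_def)
    then have "filterlim (\<lambda>n. 1 / 2 * ulog (1 / real (Suc n))) at_bot sequentially"
      by (intro filterlim_tendsto_pos_mult_at_bot[OF tendsto_const]) auto
    from filterlim_compose[OF exp_at_bot this] show ?thesis
      using False unfolding detr_def u by auto
  qed
qed

lemma detr_le_exp_logint:
  fixes A :: "'g::group_add cgmat"
  assumes rf: "residually_finite_grp TYPE('g)" and A: "msupp S A" and p: "0 < p" and e: "0 < \<epsilon>"
  shows "detr p A \<le> exp (1 / 2 * logint p A \<epsilon>)"
proof (rule LIMSEQ_le_const2[OF detr_limit[OF rf A p]])
  obtain M :: nat where M: "1 / real (Suc M) < \<epsilon>" using e nat_approx_posE by blast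
  have "exp (1 / 2 * logint p A (1 / real (Suc n))) \<le> exp (1 / 2 * logint p A \<epsilon>)" if "M \<le> n" for n
  proof -
    have "1 / real (Suc n) \<le> 1 / real (Suc M)" using that by (simp add: field_simps)
    then have "logint p A (1 / real (Suc n)) \<le> logint p A \<epsilon>"
      using M by (intro logint_mono[OF rf A p]) (auto simp del: of_nat_Suc)
    then show ?thesis by simp
  qed
  then show "\<exists>M. \<forall>n\<ge>M. exp (1 / 2 * logint p A (1 / real (Suc n))) \<le> exp (1 / 2 * logint p A \<epsilon>)" by blast
qed

lemma detr_nonneg: "0 \<le> detr p A"
  by (simp add: detr_def detFK_def)

section \<open>Convexity of the regularised determinant\<close>

lemma trN_mone: "trN p mone = of_nat p"
  by (simp add: trN_def mone_def)

text \<open>One polynomial approximates ln (x + \<epsilon>) on [0, K] and is integrated against both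
  the spectral measure and the eigenvalues of a quotient; both then compare with the same moments.
  The pair a, D depends on A and on the quotient only through K. Since both measures have mass p,
  the uniform error is \<delta> / p.\<close>

lemma logint_approx:
  fixes TY :: "'g::group_add itself"
  assumes rf: "residually_finite_grp TYPE('g)" and p: "0 < p" and K: "0 \<le> K" and e: "0 < \<epsilon>" and d: "0 < \<delta>"
  shows "\<exists>a D. (\<forall>S (A :: 'g cgmat). msupp S A \<longrightarrow> gram_norm p S A \<le> K \<longrightarrow>
      \<bar>logint p A \<epsilon> - (\<Sum>k\<le>D. a k * Re (trN p (mpow p (gram p A) k)))\<bar> \<le> \<delta>)
    \<and> (\<forall>S (A :: 'g cgmat) N R n e. msupp S A \<longrightarrow> gram_norm p S A \<le> K \<longrightarrow> finite_quotient N R p n e \<longrightarrow>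
      (\<forall>k\<le>D. word_set (gram_supp S) k \<inter> N \<subseteq> {0}) \<longrightarrow>
      \<bar>ln (Re (det (hadj (finite_quotient.qmat N n e A) * finite_quotient.qmat N n e A + complex_of_real \<epsilon> \<cdot>\<^sub>m 1\<^sub>m n))) / card R
         - (\<Sum>k\<le>D. a k * Re (trN p (mpow p (gram p A) k)))\<bar> \<le> \<delta>)"
proof -
  have "continuous_on {0..K} (\<lambda>x. ln (x + \<epsilon>))"
    by (intro continuous_intros) (use e in auto)
  then obtain a D where a: "\<And>x. 0 \<le> x \<Longrightarrow> x \<le> K \<Longrightarrow> \<bar>ln (x + \<epsilon>) - (\<Sum>k\<le>D. a k * x ^ k)\<bar> \<le> \<delta> / p"
    using poly_approx_interval[of K "\<lambda>x. ln (x + \<epsilon>)" "\<delta> / p"] d p by auto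
  show ?thesis
  proof (intro exI[of _ a] exI[of _ D] conjI allI impI)
    fix S and A :: "'g cgmat"
    assume A: "msupp S A" and le: "gram_norm p S A \<le> K"
    interpret interval_measure "spec_measure p A" K
      by (rule interval_measure_mono[OF spec_measure(1)[OF rf A p] le])
    note mom = spec_measure(2)[OF rf A p]
    have "\<bar>logint p A \<epsilon> - (\<Sum>k\<le>D. a k * (\<integral>x. x ^ k \<partial>spec_measure p A))\<bar> \<le> \<delta> / p * (\<integral>x. x ^ 0 \<partial>spec_measure p A)"
      unfolding logint_def by (rule integral_approx[OF _ a]) auto
    also have "(\<integral>x. x ^ 0 \<partial>spec_measure p A) = p"
      using arg_cong[OF mom[of 0], of Re] by (simp add: trN_mone)
    also have "\<delta> / p * p = \<delta>" using p by simp
    also have "(\<Sum>k\<le>D. a k * (\<integral>x. x ^ k \<partial>spec_measure p A)) = (\<Sum>k\<le>D. a k * Re (trN p (mpow p (gram p A) k)))"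
      unfolding mom by simp
    finally show "\<bar>logint p A \<epsilon> - (\<Sum>k\<le>D. a k * Re (trN p (mpow p (gram p A) k)))\<bar> \<le> \<delta>" .
  next
    fix S N R n e and A :: "'g cgmat"
    assume A: "msupp S A" and le: "gram_norm p S A \<le> K" and fq: "finite_quotient N R p n e"
      and av': "\<forall>k\<le>D. word_set (gram_supp S) k \<inter> N \<subseteq> {0}"
    have av: "\<And>k. k \<le> D \<Longrightarrow> word_set (gram_supp S) k \<inter> N \<subseteq> {0}" using av' by blast
    interpret finite_quotient N R p n e by (rule fq)
    obtain f where f: "\<And>i. i < n \<Longrightarrow> 0 \<le> f i \<and> f i \<le> gram_norm p S A"
      and tr: "\<And>k. word_set (gram_supp S) k \<inter> N \<subseteq> {0} \<Longrightarrow>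
        complex_of_real (\<Sum>i<n. f i ^ k) = of_nat (card R) * trN p (mpow p (gram p A) k)"
      and dt: "\<And>c. det (hadj (qmat A) * qmat A + complex_of_real c \<cdot>\<^sub>m 1\<^sub>m n) = complex_of_real (\<Prod>i<n. f i + c)"
      using gram_eigenvalues[OF A] by blast
    have tr': "(\<Sum>i<n. f i ^ k) = card R * Re (trN p (mpow p (gram p A) k))" if "k \<le> D" for k
      using arg_cong[OF tr[OF av[OF that]], of Re] by (simp del: of_real_sum)
    have pos: "0 < f i + \<epsilon>" if "i < n" for i using f[OF that] e by linarith
    have nz: "f i + \<epsilon> \<noteq> 0" if "i \<in> {..<n}" for i using pos[of i] that by simp
    have "ln (Re (det (hadj (qmat A) * qmat A + complex_of_real \<epsilon> \<cdot>\<^sub>m 1\<^sub>m n))) = (\<Sum>i<n. ln (f i + \<epsilon>))"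
      unfolding dt Re_complex_of_real by (rule ln_prod) (use pos nz in auto)
    moreover have "(\<Sum>k\<le>D. a k * Re (trN p (mpow p (gram p A) k))) = (\<Sum>i<n. \<Sum>k\<le>D. a k * f i ^ k) / card R"
    proof -
      have "(\<Sum>i<n. \<Sum>k\<le>D. a k * f i ^ k) = (\<Sum>k\<le>D. a k * (\<Sum>i<n. f i ^ k))"
        by (subst sum.swap) (simp add: sum_distrib_left)
      also have "\<dots> = card R * (\<Sum>k\<le>D. a k * Re (trN p (mpow p (gram p A) k)))"
        by (simp add: tr' sum_distrib_left mult_ac)
      finally show ?thesis using card_R_pos by simp
    qed
    ultimately have "\<bar>ln (Re (det (hadj (qmat A) * qmat A + complex_of_real \<epsilon> \<cdot>\<^sub>m 1\<^sub>m n))) / card R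
         - (\<Sum>k\<le>D. a k * Re (trN p (mpow p (gram p A) k)))\<bar>
        = \<bar>\<Sum>i<n. ln (f i + \<epsilon>) - (\<Sum>k\<le>D. a k * f i ^ k)\<bar> / card R"
      by (simp add: sum_subtractf diff_divide_distrib[symmetric])
    also have "\<dots> \<le> (\<Sum>i<n. \<delta> / p) / card R"
      using f le a by (intro divide_right_mono order.trans[OF sum_abs] sum_mono) (auto intro: order_trans)
    also have "\<dots> = \<delta>" using p card_R_pos by (simp add: n_eq)
    finally show "\<bar>ln (Re (det (hadj (qmat A) * qmat A + complex_of_real \<epsilon> \<cdot>\<^sub>m 1\<^sub>m n))) / card R
         - (\<Sum>k\<le>D. a k * Re (trN p (mpow p (gram p A) k)))\<bar> \<le> \<delta>" .
  qed
qed

text \<open>With one support for all parameters, coefficients of products are finite sums over a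
  fixed range, so continuity is inherited termwise.\<close>

definition continuous_family :: "'a::topological_space set \<Rightarrow> 'g set \<Rightarrow> ('a \<Rightarrow> 'g cgmat) \<Rightarrow> bool" where
  "continuous_family X S A \<longleftrightarrow> (\<forall>z. msupp S (A z)) \<and> (\<forall>i j g. continuous_on X (\<lambda>z. A z i j g))"

lemma continuous_family_mmult:
  assumes "continuous_family X S A" "continuous_family X T B"
  shows "continuous_family X (addset S T) (\<lambda>z. mmult p (A z) (B z))"
proof -
  have B: "msupp T (B z)" for z using assms by (auto simp: continuous_family_def)
  show ?thesis
    unfolding continuous_family_def
  proof (intro conjI allI)
    fix i j g
    show "continuous_on X (\<lambda>z. mmult p (A z) (B z) i j g)"
      unfolding mmult_vmul vmul_eq[OF B] using assms by (intro continuous_intros) (auto simp: continuous_family_def)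
  qed (use assms in \<open>auto simp: continuous_family_def intro: msupp_mmult\<close>)
qed

lemma continuous_family_mstar: "continuous_family X S A \<Longrightarrow> continuous_family X (uminus ` S) (\<lambda>z. mstar (A z))"
  unfolding continuous_family_def
  by (intro conjI allI msupp_mstar) (auto simp: mstar_def grp_star_def intro!: continuous_intros)

lemma continuous_family_gram: "continuous_family X S A \<Longrightarrow> continuous_family X (gram_supp S) (\<lambda>z. gram p (A z))"
  unfolding gram_def gram_supp_def by (intro continuous_family_mmult continuous_family_mstar)

lemma continuous_family_mpow: "continuous_family X S A \<Longrightarrow> continuous_family X (word_set S k) (\<lambda>z. mpow p (A z) k)"
proof (induction k)
  case 0
  then show ?case by (simp add: continuous_family_def msupp_mone)
next
  case (Suc k)
  then show ?case by (simp add: continuous_family_mmult)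
qed

lemma continuous_on_trN_gram: "continuous_family X S A \<Longrightarrow> continuous_on X (\<lambda>z. trN p (mpow p (gram p (A z)) k))"
proof -
  assume "continuous_family X S A"
  then have "continuous_family X (word_set (gram_supp S) k) (\<lambda>z. mpow p (gram p (A z)) k)" by (intro continuous_family_mpow continuous_family_gram)
  then show ?thesis unfolding trN_def by (intro continuous_intros) (auto simp: continuous_family_def)
qed

lemma continuous_on_gram_norm: "continuous_family X S A \<Longrightarrow> continuous_on X (\<lambda>z. gram_norm p S (A z))"
  using continuous_family_gram[of X S A p]
  unfolding gram_norm_def by (intro continuous_intros) (auto simp: continuous_family_def)

lemma continuous_on_logint:
  fixes A :: "'a::topological_space \<Rightarrow> 'g::group_add cgmat"
  assumes rf: "residually_finite_grp TYPE('g)" and p: "0 < p" and A: "continuous_family X S A" and e: "0 < \<epsilon>"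
  shows "continuous_on X (\<lambda>z. logint p (A z) \<epsilon>)"
  unfolding continuous_on_def
proof
  fix z0 assume z0: "z0 \<in> X"
  show "((\<lambda>z. logint p (A z) \<epsilon>) \<longlongrightarrow> logint p (A z0) \<epsilon>) (at z0 within X)"
  proof (rule tendstoI)
    fix \<delta> :: real assume \<delta>: "0 < \<delta>"
    \<comment> \<open>The summand 1 leaves room for a neighbourhood of z0 on which the norm stays
      below K, so one polynomial serves all nearby z. Two approximation errors and the variation of
      P cost \<delta> / 4 each.\<close>
    define K where "K = gram_norm p S (A z0) + 1"
    have K: "0 \<le> K" using gram_norm_nonneg[of p S "A z0"] by (simp add: K_def)
    have \<delta>4: "0 < \<delta> / 4" using \<delta> by simp
    obtain a D where ap: "\<And>S (A :: 'g cgmat). msupp S A \<Longrightarrow> gram_norm p S A \<le> K \<Longrightarrow>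
      \<bar>logint p A \<epsilon> - (\<Sum>k\<le>D. a k * Re (trN p (mpow p (gram p A) k)))\<bar> \<le> \<delta> / 4"
      using logint_approx[OF rf p K e \<delta>4] by blast
    define P where "P z = (\<Sum>k\<le>D. a k * Re (trN p (mpow p (gram p (A z)) k)))" for z
    have "continuous_on X P"
      unfolding P_def by (intro continuous_intros continuous_on_trN_gram[OF A])
    then have "(P \<longlongrightarrow> P z0) (at z0 within X)" using z0 by (simp add: continuous_on_def)
    then have ev1: "\<forall>\<^sub>F z in at z0 within X. dist (P z) (P z0) < \<delta> / 4" using \<delta> by (intro tendstoD) auto
    have "((\<lambda>z. gram_norm p S (A z)) \<longlongrightarrow> gram_norm p S (A z0)) (at z0 within X)"
      using continuous_on_gram_norm[OF A] z0 by (simp add: continuous_on_def)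
    then have ev2: "\<forall>\<^sub>F z in at z0 within X. gram_norm p S (A z) < K"
      by (rule order_tendstoD) (simp add: K_def)
    have sup: "msupp S (A z)" for z using A by (simp add: continuous_family_def)
    have b0: "\<bar>logint p (A z0) \<epsilon> - P z0\<bar> \<le> \<delta> / 4"
      unfolding P_def by (rule ap[OF sup]) (simp add: K_def)
    show "\<forall>\<^sub>F z in at z0 within X. dist (logint p (A z) \<epsilon>) (logint p (A z0) \<epsilon>) < \<delta>"
      using ev1 ev2
    proof eventually_elim
      case (elim z)
      have "\<bar>logint p (A z) \<epsilon> - P z\<bar> \<le> \<delta> / 4"
        unfolding P_def by (rule ap[OF sup]) (use elim in simp)
      then show ?case using b0 elim(1) \<delta> unfolding dist_real_def by linarith
    qed
  qed
qed

section \<open>Weights, unitary characters and holomorphic dependence\<close>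

definition wmul :: "('g \<Rightarrow> complex) \<Rightarrow> 'g cgmat \<Rightarrow> 'g cgmat" where
  "wmul w A = (\<lambda>i j g. w g * A i j g)"

lemma msupp_wmul: "msupp S A \<Longrightarrow> msupp S (wmul w A)"
  by (intro msuppI) (auto simp: wmul_def msuppD)

lemma wmul_wmul: "wmul v (wmul w A) = wmul (\<lambda>g. v g * w g) A"
  by (simp add: wmul_def mult.assoc)

text \<open>Multiplication by a unitary character is a trace-preserving *-automorphism of the group ring.\<close>

lemma trN_gram_character:
  fixes A :: "'g::group_add cgmat"
  assumes unit: "\<And>g. cmod (w g) = 1" and hom: "\<And>a b. w (a + b) = w a * w b"
  shows "trN p (mpow p (mmult p (mstar (wmul w A)) (wmul w A)) k) = trN p (mpow p (mmult p (mstar A) A) k)"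
proof -
  have nz: "w g \<noteq> 0" for g using unit[of g] by auto
  have one: "w 0 = 1" using hom[of 0 0] nz[of 0] by simp
  have mult: "mmult p (wmul w B) (wmul w C) = wmul w (mmult p B C)" for B C
  proof -
    have "conv (\<lambda>g. w g * a g) (\<lambda>g. w g * b g) g = w g * conv a b g" for a b g
    proof -
      have "w (g + - k) * a (g + - k) * (w k * b k) = w g * (a (g + - k) * b k)" for k
      proof -
        have "w g = w (g + - k) * w k" using hom[of "g + - k" k] by simp
        then show ?thesis by (simp only: mult_ac)
      qed
      moreover have "supp (\<lambda>g. w g * b g) = supp b" using nz by (simp add: supp_def)
      ultimately show ?thesis unfolding conv_def by (simp only: sum_distrib_left)
    qed
    then show ?thesis unfolding mmult_def wmul_def by (simp add: sum_distrib_left)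
  qed
  have star: "mstar (wmul w B) = wmul w (mstar B)" for B
  proof -
    have "cnj (w (- g)) = w g" for g
    proof -
      have "w (- g) * cnj (w (- g)) = 1" using complex_norm_square[of "w (- g)"] unit[of "- g"] by simp
      moreover have "w (- g) * w g = 1" using hom[of "- g" g] one by simp
      ultimately show ?thesis using nz[of "- g"] by (metis mult_left_cancel)
    qed
    then show ?thesis by (simp add: mstar_def grp_star_def wmul_def fun_eq_iff)
  qed
  have "mpow p (wmul w B) k = wmul w (mpow p B k)" for B
  proof (induction k)
    case 0
    show ?case by (simp add: wmul_def mone_def one fun_eq_iff)
  next
    case (Suc k)
    then show ?case by (simp add: mult)
  qed
  then show ?thesis unfolding star mult by (simp add: trN_def wmul_def one)
qed

text \<open>\<open>spec_measure\<close> sees a matrix only through its moments, so equal moments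
  give the same defining predicate and hence the same measure.\<close>

lemma logint_character:
  assumes "\<And>g. cmod (w g) = 1" "\<And>a b. w (a + b) = w a * w b"
  shows "logint p (wmul w A) \<epsilon> = logint p A \<epsilon>"
  unfolding logint_def spec_measure_def trN_gram_character[OF assms] ..

lemma holomorphic_det:
  assumes "\<And>z. C z \<in> carrier_mat n n" "\<And>i j. i < n \<Longrightarrow> j < n \<Longrightarrow> (\<lambda>z. C z $$ (i, j)) holomorphic_on X"
  shows "(\<lambda>z. det (C z)) holomorphic_on X"
proof -
  have "(\<lambda>z. \<Sum>q\<in>{q. q permutes {0..<n}}. signof q * (\<Prod>i = 0..<n. C z $$ (i, q i))) holomorphic_on X"
  proof (intro holomorphic_intros)
    fix q i assume "q \<in> {q. q permutes {0..<n}}" "i \<in> {0..<n}"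
    then have "i < n" "q i < n" using permutes_in_image[of q "{0..<n}" i] by auto
    then show "(\<lambda>z. C z $$ (i, q i)) holomorphic_on X" by (rule assms(2))
  qed
  then show ?thesis using assms(1) by (simp add: det_def'[of _ n])
qed

text \<open>With complex weights exp (z h) the functional log det (A_z^* A_z + \<epsilon>) is subharmonic in z and depends
  only on Re z, so it is convex there. Subharmonicity is used at finite quotients, in the form of the maximum principle for
  the holomorphic function det (A_0^* A_z + \<epsilon>), which det_gram_cauchy_schwarz compares with the values at 0 and z.
  The quadratic term of P makes the horizontal sides of a long rectangle harmless.\<close>

lemma logint_midpoint_convex:
  fixes B :: "'g::group_add cgmat"
  assumes rf: "residually_finite_grp TYPE('g)" and p: "0 < p" and B: "msupp S B" and e: "0 < \<epsilon>"
    and h: "\<And>a b. h (a + b) = h a + (h b :: real)"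
  shows "2 * logint p B \<epsilon> \<le> logint p (wmul (\<lambda>g. complex_of_real (exp (h g))) B) \<epsilon>
    + logint p (wmul (\<lambda>g. complex_of_real (exp (- h g))) B) \<epsilon>"
proof (rule ccontr)
  define A where "A z = wmul (\<lambda>g. exp (z * complex_of_real (h g))) B" for z
  define u where "u z = logint p (A z) \<epsilon>" for z
  have A: "msupp S (A z)" for z unfolding A_def by (rule msupp_wmul[OF B])
  have fam: "continuous_family UNIV S A"
    unfolding continuous_family_def using A by (auto simp: A_def wmul_def intro!: continuous_intros)
  \<comment> \<open>The imaginary part of z contributes a unitary character, because h is
    additive.\<close>
  have uRe: "u z = u (complex_of_real (Re z))" for z
  proof -
    define w where "w g = exp (\<i> * complex_of_real (Im z * h g))" for g
    have "A z = wmul w (A (complex_of_real (Re z)))"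
    proof -
      have "z * complex_of_real (h g) = \<i> * complex_of_real (Im z * h g) + complex_of_real (Re z) * complex_of_real (h g)" for g
        by (simp add: complex_eq_iff)
      then show ?thesis unfolding A_def wmul_wmul w_def by (simp add: exp_add)
    qed
    moreover have "cmod (w g) = 1" "w (a + b) = w a * w b" for g a b
      unfolding w_def norm_exp_i_times by (simp_all add: h algebra_simps exp_add)
    ultimately show ?thesis unfolding u_def by (simp add: logint_character)
  qed
  \<comment> \<open>c + \<alpha> Re z interpolates u at -1 and 1. If convexity fails, u exceeds it
    at 0 by 3 \<eta>, which pays for all errors below.\<close>
  define c where "c = (u 1 + u (-1)) / 2"
  define \<alpha> where "\<alpha> = (u 1 - u (-1)) / 2"
  define \<eta> where "\<eta> = (u 0 - c) / 3"
  assume "\<not> ?thesis"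
  moreover have "A 0 = B" "A 1 = wmul (\<lambda>g. complex_of_real (exp (h g))) B" "A (-1) = wmul (\<lambda>g. complex_of_real (exp (- h g))) B"
    by (simp_all add: A_def wmul_def exp_of_real[symmetric])
  ultimately have \<eta>: "0 < \<eta>" unfolding \<eta>_def c_def u_def by simp
  have u1: "u 1 = c + \<alpha>" "u (-1) = c - \<alpha>" "u 0 = c + 3 * \<eta>"
    unfolding c_def \<alpha>_def \<eta>_def by (simp_all add: field_simps)
  have "compact (complex_of_real ` {-1..1})"
    by (intro compact_continuous_image continuous_intros) auto
  moreover have cu: "continuous_on X u" for X
    unfolding u_def using continuous_on_logint[OF rf p fam e] continuous_on_subset by blast
  ultimately have "compact (u ` complex_of_real ` {-1..1})" by (rule compact_continuous_image[rotated])
  then have "bdd_above (u ` complex_of_real ` {-1..1})" by (intro bounded_imp_bdd_above compact_imp_bounded)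
  then obtain M where M: "\<And>s. -1 \<le> s \<Longrightarrow> s \<le> 1 \<Longrightarrow> u (complex_of_real s) \<le> M"
    unfolding bdd_above_def by force
  \<comment> \<open>The rectangle is made so tall that - \<eta> b^2 outweighs any value of u -
    \<alpha> Re z on its horizontal sides.\<close>
  define b where "b = \<bar>M + \<bar>\<alpha>\<bar> - c\<bar> / \<eta> + 1"
  have b: "1 \<le> b" "M + \<bar>\<alpha>\<bar> - \<eta> * b\<^sup>2 \<le> c"
  proof -
    show b1: "1 \<le> b" using \<eta> by (simp add: b_def)
    have "\<bar>M + \<bar>\<alpha>\<bar> - c\<bar> \<le> \<eta> * b" using \<eta> by (simp add: b_def field_simps)
    also have "\<dots> \<le> \<eta> * b\<^sup>2" using \<eta> b1 by (intro mult_left_mono self_le_power) auto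
    finally show "M + \<bar>\<alpha>\<bar> - \<eta> * b\<^sup>2 \<le> c" by linarith
  qed
  define Q where "Q = cbox (Complex (-1) (-b)) (Complex 1 b)"
  have inQ: "z \<in> Q \<longleftrightarrow> -1 \<le> Re z \<and> Re z \<le> 1 \<and> -b \<le> Im z \<and> Im z \<le> b" for z
    by (auto simp: Q_def in_cbox_complex_iff)
  have "compact ((\<lambda>z. gram_norm p S (A z)) ` Q)"
    unfolding Q_def by (intro compact_continuous_image continuous_on_subset[OF continuous_on_gram_norm[OF fam]]) auto
  then have "bdd_above ((\<lambda>z. gram_norm p S (A z)) ` Q)" by (intro bounded_imp_bdd_above compact_imp_bounded)
  then obtain K0 where K0: "\<And>z. z \<in> Q \<Longrightarrow> gram_norm p S (A z) \<le> K0"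
    unfolding bdd_above_def by force
  have zeroQ: "0 \<in> Q" using b by (simp add: inQ)
  have K: "0 \<le> K0" using K0[OF zeroQ] gram_norm_nonneg[of p S "A 0"] by linarith
  have \<eta>4: "0 < \<eta> / 4" using \<eta> by simp
  obtain a D where
    ap1: "\<And>S (A :: 'g cgmat). msupp S A \<Longrightarrow> gram_norm p S A \<le> K0 \<Longrightarrow>
      \<bar>logint p A \<epsilon> - (\<Sum>k\<le>D. a k * Re (trN p (mpow p (gram p A) k)))\<bar> \<le> \<eta> / 4"
    and ap2: "\<And>S (A :: 'g cgmat) N R n e. msupp S A \<Longrightarrow> gram_norm p S A \<le> K0 \<Longrightarrow> finite_quotient N R p n e \<Longrightarrow>
      (\<And>k. k \<le> D \<Longrightarrow> word_set (gram_supp S) k \<inter> N \<subseteq> {0}) \<Longrightarrow>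
      \<bar>ln (Re (det (hadj (finite_quotient.qmat N n e A) * finite_quotient.qmat N n e A + complex_of_real \<epsilon> \<cdot>\<^sub>m 1\<^sub>m n))) / card R
         - (\<Sum>k\<le>D. a k * Re (trN p (mpow p (gram p A) k)))\<bar> \<le> \<eta> / 4"
    using logint_approx[OF rf p K e \<eta>4] by blast
  have fin: "finite (gram_supp S)" using msupp_gram[OF B] by (auto simp: msupp_def)
  obtain N R :: "'g set" and n en where fq: "finite_quotient N R p n en"
    and av: "\<And>k. k \<le> D \<Longrightarrow> word_set (gram_supp S) k \<inter> N \<subseteq> {0}"
    using finite_quotient_word_set[OF rf fin] by blast
  interpret finite_quotient N R p n en by (rule fq)
  define m where "m = real (card R)"
  have m: "0 < m" using card_R_pos by (simp add: m_def)
  define C where "C z = qmat (A z)" for z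
  have C [simp]: "C z \<in> carrier_mat n n" for z by (simp add: C_def)
  define d where "d z = Re (det (hadj (C z) * C z + complex_of_real \<epsilon> \<cdot>\<^sub>m 1\<^sub>m n))" for z
  have dpos: "0 < d z" for z unfolding d_def by (rule det_gram_add_pos[OF C e])
  define v where "v z = ln (d z) / m" for z
  have dv: "d z = exp (m * v z)" for z using dpos m by (simp add: v_def)
  have uv: "\<bar>v z - u z\<bar> \<le> \<eta> / 2" if "z \<in> Q" for z
    using ap1[OF A K0[OF that]] ap2[OF A K0[OF that] fq av]
    unfolding v_def d_def C_def m_def u_def by linarith
  \<comment> \<open>Re P removes the slope \<alpha>. Its quadratic term has real part \<eta> (x^2 -
    y^2 - 1) at z = x + i y: at most 0 on the vertical sides, at most - \<eta> b^2 on the horizontal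
    ones, and only - \<eta> at 0.\<close>
  define P where "P z = - complex_of_real \<alpha> * z + complex_of_real \<eta> * (z\<^sup>2 - 1)" for z
  have ReP: "Re (P z) = - \<alpha> * Re z + \<eta> * ((Re z)\<^sup>2 - (Im z)\<^sup>2 - 1)" for z
    by (simp add: P_def power2_eq_square)
  \<comment> \<open>The exponent carries m / 2 because the Cauchy-Schwarz bound is for the square:
    |F z|^2 is at most d 0 * d z * exp (m Re (P z)), and d = exp (m v).\<close>
  define F where "F z = det (hadj (C 0) * C z + complex_of_real \<epsilon> \<cdot>\<^sub>m 1\<^sub>m n) * exp (complex_of_real (m / 2) * P z)" for z
  have "F holomorphic_on UNIV"
  proof -
    have "(\<lambda>z. (hadj (C 0) * C z + complex_of_real \<epsilon> \<cdot>\<^sub>m 1\<^sub>m n) $$ (i, j)) holomorphic_on UNIV" if ij: "i < n" "j < n" for i j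
    proof -
      have ent: "(\<lambda>z. C z $$ (k, j)) holomorphic_on UNIV" if "k < n" for k
        unfolding C_def qmat_index[OF A that ij(2)] unfolding A_def wmul_def by (intro holomorphic_intros)
      have "(\<lambda>z. (\<Sum>k = 0..<n. cnj (C 0 $$ (k, i)) * C z $$ (k, j)) + (if i = j then complex_of_real \<epsilon> else 0)) holomorphic_on UNIV"
        by (intro holomorphic_intros ent) auto
      moreover have "(hadj (C 0) * C z + complex_of_real \<epsilon> \<cdot>\<^sub>m 1\<^sub>m n) $$ (i, j)
        = (\<Sum>k = 0..<n. cnj (C 0 $$ (k, i)) * C z $$ (k, j)) + (if i = j then complex_of_real \<epsilon> else 0)" for z
        using ij by (simp add: scalar_prod_def C_def)
      ultimately show ?thesis by simp
    qed
    then have "(\<lambda>z. det (hadj (C 0) * C z + complex_of_real \<epsilon> \<cdot>\<^sub>m 1\<^sub>m n)) holomorphic_on UNIV"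
      by (intro holomorphic_det[of _ n]) (auto intro!: mult_carrier_mat[of _ n n])
    then show ?thesis unfolding F_def P_def by (intro holomorphic_intros)
  qed
  have bound: "cmod (F z) \<le> exp (m / 2 * (v 0 + c + \<eta> / 2))" if z: "z \<in> frontier Q" for z
  proof -
    have zQ: "z \<in> Q" and edge: "Re z = 1 \<or> Re z = -1 \<or> \<bar>Im z\<bar> = b"
      using z b unfolding Q_def frontier_cbox
      by (auto simp: in_cbox_complex_iff in_box_complex_iff split: if_splits)
    have s: "-1 \<le> Re z" "Re z \<le> 1" using zQ by (auto simp: inQ)
    have uP: "u z + Re (P z) \<le> c"
    proof -
      consider "Re z = 1" | "Re z = -1" | "\<bar>Im z\<bar> = b" using edge by blast
      then show ?thesis
      proof cases
        case 1
        then show ?thesis unfolding uRe[of z] ReP using u1 \<eta> by simp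
      next
        case 2
        then show ?thesis unfolding uRe[of z] ReP using u1 \<eta> by simp
      next
        case 3
        then have im: "(Im z)\<^sup>2 = b\<^sup>2" by (metis power2_abs)
        have "(Re z)\<^sup>2 \<le> 1" using s by (simp add: abs_square_le_1 abs_le_iff)
        then have "\<eta> * ((Re z)\<^sup>2 - (Im z)\<^sup>2 - 1) \<le> \<eta> * (- b\<^sup>2)"
          using \<eta> im by (intro mult_left_mono) auto
        moreover have "- \<alpha> * Re z \<le> \<bar>\<alpha>\<bar>"
        proof -
          have "- \<alpha> * Re z \<le> \<bar>\<alpha>\<bar> * \<bar>Re z\<bar>" by (metis abs_ge_self abs_minus_cancel abs_mult)
          also have "\<dots> \<le> \<bar>\<alpha>\<bar> * 1" using s by (intro mult_left_mono) auto
          finally show ?thesis by simp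
        qed
        moreover have "u z \<le> M" unfolding uRe[of z] using M s by blast
        ultimately show ?thesis unfolding ReP using b(2) by simp
      qed
    qed
    have "(cmod (F z))\<^sup>2 = (cmod (det (hadj (C 0) * C z + complex_of_real \<epsilon> \<cdot>\<^sub>m 1\<^sub>m n)))\<^sup>2 * (exp (m / 2 * Re (P z)))\<^sup>2"
      unfolding F_def norm_mult by (simp add: power_mult_distrib norm_exp_eq_Re)
    also have "\<dots> \<le> (d 0 * d z) * (exp (m / 2 * Re (P z)))\<^sup>2"
      unfolding d_def by (intro mult_right_mono det_gram_cauchy_schwarz[OF C C e]) auto
    also have "\<dots> = (exp (m / 2 * (v 0 + (v z + Re (P z)))))\<^sup>2"
      unfolding dv by (simp add: power2_eq_square exp_add[symmetric] algebra_simps)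
    also have "\<dots> \<le> (exp (m / 2 * (v 0 + c + \<eta> / 2)))\<^sup>2"
    proof -
      have "v z + Re (P z) \<le> c + \<eta> / 2" using uv[OF zQ] uP by linarith
      then show ?thesis using m by (intro power_mono) (auto intro!: mult_left_mono)
    qed
    finally show ?thesis by (rule power2_le_imp_le) simp
  qed
  have "cmod (F 0) \<le> exp (m / 2 * (v 0 + c + \<eta> / 2))"
  proof (rule maximum_modulus_frontier[OF _ _ _ bound zeroQ])
    show "F holomorphic_on interior Q" "continuous_on (closure Q) F"
      using \<open>F holomorphic_on UNIV\<close> holomorphic_on_subset holomorphic_on_imp_continuous_on continuous_on_subset by blast+
  qed (auto simp: Q_def)
  moreover have "cmod (F 0) = exp (m / 2 * (2 * v 0 - \<eta>))"
  proof -
    have "cmod (det (hadj (C 0) * C 0 + complex_of_real \<epsilon> \<cdot>\<^sub>m 1\<^sub>m n)) = d 0"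
      unfolding d_def using det_gram_add_pos[OF C e, of 0] by (simp add: cmod_def)
    then have "cmod (F 0) = exp (m * v 0) * exp (m / 2 * Re (P 0))"
      unfolding F_def norm_mult by (simp add: norm_exp_eq_Re dv)
    also have "Re (P 0) = - \<eta>" by (simp add: ReP)
    finally show ?thesis by (simp add: exp_add[symmetric] algebra_simps)
  qed
  ultimately have "m / 2 * (2 * v 0 - \<eta>) \<le> m / 2 * (v 0 + c + \<eta> / 2)" by simp
  \<comment> \<open>This gives v 0 \<le> c + 3/2 \<eta>, whereas v 0 \<ge> u 0 - \<eta> / 2 = c +
    5/2 \<eta>.\<close>
  then have "2 * v 0 - \<eta> \<le> v 0 + c + \<eta> / 2" using m by simp
  then show False using uv[OF zeroQ] u1(3) \<eta> by linarith
qed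

section \<open>Continuity of the determinant\<close>

lemma mmult_cong:
  assumes "\<And>i j. i < p \<Longrightarrow> j < p \<Longrightarrow> A i j = A' i j" "\<And>i j. i < p \<Longrightarrow> j < p \<Longrightarrow> B i j = B' i j"
    and "i < p" "j < p"
  shows "mmult p A B i j = mmult p A' B' i j"
  unfolding mmult_def using assms by (intro ext sum.cong) auto

lemma mpow_cong:
  assumes "\<And>i j. i < p \<Longrightarrow> j < p \<Longrightarrow> A i j = A' i j" "i < p" "j < p"
  shows "mpow p A k i j = mpow p A' k i j"
  using assms(2,3)
proof (induction k arbitrary: i j)
  case (Suc k)
  then show ?case using assms(1) by (auto intro!: mmult_cong)
qed simp

text \<open>Needed to replace the given matrix by one that vanishes outside the p x p block, since
  \<open>msupp\<close> bounds the supports at all indices.\<close>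

lemma detr_cong:
  assumes eq: "\<And>i j. i < p \<Longrightarrow> j < p \<Longrightarrow> A i j = B i j"
  shows "detr p A = detr p B"
proof -
  have gr: "mmult p (mstar A) A i j = mmult p (mstar B) B i j" if "i < p" "j < p" for i j
    by (rule mmult_cong[OF _ _ that]) (simp_all add: mstar_def eq)
  have "mpow p (mmult p (mstar A) A) k i i = mpow p (mmult p (mstar B) B) k i i" if "i < p" for k i
    by (rule mpow_cong[OF gr that that])
  then have "trN p (mpow p (mmult p (mstar A) A) k) = trN p (mpow p (mmult p (mstar B) B) k)" for k
    by (simp add: trN_def)
  then have "spec_measure p A = spec_measure p B" by (simp add: spec_measure_def)
  moreover have "op_injective p A \<longleftrightarrow> op_injective p B"
    unfolding op_injective_def using eq by simp
  ultimately show ?thesis by (simp add: detr_def det_class_def detFK_def)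
qed

text \<open>Midpoint convexity, exponentiated and taken to the limit. The product form remains
  meaningful where a determinant is 0 and its logarithm would be minus infinity.\<close>

lemma detr_square_le_twists:
  fixes B :: "'g::group_add cgmat"
  assumes rf: "residually_finite_grp TYPE('g)" and p: "0 < p" and B: "msupp S B"
    and h: "\<And>a b. h (a + b) = h a + (h b :: real)"
  shows "(detr p B)\<^sup>2 \<le> detr p (wmul (\<lambda>g. complex_of_real (exp (h g))) B) * detr p (wmul (\<lambda>g. complex_of_real (exp (- h g))) B)"
proof (rule LIMSEQ_le)
  let ?P = "wmul (\<lambda>g. complex_of_real (exp (h g))) B" and ?M = "wmul (\<lambda>g. complex_of_real (exp (- h g))) B"
  let ?e = "\<lambda>n. 1 / real (Suc n)"
  show "(\<lambda>n. (exp (1 / 2 * logint p B (?e n)))\<^sup>2) \<longlonglongrightarrow> (detr p B)\<^sup>2"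
    by (intro tendsto_power detr_limit[OF rf B p])
  show "(\<lambda>n. exp (1 / 2 * logint p ?P (?e n)) * exp (1 / 2 * logint p ?M (?e n))) \<longlonglongrightarrow> detr p ?P * detr p ?M"
    by (intro tendsto_mult detr_limit[OF rf msupp_wmul[OF B] p])
  have "(exp (1 / 2 * logint p B (?e n)))\<^sup>2 \<le> exp (1 / 2 * logint p ?P (?e n)) * exp (1 / 2 * logint p ?M (?e n))" for n
  proof -
    have "2 * logint p B (?e n) \<le> logint p ?P (?e n) + logint p ?M (?e n)"
      by (rule logint_midpoint_convex[OF rf p B _ h]) simp
    then show ?thesis by (simp add: power2_eq_square exp_add[symmetric])
  qed
  then show "\<exists>N. \<forall>n\<ge>N. (exp (1 / 2 * logint p B (?e n)))\<^sup>2 \<le> exp (1 / 2 * logint p ?P (?e n)) * exp (1 / 2 * logint p ?M (?e n))"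
    by blast
qed

text \<open>The pair (\<phi>, t) enters only through \<psi> = ln t * \<phi>; in this coordinate
  twists compose additively, as \<open>htwist_htwist\<close> states.\<close>

definition htwist :: "('g \<Rightarrow> real) \<Rightarrow> 'g cgmat \<Rightarrow> 'g cgmat" where
  "htwist \<psi> A = wmul (\<lambda>g. complex_of_real (exp (\<psi> g))) A"

lemma mtwist_eq_htwist: "0 < t \<Longrightarrow> mtwist \<phi> t A = htwist (\<lambda>g. ln t * \<phi> g) A"
  by (simp add: mtwist_def twist_def htwist_def wmul_def powr_def mult.commute)

lemma htwist_htwist: "htwist \<psi> (htwist \<xi> A) = htwist (\<lambda>g. \<xi> g + \<psi> g) A"
  by (simp add: htwist_def wmul_wmul exp_add mult.commute)

lemma htwist_0: "htwist (\<lambda>_. 0) A = A"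
  by (simp add: htwist_def wmul_def)

lemma detr_htwist_square_le:
  fixes A :: "'g::group_add cgmat"
  assumes rf: "residually_finite_grp TYPE('g)" and p: "0 < p" and A: "msupp S A" and h: "h \<in> hom_real"
  shows "(detr p (htwist \<psi> A))\<^sup>2 \<le> detr p (htwist (\<lambda>g. \<psi> g + h g) A) * detr p (htwist (\<lambda>g. \<psi> g - h g) A)"
proof -
  have "msupp S (htwist \<psi> A)" unfolding htwist_def by (rule msupp_wmul[OF A])
  from detr_square_le_twists[OF rf p this, of h] h
  have "(detr p (htwist \<psi> A))\<^sup>2 \<le> detr p (htwist h (htwist \<psi> A)) * detr p (htwist (\<lambda>g. - h g) (htwist \<psi> A))"
    by (simp add: hom_real_def htwist_def)
  then show ?thesis by (simp add: htwist_htwist)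
qed

lemma detr_htwist_pos:
  fixes A :: "'g::group_add cgmat"
  assumes rf: "residually_finite_grp TYPE('g)" and p: "0 < p" and A: "msupp S A" and h: "h \<in> hom_real"
    and nz: "detr p A \<noteq> 0"
  shows "0 < detr p (htwist h A)"
proof -
  have "(detr p A)\<^sup>2 \<le> detr p (htwist h A) * detr p (htwist (\<lambda>g. - h g) A)"
    using detr_htwist_square_le[OF rf p A h, of "\<lambda>_. 0"] by (simp add: htwist_0)
  moreover have "0 < (detr p A)\<^sup>2" using nz by simp
  ultimately have "0 < detr p (htwist h A) * detr p (htwist (\<lambda>g. - h g) A)" by linarith
  then show ?thesis using detr_nonneg[of p "htwist h A"] by (simp add: zero_less_mult_iff)
qed

text \<open>A single \<epsilon> with regularised value below c at \<psi>0 suffices: that value is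
  continuous and dominates the determinant. Continuity in the product topology is available because
  each coefficient involves one coordinate of \<psi>.\<close>

lemma detr_htwist_upper:
  fixes A :: "'g::group_add cgmat"
  assumes rf: "residually_finite_grp TYPE('g)" and p: "0 < p" and A: "msupp S A" and c: "detr p (htwist \<psi>0 A) < c"
  shows "\<forall>\<^sub>F \<psi> in at \<psi>0. detr p (htwist \<psi> A) < c"
proof -
  have sup: "msupp S (htwist \<psi> A)" for \<psi> unfolding htwist_def by (rule msupp_wmul[OF A])
  have "\<forall>\<^sub>F n in sequentially. exp (1 / 2 * logint p (htwist \<psi>0 A) (1 / real (Suc n))) < c"
    by (rule order_tendstoD(2)[OF detr_limit[OF rf sup p] c])
  then obtain n where n: "exp (1 / 2 * logint p (htwist \<psi>0 A) (1 / real (Suc n))) < c"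
    by (auto simp: eventually_sequentially)
  have "continuous_family UNIV S (\<lambda>\<psi>. htwist \<psi> A)"
    unfolding continuous_family_def using sup
    by (auto simp: htwist_def wmul_def intro!: continuous_intros continuous_on_product_coordinates)
  from continuous_on_logint[OF rf p this, of "1 / real (Suc n)"]
  have "continuous_on UNIV (\<lambda>\<psi>. exp (1 / 2 * logint p (htwist \<psi> A) (1 / real (Suc n))))"
    by (intro continuous_intros) auto
  then have "((\<lambda>\<psi>. exp (1 / 2 * logint p (htwist \<psi> A) (1 / real (Suc n)))) \<longlongrightarrow> exp (1 / 2 * logint p (htwist \<psi>0 A) (1 / real (Suc n)))) (at \<psi>0)"
    by (simp add: continuous_on_def del: of_nat_Suc)
  then have "\<forall>\<^sub>F \<psi> in at \<psi>0. exp (1 / 2 * logint p (htwist \<psi> A) (1 / real (Suc n))) < c"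
    using n by (rule order_tendstoD(2))
  then show ?thesis
  proof eventually_elim
    case (elim \<psi>)
    have "detr p (htwist \<psi> A) \<le> exp (1 / 2 * logint p (htwist \<psi> A) (1 / real (Suc n)))"
      by (rule detr_le_exp_logint[OF rf sup p]) simp
    then show ?case using elim by linarith
  qed
qed

text \<open>Upper semicontinuity and V(\<psi>0)^2 \<le> V(\<psi>) V(2 \<psi>0 - \<psi>) together force lower semicontinuity.\<close>

lemma continuous_on_detr_htwist:
  fixes A :: "'g::group_add cgmat"
  assumes rf: "residually_finite_grp TYPE('g)" and p: "0 < p" and A: "msupp S A" and nz: "detr p A \<noteq> 0"
  shows "continuous_on hom_real (\<lambda>\<psi>. detr p (htwist \<psi> A))"
  unfolding continuous_on_def
proof
  fix \<psi>0 :: "'g \<Rightarrow> real" assume \<psi>0: "\<psi>0 \<in> hom_real"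
  define V where "V \<psi> = detr p (htwist \<psi> A)" for \<psi>
  have pos: "0 < V \<psi>" if "\<psi> \<in> hom_real" for \<psi>
    unfolding V_def by (rule detr_htwist_pos[OF rf p A that nz])
  have V0: "0 < V \<psi>0" by (rule pos[OF \<psi>0])
  have up: "\<forall>\<^sub>F \<psi> in nhds \<psi>0. V \<psi> < c" if "V \<psi>0 < c" for c
    using detr_htwist_upper[OF rf p A, of \<psi>0 c] that
    unfolding V_def eventually_nhds_conv_at by blast
  have hom: "(\<lambda>g. a * \<psi> g + b * \<xi> g) \<in> hom_real" if "\<psi> \<in> hom_real" "\<xi> \<in> hom_real" for a b and \<psi> \<xi> :: "'g \<Rightarrow> real"
    using that by (simp add: hom_real_def algebra_simps)
  \<comment> \<open>Reflection in \<psi>0. It fixes \<psi>0 and is continuous, so the upper bound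
    near \<psi>0 also holds at the reflected point.\<close>
  define r where "r \<psi> = (\<lambda>g. 2 * \<psi>0 g + (-1) * \<psi> g)" for \<psi> :: "'g \<Rightarrow> real"
  have "continuous_on UNIV r"
    unfolding r_def
    by (intro continuous_on_coordinatewise_then_product continuous_intros continuous_on_product_coordinates)
  then have "(r \<longlongrightarrow> r \<psi>0) (at \<psi>0)" by (simp add: continuous_on_def)
  then have "filterlim r (nhds \<psi>0) (at \<psi>0)" by (simp add: r_def)
  then have rlim: "filterlim r (nhds \<psi>0) (at \<psi>0 within hom_real)"
    by (rule filterlim_mono) (auto intro: at_le)
  have hr: "\<forall>\<^sub>F \<psi> in at \<psi>0 within hom_real. \<psi> \<in> hom_real"
    by (simp add: eventually_at_filter)
  show "((\<lambda>\<psi>. detr p (htwist \<psi> A)) \<longlongrightarrow> detr p (htwist \<psi>0 A)) (at \<psi>0 within hom_real)"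
    unfolding V_def[symmetric]
  proof (rule order_tendstoI)
    fix c assume "V \<psi>0 < c"
    then show "\<forall>\<^sub>F \<psi> in at \<psi>0 within hom_real. V \<psi> < c"
      using up[of c] by (auto simp: eventually_at_filter elim: eventually_mono)
  next
    fix c assume c: "c < V \<psi>0"
    show "\<forall>\<^sub>F \<psi> in at \<psi>0 within hom_real. c < V \<psi>"
    proof (cases "c \<le> 0")
      case True
      show ?thesis using hr by eventually_elim (use pos True in force)
    next
      case False
      \<comment> \<open>For 0 < c < V \<psi>0 the threshold (V \<psi>0)^2 / c exceeds V \<psi>0, so
        upper semicontinuity keeps V (r \<psi>) below it; the square inequality then gives V \<psi>
        > c.\<close>
      then have "V \<psi>0 * c < V \<psi>0 * V \<psi>0" using c V0 by simp
      then have "V \<psi>0 < (V \<psi>0)\<^sup>2 / c" using False by (simp add: field_simps power2_eq_square)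
      from rlim[unfolded filterlim_iff, rule_format, OF up[OF this]]
      have "\<forall>\<^sub>F \<psi> in at \<psi>0 within hom_real. V (r \<psi>) < (V \<psi>0)\<^sup>2 / c" .
      then show ?thesis using hr
      proof eventually_elim
        case (elim \<psi>)
        have h: "(\<lambda>g. 1 * \<psi> g + (-1) * \<psi>0 g) \<in> hom_real" using hom elim(2) \<psi>0 by blast
        have "(V \<psi>0)\<^sup>2 \<le> V \<psi> * V (r \<psi>)"
          using detr_htwist_square_le[OF rf p A h, of \<psi>0] by (simp add: V_def r_def)
        also have "\<dots> < V \<psi> * ((V \<psi>0)\<^sup>2 / c)"
          using elim pos by (intro mult_strict_left_mono) auto
        finally have "(V \<psi>0)\<^sup>2 * c < (V \<psi>0)\<^sup>2 * V \<psi>" using False by (simp add: field_simps)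
        then show ?case using V0 by simp
      qed
    qed
  qed
qed

theorem theorem5p9:
  fixes \<Omega> :: "'g::group_add cgmat" and p :: nat
  assumes "finitely_generated_grp TYPE('g)"
    and "residually_finite_grp TYPE('g)"
    and "mat_CG p \<Omega>"
    and "detr p \<Omega> \<noteq> 0"
  shows "continuous_on (hom_real \<times> {0<..})
           (\<lambda>(\<phi>, t). detr p (mtwist \<phi> t \<Omega>))"
proof (cases "p = 0")
  \<comment> \<open>All 0 x 0 matrices agree entrywise, so the map is constant. Eigenvalue averages
    at a quotient would divide by n = 0 here.\<close>
  case True
  then have "(\<lambda>(\<phi>, t). detr p (mtwist \<phi> t \<Omega>)) = (\<lambda>_. detr p \<Omega>)"
    by (auto intro!: detr_cong)
  then show ?thesis by simp
next
  case False
  then have p: "0 < p" by simp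
  \<comment> \<open>Only entries below p are known to be finitely supported; zero padding gives one
    finite support for all indices.\<close>
  define A where "A i j = (if i < p \<and> j < p then \<Omega> i j else (\<lambda>_. 0))" for i j
  define S where "S = (\<Union>i<p. \<Union>j<p. supp (\<Omega> i j))"
  have "finite S" unfolding S_def using assms(3) by (auto simp: mat_CG_def in_CG_def)
  then have A: "msupp S A" by (intro msuppI) (auto simp: A_def S_def supp_def)
  have detA: "detr p (mtwist \<phi> t \<Omega>) = detr p (mtwist \<phi> t A)" for \<phi> t
    by (rule detr_cong) (simp add: mtwist_def A_def)
  have "detr p A = detr p \<Omega>" by (rule detr_cong) (simp add: A_def)
  then have nz: "detr p A \<noteq> 0" using assms(4) by simp
  \<comment> \<open>The map to the logarithmic coordinate; continuity in (\<phi>, t) follows by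
    composing with it.\<close>
  define q where "q = (\<lambda>(\<phi> :: 'g \<Rightarrow> real, t :: real) g. ln t * \<phi> g)"
  have "continuous_on (hom_real \<times> {0<..}) q"
  proof (rule continuous_on_coordinatewise_then_product)
    fix g
    have "continuous_on (hom_real \<times> {0<..}) (\<lambda>x. ln (snd x) * (fst x :: 'g \<Rightarrow> real) g)"
      by (intro continuous_intros continuous_on_compose2[OF continuous_on_product_coordinates]) auto
    then show "continuous_on (hom_real \<times> {0<..}) (\<lambda>x. q x g)"
      by (simp add: q_def case_prod_unfold)
  qed
  moreover have "q ` (hom_real \<times> {0<..}) \<subseteq> hom_real"
    by (auto simp: q_def hom_real_def algebra_simps)
  ultimately have "continuous_on (hom_real \<times> {0<..}) (\<lambda>x. detr p (htwist (q x) A))"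
    by (intro continuous_on_compose2[OF continuous_on_detr_htwist[OF assms(2) p A nz]])
  moreover have "detr p (htwist (q x) A) = (case x of (\<phi>, t) \<Rightarrow> detr p (mtwist \<phi> t \<Omega>))"
    if "x \<in> hom_real \<times> {0<..}" for x
    using that by (auto simp: detA q_def mtwist_eq_htwist)
  ultimately show ?thesis by (simp cong: continuous_on_cong)
qed

end
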